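(* Assume that $K_n\to\infty$ as $n\to\infty$, that there is an absolute constant $C>0$ such that $\|u^n\|+\|v^n\|\le C$ for all $n$, and that $\liminf_{n\to\infty}|\langle v^n,u^n\rangle|>1$. For any fixed $\varepsilon\in\left(0,(\liminf_n|\langle v^n,u^n\rangle|-1)/2\right)$, let $\sigma^+_\varepsilon(Y^n)=\sigma(Y^n)\cap\{z\in\mathbb C:|z|\ge1+\varepsilon\}$. Then $$\mathbb P\left\{|\sigma^+_\varepsilon(Y^n)|=1\right\}\xrightarrow[n\to\infty]{}1 .$$ When the event $\{|\sigma^+_\varepsilon(Y^n)|=1\}$ is realized, let $\lambda_{\max}(Y^n)$ be the unique eigenvalue of $Y^n$ with the largest modulus; otherwise set $\lambda_{\max}(Y^n)=0$. Then $$\lambda_{\max}(Y^n)-\langle v^n,u^n\rangle\to0\quad\text{in probability as } n\to\infty .$$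
   Context: Model. Let $\chi$ be a complex-valued random variable with $\mathbb{E}\chi=0$ and $\mathbb{E}|\chi|^2=1$. For each $n\ge1$, $A^n=(A^n_{ij})_{i,j=1}^n$ is a random matrix with i.i.d. entries distributed as $\chi$. $(K_n)$ is a sequence of positive integers with $K_n\le n$; $B^n=(B^n_{ij})$ is an $n\times n$ matrix with i.i.d. Bernoulli ($\{0,1\}$-valued) entries with $\mathbb P(B^n_{11}=1)=K_n/n$, independent of $A^n$. The matrix $X^n$ has entries $X^n_{ij}=\frac1{\sqrt{K_n}}B^n_{ij}A^n_{ij}$. Let $u^n,v^n\in\mathbb C^n$ be deterministic vectors, $E^n=u^n(v^n)^\star$ (rank-one deformation) and $Y^n=X^n+E^n$. Notation. $\star$ is conjugate transpose, $\langle u,v\rangle=u^\star v$, $\|\cdot\|$ is the Euclidean norm, $\sigma(M)$ is the spectrum of $M$, and cardinalities $|\cdot|$ of sets of eigenvalues count (algebraic) multiplicities. *)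

theory Defs
  imports
    "HOL-Probability.Probability"
    "Jordan_Normal_Form.Spectral_Radius"
begin

unbundle no vec_syntax

definition vnorm :: "complex vec \<Rightarrow> real" where
  "vnorm v = sqrt (\<Sum>i<dim_vec v. (cmod (v $ i))\<^sup>2)"

text \<open>The product is antilinear in the first argument, whereas the library's
  \<open>x \<bullet>c y\<close> conjugates the second one.\<close>

definition hinner :: "complex vec \<Rightarrow> complex vec \<Rightarrow> complex" where
  "hinner u v = v \<bullet>c u"

definition rank_one :: "complex vec \<Rightarrow> complex vec \<Rightarrow> complex mat" where
  "rank_one u v = mat (dim_vec u) (dim_vec v) (\<lambda>(i, j). u $ i * cnj (v $ j))"

text \<open>Matrix indices run over \<open>{..<n}\<close>. The Bernoulli entries are complex numbers,
  all equal to \<open>0\<close> or \<open>1\<close>, so that their law is determined by the probability of the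
  value \<open>1\<close>. The last assumption is independence of the two random matrices as a whole.\<close>

locale sparse_iid_model = prob_space M
  for M :: "'a measure" +
  fixes n k :: nat
    and law :: "complex measure"
    and A B :: "nat \<Rightarrow> nat \<Rightarrow> 'a \<Rightarrow> complex"
  assumes A_indep: "indep_vars (\<lambda>_. borel) (\<lambda>(i, j). A i j) ({..<n} \<times> {..<n})"
    and A_law: "\<And>i j. i < n \<Longrightarrow> j < n \<Longrightarrow> distr M borel (A i j) = law"
    and B_indep: "indep_vars (\<lambda>_. borel) (\<lambda>(i, j). B i j) ({..<n} \<times> {..<n})"
    and B_values: "\<And>i j \<omega>. i < n \<Longrightarrow> j < n \<Longrightarrow> \<omega> \<in> space M \<Longrightarrow> B i j \<omega> \<in> {0, 1}"
    and B_law: "\<And>i j. i < n \<Longrightarrow> j < n \<Longrightarrow> prob {\<omega> \<in> space M. B i j \<omega> = 1} = real k / real n"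
    and A_B_indep: "indep_var
      (Pi\<^sub>M ({..<n} \<times> {..<n}) (\<lambda>_. borel)) (\<lambda>\<omega>. \<lambda>(i, j)\<in>{..<n} \<times> {..<n}. A i j \<omega>)
      (Pi\<^sub>M ({..<n} \<times> {..<n}) (\<lambda>_. borel)) (\<lambda>\<omega>. \<lambda>(i, j)\<in>{..<n} \<times> {..<n}. B i j \<omega>)"

definition sparse_mat ::
  "nat \<Rightarrow> nat \<Rightarrow> (nat \<Rightarrow> nat \<Rightarrow> 'a \<Rightarrow> complex) \<Rightarrow> (nat \<Rightarrow> nat \<Rightarrow> 'a \<Rightarrow> complex) \<Rightarrow> 'a \<Rightarrow> complex mat"
where
  "sparse_mat n k A B \<omega> =
     mat n n (\<lambda>(i, j). complex_of_real (1 / sqrt (real k)) * B i j \<omega> * A i j \<omega>)"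

definition outer_spectrum :: "real \<Rightarrow> complex mat \<Rightarrow> complex set" where
  "outer_spectrum \<epsilon> Y = spectrum Y \<inter> {z. cmod z \<ge> 1 + \<epsilon>}"

definition eigenvalue_count :: "complex mat \<Rightarrow> complex set \<Rightarrow> nat" where
  "eigenvalue_count Y S = (\<Sum>z\<in>S. Polynomial.order z (char_poly Y))"

definition lambda_max :: "real \<Rightarrow> complex mat \<Rightarrow> complex" where
  "lambda_max \<epsilon> Y =
     (if eigenvalue_count Y (outer_spectrum \<epsilon> Y) = 1
      then THE z. z \<in> spectrum Y \<and> (\<forall>w\<in>spectrum Y. w \<noteq> z \<longrightarrow> cmod w < cmod z)
      else 0)"

text \<open>Each \<open>Z n\<close> may live on its own probability space \<open>M n\<close>. Measurability is part of
  the notion: \<open>measure\<close> is \<open>0\<close> on non-measurable sets, which would make the limit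
  condition vacuous. The index \<open>0\<close> is not used.\<close>

definition tendsto_zero_in_prob :: "(nat \<Rightarrow> 'a measure) \<Rightarrow> (nat \<Rightarrow> 'a \<Rightarrow> complex) \<Rightarrow> bool" where
  "tendsto_zero_in_prob M Z \<longleftrightarrow>
     (\<forall>n\<ge>1. Z n \<in> borel_measurable (M n)) \<and>
     (\<forall>\<delta>>0. (\<lambda>n. measure (M n) {\<omega> \<in> space (M n). cmod (Z n \<omega>) > \<delta>}) \<longlonglongrightarrow> 0)"

end

theory Submission
  imports Defs "HOL-Complex_Analysis.Complex_Analysis"
begin

unbundle no vec_syntax

text \<open>
  Everything happens at the level of the reversed characteristic polynomials
  \<open>q z = det (1 - z X)\<close> and \<open>det (1 - z Y)\<close> on a disc \<open>|z| \<le> r < 1\<close>. Square-free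
  monomials in the entries of \<open>X\<close> are orthogonal, and the coefficients of both polynomials are
  combinations of such monomials. Computing second moments in this way, \<open>q\<close> stays bounded in
  probability and \<open>det (1 - z Y)\<close> differs from \<open>q z * (1 - z * a)\<close>, with \<open>a = \<langle>v, u\<rangle>\<close>, only by
  \<open>O(1 / sqrt n)\<close>: expanding the determinant along the rank-one part leaves minors of \<open>X\<close>, the
  principal ones recombine to \<open>q z * z * a\<close>, and the others are negligible.

  It remains to bound \<open>|q|\<close> from below. Truncating the entries changes the coefficients of \<open>q\<close>
  little in mean square, so assume the entries of \<open>A\<close> bounded. Then \<open>E |tr X^k|^2\<close> is at most
  \<open>2 k^2 + o(1)\<close> for fixed \<open>k\<close>: of the pairs of closed walks in which no edge is simple, only those
  with as many edges as vertices survive, and these are permutations of the vertex set.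
  Hence \<open>S z = (\<Sum>k\<le>m. z^k / k * tr X^k)\<close> is bounded in probability uniformly in \<open>m\<close>. The function
  \<open>q * exp S\<close> is a product of Weierstrass factors, so \<open>q * exp S - 1\<close> vanishes to order \<open>m\<close> at
  \<open>0\<close> and is small for large \<open>m\<close>, which gives \<open>|q| \<ge> exp (- |S|) / 2\<close>. On the disc the zeros of
  \<open>det (1 - z Y)\<close> are therefore those of a small perturbation of \<open>1 - z * a\<close>.
\<close>

subsection \<open>Products of Weierstrass factors and perturbed linear functions\<close>

text \<open>Only two moments of the entries are available, so high trace moments of \<open>X\<close>
  cannot control its spectral radius directly. Coefficients of determinants escape this because
  their monomials use each entry at most once. But upper bounds of this kind only give tightness of
  \<open>q\<close>, and a tight random holomorphic function may come arbitrarily close to zero.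
  Excluding this needs log q, hence traces, where entries are repeated; the trace estimate is the
  one place that uses bounded entries and K_n \<rightarrow> \<infinity>. The truncated and the
  original matrix share their Bernoulli variables and are compared through \<open>q\<close> alone,
  never through traces. Since the mean of |tr X^k| grows at most linearly in k, the weight 1/k
  leaves a geometric series, so the bound on S does not depend on m. This frees m to depend on the
  bounds for q and S. The truncation level depends on those bounds too, and n on everything, so that
  only finitely many walk lengths have to be compared with n. All minors up to order n enter, but
  their second moments are bounded without any condition on n.\<close>

lemma weierstrass_factor_expand:
  "\<exists>G. G holomorphic_on UNIV \<and> (\<forall>w. weierstrass_factor m w = 1 + w ^ Suc m * G w)"
proof -
  define f where "f w = (weierstrass_factor m w - 1) / w ^ Suc m" for w
  have "f holomorphic_on UNIV - {0}"
    unfolding f_def by (intro holomorphic_intros) auto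
  moreover have "\<exists>B. eventually (\<lambda>z. norm (f z) \<le> B) (at 0)"
  \<comment> \<open>The constant 3 is that of \<open>weierstrass_factor_bound\<close>, valid for |z|
    \<le> 1/2. Boundedness near 0 makes the singularity of \<open>f\<close> removable, and
    \<open>G\<close> is the extension.\<close>
  proof (intro exI[of _ 3])
    have "eventually (\<lambda>z::complex. z \<in> ball 0 (1/2) - {0}) (at 0)"
      by (intro eventually_at_in_open) auto
    then show "eventually (\<lambda>z. norm (f z) \<le> 3) (at 0)"
    proof eventually_elim
      case (elim z)
      then have "norm (weierstrass_factor m z - 1) \<le> 3 * norm z ^ Suc m"
        by (intro weierstrass_factor_bound) auto
      with elim show ?case
        unfolding f_def norm_divide norm_power by (subst pos_divide_le_eq) auto
    qed
  qed
  ultimately obtain G where G: "G holomorphic_on UNIV" "\<And>w. w \<noteq> 0 \<Longrightarrow> G w = f w"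
    using holomorphic_on_extend_bounded[of f UNIV 0] by auto
  have "weierstrass_factor m w = 1 + w ^ Suc m * G w" for w
    by (cases "w = 0") (auto simp: G(2) f_def)
  with G(1) show ?thesis by blast
qed

lemma prod_weierstrass_factor_expand:
  fixes es :: "complex list"
  shows "\<exists>G. G holomorphic_on UNIV \<and>
    (\<forall>z. (\<Prod>e\<leftarrow>es. weierstrass_factor m (e * z)) = 1 + z ^ Suc m * G z)"
proof (induction es)
  case Nil
  show ?case by (rule exI[of _ "\<lambda>_. 0"]) auto
next
  case (Cons e es)
  then obtain G where G: "G holomorphic_on UNIV"
    "\<And>z. (\<Prod>e\<leftarrow>es. weierstrass_factor m (e * z)) = 1 + z ^ Suc m * G z" by blast
  obtain H where H: "H holomorphic_on UNIV"
    "\<And>w. weierstrass_factor m w = 1 + w ^ Suc m * H w"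
    using weierstrass_factor_expand by blast
  have H': "(\<lambda>z. H (e * z)) holomorphic_on UNIV"
    by (rule holomorphic_on_compose_gen[OF _ H(1), unfolded o_def]) (auto intro!: holomorphic_intros)
  show ?case
  proof (intro exI[of _ "\<lambda>z. e ^ Suc m * H (e * z) + G z + z ^ Suc m * e ^ Suc m * H (e * z) * G z"] conjI allI)
    show "(\<lambda>z. e ^ Suc m * H (e * z) + G z + z ^ Suc m * e ^ Suc m * H (e * z) * G z) holomorphic_on UNIV"
      by (intro holomorphic_intros H' G)
    show "(\<Prod>e\<leftarrow>e # es. weierstrass_factor m (e * z)) =
      1 + z ^ Suc m * (e ^ Suc m * H (e * z) + G z + z ^ Suc m * e ^ Suc m * H (e * z) * G z)" for z
      unfolding list.map prod_list.Cons G(2) H(2)[of "e * z"]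
      by (simp add: algebra_simps power_mult_distrib)
  qed
qed

text \<open>A Schwarz lemma of order \<open>Suc m\<close>: the quotient of the difference by z^(m+1)
  is entire, and the maximum principle carries its bound on the circle |z| = R inwards.\<close>

lemma prod_weierstrass_factor_bound:
  fixes es :: "complex list"
  assumes R: "0 < R"
    and M: "\<And>z. cmod z \<le> R \<Longrightarrow> cmod ((\<Prod>e\<leftarrow>es. weierstrass_factor m (e * z)) - 1) \<le> M"
    and z: "cmod z \<le> R"
  shows "cmod ((\<Prod>e\<leftarrow>es. weierstrass_factor m (e * z)) - 1) \<le> M * (cmod z / R) ^ Suc m"
proof -
  obtain G where G: "G holomorphic_on UNIV"
    "\<And>z. (\<Prod>e\<leftarrow>es. weierstrass_factor m (e * z)) = 1 + z ^ Suc m * G z"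
    using prod_weierstrass_factor_expand by blast
  have "cmod (G z) \<le> M / R ^ Suc m"
  proof (rule maximum_modulus_frontier[of G "cball 0 R"])
    show "G holomorphic_on interior (cball 0 R)" by (rule holomorphic_on_subset[OF G(1)]) auto
    show "continuous_on (closure (cball 0 R)) G"
      by (rule continuous_on_subset[OF holomorphic_on_imp_continuous_on[OF G(1)]]) auto
    fix w :: complex assume "w \<in> frontier (cball 0 R)"
    then have w: "cmod w = R" using R by auto
    have "cmod w ^ Suc m * cmod (G w) \<le> M"
      using M[of w] w unfolding G(2) by (simp add: norm_mult norm_power)
    then show "cmod (G w) \<le> M / R ^ Suc m"
      using R w by (simp add: pos_le_divide_eq mult.commute del: power_Suc)
  qed (use z in auto)
  then have "cmod z ^ Suc m * cmod (G z) \<le> cmod z ^ Suc m * (M / R ^ Suc m)"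
    by (intro mult_left_mono) auto
  then show ?thesis unfolding G(2)
    by (simp add: norm_mult norm_power power_divide mult.commute del: power_Suc)
qed

lemma sum_list_sum_swap: "(\<Sum>x\<leftarrow>xs. \<Sum>k\<in>A. f x k) = (\<Sum>k\<in>A. \<Sum>x\<leftarrow>xs. f x (k::nat) :: complex)"
  by (induction xs) (auto simp: sum.distrib)

lemma exp_sum_list: "exp (\<Sum>x\<leftarrow>xs. f x :: complex) = (\<Prod>x\<leftarrow>xs. exp (f x))"
  by (induction xs) (auto simp: exp_add)

lemma prod_list_mult_distrib: "(\<Prod>x\<leftarrow>xs. f x * g x :: complex) = (\<Prod>x\<leftarrow>xs. f x) * (\<Prod>x\<leftarrow>xs. g x)"
  by (induction xs) auto

text \<open>A lower bound from upper bounds only: \<open>a\<close> and \<open>b\<close> bound q exp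
  S - 1 by a exp b + 1 on the larger disc, and passing to the smaller disc gains (r / R)^(m+1).
  Neither the number nor the position of the \<open>es\<close> enters, so the result is uniform in
  the size of the matrix.\<close>

lemma prod_linear_lower_bound:
  fixes es :: "complex list" and m :: nat
  defines "q \<equiv> \<lambda>z. \<Prod>e\<leftarrow>es. 1 - e * z"
    and "S \<equiv> \<lambda>z. \<Sum>k=1..m. z ^ k / of_nat k * (\<Sum>e\<leftarrow>es. e ^ k)"
  assumes r: "0 \<le> r" "r < R"
    and a: "\<And>z. cmod z \<le> R \<Longrightarrow> cmod (q z) \<le> a"
    and b: "\<And>z. cmod z \<le> R \<Longrightarrow> cmod (S z) \<le> b"
    and m: "(a * exp b + 1) * (r / R) ^ Suc m \<le> 1 / 2"
    and z: "cmod z \<le> r"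
  shows "exp (- b) / 2 \<le> cmod (q z)"
proof -
  have qS: "(\<Prod>e\<leftarrow>es. weierstrass_factor m (e * z)) = q z * exp (S z)" for z
  proof -
    have "S z = (\<Sum>e\<leftarrow>es. \<Sum>k=1..m. (e * z) ^ k / of_nat k)"
      unfolding S_def sum_list_sum_swap
      by (intro sum.cong refl) (simp add: sum_list_const_mult[symmetric] power_mult_distrib mult.commute divide_inverse mult.left_commute)
    then have "exp (S z) = (\<Prod>e\<leftarrow>es. exp (\<Sum>k=1..m. (e * z) ^ k / of_nat k))"
      by (simp add: exp_sum_list)
    then have "q z * exp (S z) = (\<Prod>e\<leftarrow>es. (1 - e * z) * exp (\<Sum>k=1..m. (e * z) ^ k / of_nat k))"
      unfolding q_def by (simp only: prod_list_mult_distrib)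
    then show ?thesis by (simp add: weierstrass_factor_def)
  qed
  have expb: "cmod (exp (S z)) \<le> exp b" if "cmod z \<le> R" for z
    by (rule order_trans[OF norm_exp]) (use b[OF that] in simp)
  have "cmod ((\<Prod>e\<leftarrow>es. weierstrass_factor m (e * z)) - 1) \<le> (a * exp b + 1) * (cmod z / R) ^ Suc m"
  proof (rule prod_weierstrass_factor_bound)
    fix w assume w: "cmod w \<le> R"
    have "cmod (q w * exp (S w)) \<le> a * exp b"
      unfolding norm_mult using a[OF w] expb[OF w]
      by (intro mult_mono) (auto intro: order_trans[OF norm_ge_zero])
    then show "cmod ((\<Prod>e\<leftarrow>es. weierstrass_factor m (e * w)) - 1) \<le> a * exp b + 1"
      unfolding qS using norm_triangle_ineq4[of "q w * exp (S w)" 1] by simp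
  qed (use r z in auto)
  also have "\<dots> \<le> (a * exp b + 1) * (r / R) ^ Suc m"
  proof -
    have "0 \<le> a" using a[of 0] r by (auto intro: order_trans[OF norm_ge_zero])
    then show ?thesis using r z by (intro mult_left_mono power_mono divide_right_mono) auto
  qed
  also note m
  finally have "1 / 2 \<le> cmod (q z * exp (S z))"
    unfolding qS using norm_triangle_ineq2[of 1 "q z * exp (S z)"]
    by (simp add: norm_minus_commute)
  also have "\<dots> \<le> cmod (q z) * exp b"
    unfolding norm_mult using expb[of z] r z by (intro mult_left_mono) auto
  finally have "exp (- b) * (1 / 2) \<le> exp (- b) * (cmod (q z) * exp b)"
    by (rule mult_left_mono) simp
  also have "\<dots> = cmod (q z) * (exp b * exp (- b))" by (simp only: mult_ac)
  finally show ?thesis by (simp add: exp_minus_inverse)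
qed

text \<open>This takes the place of Rouche's theorem. A zero is a fixed point of z \<mapsto> (1 + e
  z) / a, which the first condition on \<tau> makes a self-map of the closed disc of radius r0, so
  Brouwer applies. The second condition and Cauchy's estimate give |e'| < |a| there, which yields
  both uniqueness and simplicity. Simplicity is recorded as \<open>deriv e z0 \<noteq> a\<close> and
  later becomes algebraic multiplicity one.\<close>

lemma perturbed_linear_zero:
  fixes a :: complex
  assumes hol: "e holomorphic_on ball 0 r" and e: "\<And>z. z \<in> ball 0 r \<Longrightarrow> cmod (e z) \<le> \<tau>"
    and r: "0 < r0" "r0 < r" and \<tau>: "1 + \<tau> \<le> r0 * cmod a" "\<tau> < cmod a * ((r - r0) / 2)"
  obtains z0 where "cmod z0 \<le> r0" "1 - a * z0 + e z0 = 0"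
    "\<And>z. cmod z \<le> r0 \<Longrightarrow> 1 - a * z + e z = 0 \<Longrightarrow> z = z0" "deriv e z0 \<noteq> a"
proof -
  \<comment> \<open>Half of the gap, so that closed discs of radius s about points of the r0-disc
    stay inside the open ball on which \<open>e\<close> is holomorphic and bounded.\<close>
  define s where "s = (r - r0) / 2"
  have s: "0 < s" "r0 + s < r" using r by (auto simp: s_def field_simps)
  have \<tau>0: "0 \<le> \<tau>" using e[of 0] r by (auto intro: order_trans[OF norm_ge_zero])
  have a0: "a \<noteq> 0" using \<tau> \<tau>0 r by auto
  have de: "cmod (deriv e z) \<le> \<tau> / s" if "cmod z \<le> r0" for z
  proof -
    have sub: "cball z s \<subseteq> ball 0 r"
    proof
      fix w assume "w \<in> cball z s"
      then have "cmod (w - z) \<le> s" by (simp add: dist_norm norm_minus_commute)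
      then show "w \<in> ball 0 r" using that s norm_triangle_sub[of w z] by auto
    qed
    have "cmod ((deriv ^^ 1) e z) \<le> fact 1 * \<tau> / s ^ 1"
    proof (rule Cauchy_inequality)
      show "e holomorphic_on ball z s" by (rule holomorphic_on_subset[OF hol]) (use sub in force)
      show "continuous_on (cball z s) e"
        by (rule continuous_on_subset[OF holomorphic_on_imp_continuous_on[OF hol] sub])
      fix x assume "cmod (z - x) = s"
      then have "x \<in> cball z s" by (auto simp: dist_norm)
      then show "cmod (e x) \<le> \<tau>" using sub e by blast
    qed (use s in auto)
    then show ?thesis by simp
  qed
  have lt: "\<tau> / s < cmod a" using \<tau> s by (simp add: s_def pos_divide_less_eq)
  have "\<exists>z\<in>cball 0 r0. (1 + e z) / a = z"
  proof (rule brouwer_ball)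
    show "continuous_on (cball 0 r0) (\<lambda>z. (1 + e z) / a)"
      using a0 r by (intro continuous_intros continuous_on_subset[OF holomorphic_on_imp_continuous_on[OF hol]]) auto
    show "(\<lambda>z. (1 + e z) / a) \<in> cball 0 r0 \<rightarrow> cball 0 r0"
    proof
      fix z :: complex assume "z \<in> cball 0 r0"
      then have "cmod (1 + e z) \<le> 1 + \<tau>"
        using e[of z] r norm_triangle_ineq[of 1 "e z"] by auto
      then show "(1 + e z) / a \<in> cball 0 r0"
        using \<tau> a0 by (simp add: norm_divide pos_divide_le_eq)
    qed
  qed (use r in auto)
  then obtain z0 where z0: "cmod z0 \<le> r0" "(1 + e z0) / a = z0" by auto
  show thesis
  proof
    show "cmod z0 \<le> r0" by fact
    show z0': "1 - a * z0 + e z0 = 0" using z0(2) a0 by (simp add: field_simps)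
    show "deriv e z0 \<noteq> a"
    proof
      assume *: "deriv e z0 = a"
      show False using de[OF z0(1)] lt unfolding * by simp
    qed
    fix z assume z: "cmod z \<le> r0" "1 - a * z + e z = 0"
    have "cmod (e z - e z0) \<le> \<tau> / s * cmod (z - z0)"
    proof (rule field_differentiable_bound)
      fix w :: complex assume w: "w \<in> cball 0 r0"
      show "(e has_field_derivative deriv e w) (at w within cball 0 r0)"
        by (rule has_field_derivative_at_within, rule holomorphic_derivI[OF hol]) (use w r in auto)
      show "cmod (deriv e w) \<le> \<tau> / s" using w de by auto
    qed (use z z0 in auto)
    moreover have "e z - e z0 = a * (z - z0) + (1 - a * z + e z) - (1 - a * z0 + e z0)"
      by (simp add: algebra_simps)
    then have "e z - e z0 = a * (z - z0)" using z(2) z0' by simp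
    ultimately have "cmod a * cmod (z - z0) \<le> \<tau> / s * cmod (z - z0)" by (simp add: norm_mult)
    then have "(cmod a - \<tau> / s) * cmod (z - z0) \<le> 0" by (simp add: left_diff_distrib)
    then show "z = z0" using lt by (simp add: mult_le_0_iff)
  qed
qed

subsection \<open>Leibniz expansion of the reversed characteristic polynomial\<close>

text \<open>The principal minor with rows and columns \<open>I\<close>. Using a function of two
  indices and an arbitrary index set avoids renumbering submatrices.\<close>

definition leibniz :: "(nat \<Rightarrow> nat \<Rightarrow> complex) \<Rightarrow> nat set \<Rightarrow> complex" where
  "leibniz x I = (\<Sum>\<sigma> | \<sigma> permutes I. of_int (sign \<sigma>) * (\<Prod>i\<in>I. x i (\<sigma> i)))"

definition minor_sum :: "(nat \<Rightarrow> nat \<Rightarrow> complex) \<Rightarrow> nat \<Rightarrow> nat \<Rightarrow> complex" where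
  "minor_sum x n k = (\<Sum>I | I \<subseteq> {..<n} \<and> card I = k. leibniz x I)"

text \<open>This is det (1 - z x), given by its coefficients because all moments below are taken
  coefficient by coefficient.\<close>

definition rev_char :: "(nat \<Rightarrow> nat \<Rightarrow> complex) \<Rightarrow> nat \<Rightarrow> complex \<Rightarrow> complex" where
  "rev_char x n z = (\<Sum>k\<le>n. (- z) ^ k * minor_sum x n k)"

lemma permutes_subset_iff:
  assumes "\<sigma> permutes N" "I \<subseteq> N"
  shows "(\<forall>i\<in>N - I. \<sigma> i = i) \<longleftrightarrow> \<sigma> permutes I"
  using assms unfolding permutes_def by blast

lemma sum_subsets_card:
  fixes g :: "nat \<Rightarrow> nat set \<Rightarrow> complex"
  shows "(\<Sum>I\<in>Pow {..<n}. g (card I) I) = (\<Sum>k\<le>n. \<Sum>I | I \<subseteq> {..<n} \<and> card I = k. g k I)"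
proof -
  have "(\<Sum>I\<in>Pow {..<n}. g (card I) I) = (\<Sum>k\<in>{..n}. \<Sum>I | I \<in> Pow {..<n} \<and> card I = k. g (card I) I)"
    using card_mono[of "{..<n}"] by (intro sum.group[symmetric]) auto
  also have "\<dots> = (\<Sum>k\<le>n. \<Sum>I | I \<subseteq> {..<n} \<and> card I = k. g k I)"
    by (intro sum.cong refl) auto
  finally show ?thesis .
qed

text \<open>In each row choose either the entry of d x or the diagonal entry c. Rows choosing c must
  be fixed points of the permutation, which therefore restricts to the set I of the remaining
  rows.\<close>

lemma leibniz_shift:
  "leibniz (\<lambda>i j. (if i = j then c else 0) + d * x i j) {..<n} =
     (\<Sum>k\<le>n. c ^ (n - k) * d ^ k * minor_sum x n k)"
proof -
  define \<delta> where "\<delta> I = c ^ (n - card I) * d ^ card I * leibniz x I" for I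
  have "leibniz (\<lambda>i j. (if i = j then c else 0) + d * x i j) {..<n} =
    (\<Sum>\<sigma> | \<sigma> permutes {..<n}. of_int (sign \<sigma>) *
      (\<Sum>I\<in>Pow {..<n}. (\<Prod>i\<in>I. d * x i (\<sigma> i)) * (\<Prod>i\<in>{..<n} - I. if i = \<sigma> i then c else 0)))"
    unfolding leibniz_def by (subst add.commute) (simp add: prod_add)
  also have "\<dots> = (\<Sum>I\<in>Pow {..<n}. \<Sum>\<sigma> | \<sigma> permutes {..<n}. of_int (sign \<sigma>) *
      ((\<Prod>i\<in>I. d * x i (\<sigma> i)) * (\<Prod>i\<in>{..<n} - I. if i = \<sigma> i then c else 0)))"
    unfolding sum_distrib_left by (rule sum.swap)
  also have "\<dots> = (\<Sum>I\<in>Pow {..<n}. \<delta> I)"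
  proof (intro sum.cong refl)
    fix I assume "I \<in> Pow {..<n}"
    then have I: "I \<subseteq> {..<n}" and fin: "finite I" by (auto intro: finite_subset)
    have "(\<Sum>\<sigma> | \<sigma> permutes {..<n}. of_int (sign \<sigma>) *
        ((\<Prod>i\<in>I. d * x i (\<sigma> i)) * (\<Prod>i\<in>{..<n} - I. if i = \<sigma> i then c else 0)))
      = (\<Sum>\<sigma> | \<sigma> permutes I. of_int (sign \<sigma>) * ((\<Prod>i\<in>I. d * x i (\<sigma> i)) * c ^ (n - card I)))"
    proof (intro sum.mono_neutral_cong_right ballI)
      show "{\<sigma>. \<sigma> permutes I} \<subseteq> {\<sigma>. \<sigma> permutes {..<n}}" using I permutes_subset by blast
      fix \<sigma> assume "\<sigma> \<in> {\<sigma>. \<sigma> permutes {..<n}} - {\<sigma>. \<sigma> permutes I}"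
      then obtain i where "i \<in> {..<n} - I" "\<sigma> i \<noteq> i" using permutes_subset_iff[OF _ I] by blast
      then have "(\<Prod>i\<in>{..<n} - I. if i = \<sigma> i then c else 0) = 0"
        by (intro prod_zero) (auto intro!: bexI[of _ i])
      then show "of_int (sign \<sigma>) *
        ((\<Prod>i\<in>I. d * x i (\<sigma> i)) * (\<Prod>i\<in>{..<n} - I. if i = \<sigma> i then c else 0)) = 0" by simp
    next
      fix \<sigma> assume "\<sigma> \<in> {\<sigma>. \<sigma> permutes I}"
      then have "(\<Prod>i\<in>{..<n} - I. if i = \<sigma> i then c else 0) = (\<Prod>i\<in>{..<n} - I. c)"
        by (intro prod.cong refl) (auto simp: permutes_def)
      also have "\<dots> = c ^ (n - card I)" using I fin by (simp add: card_Diff_subset)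
      finally show "of_int (sign \<sigma>) *
        ((\<Prod>i\<in>I. d * x i (\<sigma> i)) * (\<Prod>i\<in>{..<n} - I. if i = \<sigma> i then c else 0)) =
        of_int (sign \<sigma>) * ((\<Prod>i\<in>I. d * x i (\<sigma> i)) * c ^ (n - card I))" by simp
    qed (simp add: finite_permutations)
    also have "\<dots> = \<delta> I"
      unfolding \<delta>_def leibniz_def sum_distrib_left by (intro sum.cong refl) (simp add: prod.distrib)
    finally show "(\<Sum>\<sigma> | \<sigma> permutes {..<n}. of_int (sign \<sigma>) *
        ((\<Prod>i\<in>I. d * x i (\<sigma> i)) * (\<Prod>i\<in>{..<n} - I. if i = \<sigma> i then c else 0))) = \<delta> I" .
  qed
  also have "\<dots> = (\<Sum>k\<le>n. \<Sum>I | I \<subseteq> {..<n} \<and> card I = k. c ^ (n - k) * d ^ k * leibniz x I)"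
    unfolding \<delta>_def by (rule sum_subsets_card)
  finally show ?thesis by (simp add: minor_sum_def sum_distrib_left)
qed

lemma det_eq_leibniz: "det (mat n n (\<lambda>(i, j). x i j)) = leibniz x {..<n}"
proof -
  have "(\<Prod>i = 0..<n. mat n n (\<lambda>(i, j). x i j) $$ (i, \<sigma> i)) = (\<Prod>i<n. x i (\<sigma> i))"
    if "\<sigma> permutes {..<n}" for \<sigma>
    unfolding atLeast0LessThan using that permutes_in_image[OF that]
    by (intro prod.cong refl) auto
  then show ?thesis unfolding det_def leibniz_def
    by (auto simp: atLeast0LessThan intro!: sum.cong)
qed

lemma poly_char_poly_minor_sum:
  "poly (char_poly (mat n n (\<lambda>(i, j). x i j))) c = (\<Sum>k\<le>n. c ^ (n - k) * (- 1) ^ k * minor_sum x n k)"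
proof -
  let ?A = "mat n n (\<lambda>(i, j). x i j)"
  have "poly (char_poly ?A) c = det (- char_matrix ?A c)"
    by (rule char_poly_matrix[of _ n]) auto
  also have "- char_matrix ?A c = mat n n (\<lambda>(i, j). (if i = j then c else 0) + (- 1) * x i j)"
    by (intro eq_matI) (auto simp: char_matrix_def)
  also have "det \<dots> = leibniz (\<lambda>i j. (if i = j then c else 0) + (- 1) * x i j) {..<n}"
    by (rule det_eq_leibniz)
  finally show ?thesis unfolding leibniz_shift .
qed

lemma poly_char_poly_rev_char:
  assumes "c \<noteq> 0"
  shows "poly (char_poly (mat n n (\<lambda>(i, j). x i j))) c = c ^ n * rev_char x n (1 / c)"
  unfolding poly_char_poly_minor_sum rev_char_def sum_distrib_left
  using assms by (intro sum.cong refl) (auto simp: power_diff power_minus[of "1/c"] power_divide)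

text \<open>A rank-one matrix has vanishing 2x2 minors: composing with the transposition of
  \<open>j1\<close> and \<open>j2\<close> permutes the factors w among the rows of J, leaves the
  other rows alone and flips the sign.\<close>

lemma leibniz_rank_one_pair_zero:
  assumes I: "finite I" "J \<subseteq> I" and j: "j1 \<in> J" "j2 \<in> J" "j1 \<noteq> j2"
  shows "(\<Sum>\<sigma> | \<sigma> permutes I. of_int (sign \<sigma>) *
    ((\<Prod>i\<in>J. u i * w (\<sigma> i)) * (\<Prod>i\<in>I - J. x i (\<sigma> i)))) = (0::complex)" (is "?T = 0")
proof -
  define \<tau> where "\<tau> = Transposition.transpose j1 j2"
  have \<tau>I: "\<tau> permutes I" and \<tau>J: "\<tau> permutes J"
    unfolding \<tau>_def using I j by (auto intro!: permutes_swap_id)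
  define f where "f \<sigma> = of_int (sign \<sigma>) *
    ((\<Prod>i\<in>J. u i * w (\<sigma> i)) * (\<Prod>i\<in>I - J. x i (\<sigma> i)))" for \<sigma>
  have "f (\<sigma> \<circ> \<tau>) = - f \<sigma>" if "\<sigma> permutes I" for \<sigma>
  proof -
    have "sign (\<sigma> \<circ> \<tau>) = - sign \<sigma>"
      using that I(1) \<tau>I j(3)
      by (subst sign_compose) (auto simp: \<tau>_def sign_swap_id intro: permutes_imp_permutation)
    moreover have "(\<Prod>i\<in>J. u i * w ((\<sigma> \<circ> \<tau>) i)) = (\<Prod>i\<in>J. u i * w (\<sigma> i))"
    proof -
      have "(\<Prod>i\<in>J. w (\<sigma> (\<tau> i))) = (\<Prod>i\<in>J. w (\<sigma> i))"
        using prod.permute[OF \<tau>J, of "\<lambda>i. w (\<sigma> i)"] by (simp add: o_def)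
      then show ?thesis by (simp add: prod.distrib)
    qed
    moreover have "(\<Prod>i\<in>I - J. x i ((\<sigma> \<circ> \<tau>) i)) = (\<Prod>i\<in>I - J. x i (\<sigma> i))"
      using \<tau>J by (intro prod.cong refl) (auto simp: permutes_def)
    ultimately show ?thesis by (simp add: f_def)
  qed
  moreover have "sum f {\<sigma>. \<sigma> permutes I} = sum (\<lambda>\<sigma>. f (\<sigma> \<circ> \<tau>)) {\<sigma>. \<sigma> permutes I}"
    by (rule sum_permutations_compose_right[OF \<tau>I])
  ultimately have "sum f {\<sigma>. \<sigma> permutes I} = - sum f {\<sigma>. \<sigma> permutes I}"
    by (simp add: sum_negf)
  then show ?thesis unfolding f_def by simp
qed

text \<open>Expand by the set J of rows taken from the rank-one part; only J empty or a singleton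
  survives.\<close>

lemma leibniz_rank_one:
  assumes I: "finite I"
  shows "leibniz (\<lambda>i j. x i j + u i * w j) I = leibniz x I +
    (\<Sum>j\<in>I. \<Sum>\<sigma> | \<sigma> permutes I. of_int (sign \<sigma>) * (u j * w (\<sigma> j) * (\<Prod>i\<in>I - {j}. x i (\<sigma> i))))"
proof -
  define T where "T J = (\<Sum>\<sigma> | \<sigma> permutes I. of_int (sign \<sigma>) *
    ((\<Prod>i\<in>J. u i * w (\<sigma> i)) * (\<Prod>i\<in>I - J. x i (\<sigma> i))))" for J
  have "leibniz (\<lambda>i j. x i j + u i * w j) I = (\<Sum>J\<in>Pow I. T J)"
    unfolding leibniz_def T_def using I
    by (subst add.commute, subst sum.swap) (simp add: prod_add sum_distrib_left)
  also have "\<dots> = (\<Sum>J\<in>insert {} ((\<lambda>j. {j}) ` I). T J)"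
  proof (intro sum.mono_neutral_right ballI)
    fix J assume "J \<in> Pow I - insert {} ((\<lambda>j. {j}) ` I)"
    then have J: "J \<subseteq> I" "J \<noteq> {}" "\<forall>j\<in>I. J \<noteq> {j}" by auto
    then obtain j1 where "j1 \<in> J" by auto
    moreover then obtain j2 where "j2 \<in> J" "j2 \<noteq> j1" using J by blast
    ultimately show "T J = 0" unfolding T_def by (intro leibniz_rank_one_pair_zero[OF I J(1)]) auto
  qed (use I in auto)
  also have "\<dots> = T {} + (\<Sum>j\<in>I. T {j})"
    using I by (subst sum.insert) (auto simp: sum.reindex inj_on_def)
  finally show ?thesis by (simp add: T_def leibniz_def)
qed

text \<open>Row j carries the rank-one entry and is not a fixed point, so the remaining factors use
  every row of I but j and every column but \<sigma> j: a non-principal minor of order k, whence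
  \<open>card I = Suc k\<close>.\<close>

definition off_index :: "nat \<Rightarrow> nat \<Rightarrow> (nat set \<times> nat \<times> (nat \<Rightarrow> nat)) set" where
  "off_index n k = (SIGMA I:{I. I \<subseteq> {..<n} \<and> card I = Suc k}. SIGMA j:I. {\<sigma>. \<sigma> permutes I \<and> \<sigma> j \<noteq> j})"

definition off_sum where
  "off_sum x u w n k = (\<Sum>(I, j, \<sigma>)\<in>off_index n k.
     of_int (sign \<sigma>) * (u j * w (\<sigma> j) * (\<Prod>i\<in>I - {j}. x i (\<sigma> i))))"

text \<open>The excess produced when the sum of u_j w_j over j outside I is completed to all j <
  n.\<close>

definition diag_sum where
  "diag_sum x u w n k = (\<Sum>I | I \<subseteq> {..<n} \<and> card I = k. (\<Sum>j\<in>I. u j * w j) * leibniz x I)"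

lemma finite_subsets_card [simp]: "finite {I. I \<subseteq> {..<n::nat} \<and> card I = k}"
  by (rule finite_subset[of _ "Pow {..<n}"]) auto

lemma leibniz_fixed_point:
  assumes "finite I" "j \<in> I"
  shows "(\<Sum>\<sigma> | \<sigma> permutes I \<and> \<sigma> j = j. of_int (sign \<sigma>) * (c * (\<Prod>i\<in>I - {j}. x i (\<sigma> i))))
    = c * leibniz x (I - {j})"
proof -
  have "{\<sigma>. \<sigma> permutes I \<and> \<sigma> j = j} = {\<sigma>. \<sigma> permutes (I - {j})}"
    using assms(2) unfolding permutes_def by (auto; metis)
  then show ?thesis
    by (simp add: leibniz_def sum_distrib_left mult.left_commute)
qed

text \<open>Split the terms with one rank-one row j according to whether \<sigma> j = j. If so, the
  term is u_j w_j times the principal minor on R = I - {j}. Regrouped by R, the index j runs over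
  the complement of R; completing this sum to all j makes the full inner product factor out, at the
  price of \<open>diag_sum\<close>.\<close>

lemma minor_sum_rank_one:
  "minor_sum (\<lambda>i j. x i j + u i * w j) n (Suc k) = minor_sum x n (Suc k)
    + (\<Sum>j<n. u j * w j) * minor_sum x n k + off_sum x u w n k - diag_sum x u w n k"
proof -
  define S where "S k = {I. I \<subseteq> {..<n} \<and> card I = k}" for k
  have fin: "finite (S k)" "\<And>I. I \<in> S k \<Longrightarrow> finite I" for k
    by (auto simp: S_def intro: finite_subset)
  define f where "f I j \<sigma> = of_int (sign \<sigma>) * (u j * w (\<sigma> j) * (\<Prod>i\<in>I - {j}. x i (\<sigma> i)))" for I j \<sigma>
  have "minor_sum (\<lambda>i j. x i j + u i * w j) n (Suc k) - minor_sum x n (Suc k)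
    = (\<Sum>I\<in>S (Suc k). \<Sum>j\<in>I. \<Sum>\<sigma> | \<sigma> permutes I. f I j \<sigma>)"
    unfolding minor_sum_def S_def[symmetric] f_def
    by (simp add: leibniz_rank_one fin sum.distrib)
  also have "\<dots> = (\<Sum>I\<in>S (Suc k). \<Sum>j\<in>I. (\<Sum>\<sigma> | \<sigma> permutes I \<and> \<sigma> j \<noteq> j. f I j \<sigma>)
      + u j * w j * leibniz x (I - {j}))"
  proof (intro sum.cong refl)
    fix I j assume I: "I \<in> S (Suc k)" and j: "j \<in> I"
    have "(\<Sum>\<sigma> | \<sigma> permutes I. f I j \<sigma>) = (\<Sum>\<sigma>\<in>{\<sigma>. \<sigma> permutes I \<and> \<sigma> j \<noteq> j} \<union> {\<sigma>. \<sigma> permutes I \<and> \<sigma> j = j}. f I j \<sigma>)"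
      by (rule arg_cong[of _ _ "sum _"]) auto
    also have "\<dots> = (\<Sum>\<sigma> | \<sigma> permutes I \<and> \<sigma> j \<noteq> j. f I j \<sigma>) + (\<Sum>\<sigma> | \<sigma> permutes I \<and> \<sigma> j = j. f I j \<sigma>)"
      using finite_permutations[OF fin(2)[OF I]]
      by (intro sum.union_disjoint) (auto intro: finite_subset[of _ "{\<sigma>. \<sigma> permutes I}"])
    also have "(\<Sum>\<sigma> | \<sigma> permutes I \<and> \<sigma> j = j. f I j \<sigma>) = u j * w j * leibniz x (I - {j})"
      unfolding leibniz_fixed_point[OF fin(2)[OF I] j, symmetric] f_def
      by (intro sum.cong refl) auto
    finally show "(\<Sum>\<sigma> | \<sigma> permutes I. f I j \<sigma>) = (\<Sum>\<sigma> | \<sigma> permutes I \<and> \<sigma> j \<noteq> j. f I j \<sigma>)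
      + u j * w j * leibniz x (I - {j})" .
  qed
  also have "\<dots> = off_sum x u w n k + (\<Sum>I\<in>S (Suc k). \<Sum>j\<in>I. u j * w j * leibniz x (I - {j}))"
  proof -
    have "off_sum x u w n k = (\<Sum>I\<in>S (Suc k). \<Sum>j\<in>I. \<Sum>\<sigma> | \<sigma> permutes I \<and> \<sigma> j \<noteq> j. f I j \<sigma>)"
    proof -
      have *: "finite {\<sigma>. \<sigma> permutes I \<and> \<sigma> j \<noteq> j}" if "I \<in> S (Suc k)" for I j
        using finite_permutations[OF fin(2)[OF that]] by (rule rev_finite_subset) auto
      have "(\<Sum>I\<in>S (Suc k). \<Sum>j\<in>I. \<Sum>\<sigma> | \<sigma> permutes I \<and> \<sigma> j \<noteq> j. f I j \<sigma>) =
        (\<Sum>I\<in>S (Suc k). \<Sum>(j, \<sigma>)\<in>(SIGMA j:I. {\<sigma>. \<sigma> permutes I \<and> \<sigma> j \<noteq> j}). f I j \<sigma>)"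
        by (intro sum.cong refl sum.Sigma ballI fin *) auto
      also have "\<dots> = off_sum x u w n k"
        unfolding off_sum_def off_index_def f_def S_def[symmetric]
        by (subst sum.Sigma) (auto intro!: fin finite_SigmaI * simp: split_def)
      finally show ?thesis ..
    qed
    then show ?thesis by (simp add: sum.distrib)
  qed
  also have "(\<Sum>I\<in>S (Suc k). \<Sum>j\<in>I. u j * w j * leibniz x (I - {j})) =
    (\<Sum>(I, j)\<in>(SIGMA I:S (Suc k). I). u j * w j * leibniz x (I - {j}))"
    by (intro sum.Sigma fin ballI)
  also have "\<dots> = (\<Sum>(R, j)\<in>(SIGMA R:S k. {..<n} - R). u j * w j * leibniz x R)"
    by (rule sum.reindex_bij_witness[of _ "\<lambda>(R, j). (insert j R, j)" "\<lambda>(I, j). (I - {j}, j)"])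
      (auto simp: S_def card_insert_if finite_subset insert_absorb)
  also have "\<dots> = (\<Sum>R\<in>S k. \<Sum>j\<in>{..<n} - R. u j * w j * leibniz x R)"
    by (intro sum.Sigma[symmetric] fin(1) ballI finite_Diff) auto
  also have "\<dots> = (\<Sum>R\<in>S k. (\<Sum>j<n. u j * w j) * leibniz x R - (\<Sum>j\<in>R. u j * w j) * leibniz x R)"
  proof (intro sum.cong refl)
    fix R assume "R \<in> S k"
    then have "(\<Sum>j\<in>{..<n} - R. u j * w j) = (\<Sum>j<n. u j * w j) - (\<Sum>j\<in>R. u j * w j)"
      by (intro sum_diff) (auto simp: S_def)
    then show "(\<Sum>j\<in>{..<n} - R. u j * w j * leibniz x R) =
      (\<Sum>j<n. u j * w j) * leibniz x R - (\<Sum>j\<in>R. u j * w j) * leibniz x R"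
      by (simp add: sum_distrib_right[symmetric] left_diff_distrib)
  qed
  also have "\<dots> = (\<Sum>j<n. u j * w j) * minor_sum x n k - diag_sum x u w n k"
    by (simp add: minor_sum_def diag_sum_def S_def sum_subtractf sum_distrib_left)
  finally have *: "minor_sum (\<lambda>i j. x i j + u i * w j) n (Suc k) - minor_sum x n (Suc k) =
    off_sum x u w n k + ((\<Sum>j<n. u j * w j) * minor_sum x n k - diag_sum x u w n k)" .
  have "p = q + s + r - t" if "p - q = r + (s - t)" for p q r s t :: complex
    using that by (simp add: diff_eq_eq)
  from this[OF *] show ?thesis .
qed

lemma minor_sum_0 [simp]: "minor_sum x n 0 = 1"
proof -
  have "{I. I \<subseteq> {..<n} \<and> card I = 0} = {{}}"
    by (auto simp: card_eq_0_iff dest: finite_subset)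
  then show ?thesis by (simp add: minor_sum_def leibniz_def)
qed

lemma minor_sum_gt: "n < k \<Longrightarrow> minor_sum x n k = 0"
proof -
  assume "n < k"
  have "card I \<noteq> k" if "I \<subseteq> {..<n}" for I
    using card_mono[OF _ that] \<open>n < k\<close> by auto
  then have "{I. I \<subseteq> {..<n} \<and> card I = k} = {}" by blast
  then show ?thesis unfolding minor_sum_def by (simp only: sum.empty)
qed

lemma rev_char_rank_one:
  "rev_char (\<lambda>i j. x i j + u i * w j) n z =
    rev_char x n z * (1 - (\<Sum>j<n. u j * w j) * z)
    + (\<Sum>k\<le>n. (- z) ^ Suc k * (off_sum x u w n k - diag_sum x u w n k))"
proof -
  define a where "a = (\<Sum>j<n. u j * w j)"
  define d where "d k = off_sum x u w n k - diag_sum x u w n k" for k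
  \<comment> \<open>Minors of order above n vanish, so the sum can be extended by the index
    \<open>Suc n\<close>. After the shift it again runs over k \<le> n, the range in which the
    recursion returns \<open>rev_char x n z\<close>.\<close>
  have S: "rev_char x n z = 1 + (\<Sum>k\<le>n. (- z) ^ Suc k * minor_sum x n (Suc k))" for x
  proof -
    have "rev_char x n z = (\<Sum>k\<le>Suc n. (- z) ^ k * minor_sum x n k)"
      by (simp add: rev_char_def minor_sum_gt)
    also have "\<dots> = 1 + (\<Sum>k\<le>n. (- z) ^ Suc k * minor_sum x n (Suc k))"
      by (subst sum.atMost_Suc_shift) simp
    finally show ?thesis .
  qed
  have "rev_char (\<lambda>i j. x i j + u i * w j) n z =
    1 + (\<Sum>k\<le>n. (- z) ^ Suc k * minor_sum x n (Suc k) + ((- z * a) * ((- z) ^ k * minor_sum x n k) + (- z) ^ Suc k * d k))"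
    unfolding S minor_sum_rank_one a_def[symmetric] d_def
    by (intro arg_cong[of _ _ "\<lambda>s. 1 + s"] sum.cong refl) (simp add: algebra_simps)
  also have "\<dots> = rev_char x n z + (- z * a) * rev_char x n z + (\<Sum>k\<le>n. (- z) ^ Suc k * d k)"
    unfolding sum.distrib sum_distrib_left[symmetric] rev_char_def[symmetric] add.assoc[symmetric] S[symmetric] ..
  finally show ?thesis unfolding a_def d_def by (simp add: algebra_simps)
qed

subsection \<open>Eigenvalues and closed walks\<close>

definition mat_trace :: "complex mat \<Rightarrow> complex" where
  "mat_trace A = (\<Sum>i<dim_row A. A $$ (i, i))"

text \<open>The trace of the k-th power for positive k; \<open>Suc t mod k\<close> closes the walk.
  At k = 0 the value is 1 and not n, hence the side conditions \<open>0 < k\<close> below.\<close>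

definition closed_walk_sum :: "(nat \<Rightarrow> nat \<Rightarrow> complex) \<Rightarrow> nat \<Rightarrow> nat \<Rightarrow> complex" where
  "closed_walk_sum x n k = (\<Sum>w\<in>{..<k} \<rightarrow>\<^sub>E {..<n}. \<Prod>t<k. x (w t) (w (Suc t mod k)))"

lemma mat_mult_index_sum:
  assumes "A \<in> carrier_mat n n" "B \<in> carrier_mat n n" "i < n" "j < n"
  shows "(A * B) $$ (i, j) = (\<Sum>l<n. A $$ (i, l) * B $$ (l, j))"
  using assms by (auto simp: scalar_prod_def atLeast0LessThan intro!: sum.cong)

lemma mat_trace_mult_commute:
  assumes "A \<in> carrier_mat n n" "B \<in> carrier_mat n n"
  shows "mat_trace (A * B) = mat_trace (B * A)"
proof -
  have "mat_trace (A * B) = (\<Sum>i<n. \<Sum>l<n. A $$ (i, l) * B $$ (l, i))"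
    using assms unfolding mat_trace_def
    by (simp add: mat_mult_index_sum[of _ n] del: index_mult_mat(1))
  also have "\<dots> = (\<Sum>l<n. \<Sum>i<n. B $$ (l, i) * A $$ (i, l))"
    by (subst sum.swap) (simp add: mult.commute)
  also have "\<dots> = mat_trace (B * A)"
    using assms unfolding mat_trace_def
    by (simp add: mat_mult_index_sum[of _ n] del: index_mult_mat(1))
  finally show ?thesis .
qed

lemma mat_trace_similar:
  assumes A: "A \<in> carrier_mat n n" and s: "similar_mat_wit A B P Q"
  shows "mat_trace A = mat_trace B"
proof -
  note * = similar_mat_witD2[OF A s]
  have "mat_trace A = mat_trace (P * (B * Q))"
    using * by (simp add: assoc_mult_mat[of P n n B n Q n])
  also have "\<dots> = mat_trace ((B * Q) * P)"
    using * by (intro mat_trace_mult_commute[of _ n]) auto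
  also have "\<dots> = mat_trace B" using * by (simp add: assoc_mult_mat[of B n n Q n P n])
  finally show ?thesis .
qed

lemma upper_triangular_power:
  fixes B :: "complex mat"
  assumes B: "B \<in> carrier_mat n n" and u: "upper_triangular B"
  shows "upper_triangular (B ^\<^sub>m k) \<and> (\<forall>i<n. (B ^\<^sub>m k) $$ (i, i) = (B $$ (i, i)) ^ k)"
proof (induction k)
  case 0
  then show ?case using B by simp
next
  case (Suc k)
  have Bk: "B ^\<^sub>m k \<in> carrier_mat n n" using B by simp
  have e: "(B ^\<^sub>m Suc k) $$ (i, j) = (\<Sum>l<n. (B ^\<^sub>m k) $$ (i, l) * B $$ (l, j))"
    if "i < n" "j < n" for i j
    using mat_mult_index_sum[OF Bk B that] by simp
  have z: "(B ^\<^sub>m k) $$ (i, l) * B $$ (l, j) = 0" if "i < n" "j \<le> i" "l < n" "\<not> (l = i \<and> i = j)" for i j l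
  proof (cases "l < i")
    case True
    then show ?thesis using Suc Bk that by (auto dest: upper_triangularD)
  next
    case False
    then have "j < l" using that by auto
    then show ?thesis using u B that by (auto dest: upper_triangularD)
  qed
  show ?case
  proof (intro conjI upper_triangularI allI impI)
    fix i j assume ij: "j < i" "i < dim_row (B ^\<^sub>m Suc k)"
    then have "i < n" "j < n" using B by auto
    then show "(B ^\<^sub>m Suc k) $$ (i, j) = 0" unfolding e[OF \<open>i < n\<close> \<open>j < n\<close>]
      using z ij by (intro sum.neutral) auto
  next
    fix i assume i: "i < n"
    have "(\<Sum>l<n. (B ^\<^sub>m k) $$ (i, l) * B $$ (l, i)) = (\<Sum>l\<in>{i}. (B ^\<^sub>m k) $$ (i, l) * B $$ (l, i))"
      using z i by (intro sum.mono_neutral_right) auto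
    then show "(B ^\<^sub>m Suc k) $$ (i, i) = (B $$ (i, i)) ^ Suc k"
      unfolding e[OF i i] using Suc i by (simp add: mult.commute)
  qed
qed

text \<open>Schur's triangular form carries the list \<open>es\<close> on its diagonal, and powers
  of a triangular matrix have the powers of the diagonal entries on theirs.\<close>

lemma mat_trace_power_eigenvalues:
  assumes A: "A \<in> carrier_mat n n" and cp: "char_poly A = (\<Prod>e\<leftarrow>es. [:- e, 1:])"
  shows "mat_trace (A ^\<^sub>m k) = (\<Sum>e\<leftarrow>es. e ^ k)"
proof -
  obtain B P Q where BPQ: "schur_decomposition A es = (B, P, Q)" by (metis prod_cases3)
  from schur_decomposition[OF A cp this] have
    s: "similar_mat_wit A B P Q" and u: "upper_triangular B" and d: "diag_mat B = es" by auto
  have B: "B \<in> carrier_mat n n" using similar_mat_witD2[OF A s] by auto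
  have "mat_trace (A ^\<^sub>m k) = mat_trace (B ^\<^sub>m k)"
    using A by (intro mat_trace_similar[OF _ similar_mat_wit_pow[OF s]]) auto
  also have "\<dots> = (\<Sum>i<n. (B $$ (i, i)) ^ k)"
    unfolding mat_trace_def using upper_triangular_power[OF B u] B by auto
  also have "\<dots> = (\<Sum>e\<leftarrow>es. e ^ k)"
    unfolding d[symmetric] diag_mat_def using B
    by (simp add: o_def sum_list_sum_nth atLeast0LessThan)
  finally show ?thesis .
qed

lemma sum_PiE_lessThan_Suc:
  fixes f :: "(nat \<Rightarrow> nat) \<Rightarrow> complex"
  shows "(\<Sum>w\<in>{..<Suc k} \<rightarrow>\<^sub>E S. f w) = (\<Sum>w\<in>{..<k} \<rightarrow>\<^sub>E S. \<Sum>l\<in>S. f (w(k := l)))"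
proof -
  have "(\<Sum>w\<in>{..<Suc k} \<rightarrow>\<^sub>E S. f w) = (\<Sum>(l, w)\<in>S \<times> ({..<k} \<rightarrow>\<^sub>E S). f (w(k := l)))"
    unfolding lessThan_Suc PiE_insert_eq
    by (subst sum.reindex[OF inj_combinator]) (auto simp: o_def split_def)
  also have "\<dots> = (\<Sum>l\<in>S. \<Sum>w\<in>{..<k} \<rightarrow>\<^sub>E S. f (w(k := l)))"
    by (rule sum.cartesian_product[symmetric])
  also have "\<dots> = (\<Sum>w\<in>{..<k} \<rightarrow>\<^sub>E S. \<Sum>l\<in>S. f (w(k := l)))" by (rule sum.swap)
  finally show ?thesis .
qed

text \<open>The weight g of the two end points is arbitrary so that the induction can absorb the
  last edge into it. A closed walk is the case where g is the closing edge
  \<open>x j i\<close>.\<close>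

lemma walk_sum_power:
  fixes x :: "nat \<Rightarrow> nat \<Rightarrow> complex"
  assumes A: "A = mat n n (\<lambda>(i, j). x i j)"
  shows "(\<Sum>w\<in>{..<Suc k} \<rightarrow>\<^sub>E {..<n}. (\<Prod>t<k. x (w t) (w (Suc t))) * g (w 0) (w k)) =
    (\<Sum>i<n. \<Sum>j<n. (A ^\<^sub>m k) $$ (i, j) * g i j)"
proof (induction k arbitrary: g)
  case 0
  have *: "(\<Sum>j<n. (A ^\<^sub>m 0) $$ (i, j) * g i j) = g i i" if "i < n" for i
  proof -
    have "(\<Sum>j<n. (A ^\<^sub>m 0) $$ (i, j) * g i j) = (\<Sum>j<n. if i = j then g i j else 0)"
      using that by (intro sum.cong refl) (auto simp: A one_mat_def)
    then show ?thesis using that by simp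
  qed
  have e: "(\<Sum>i<n. \<Sum>j<n. (A ^\<^sub>m 0) $$ (i, j) * g i j) = (\<Sum>i<n. g i i)"
    by (intro sum.cong refl *) auto
  have "(\<Sum>w\<in>{..<Suc 0} \<rightarrow>\<^sub>E {..<n}. (\<Prod>t<0. x (w t) (w (Suc t))) * g (w 0) (w 0)) =
    (\<Sum>w\<in>{..<0} \<rightarrow>\<^sub>E {..<n}. \<Sum>l<n. (\<lambda>w. (\<Prod>t<0. x (w t) (w (Suc t))) * g (w 0) (w 0)) (w(0 := l)))"
    by (rule sum_PiE_lessThan_Suc)
  then show ?case unfolding e by simp
next
  case (Suc k)
  have Ac: "A \<in> carrier_mat n n" by (simp add: A)
  have "(\<Sum>w\<in>{..<Suc (Suc k)} \<rightarrow>\<^sub>E {..<n}. (\<Prod>t<Suc k. x (w t) (w (Suc t))) * g (w 0) (w (Suc k)))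
    = (\<Sum>w\<in>{..<Suc k} \<rightarrow>\<^sub>E {..<n}. \<Sum>l<n. (\<Prod>t<k. x (w t) (w (Suc t))) * (x (w k) l * g (w 0) l))"
    by (subst sum_PiE_lessThan_Suc) (simp add: mult_ac)
  also have "\<dots> = (\<Sum>i<n. \<Sum>j<n. (A ^\<^sub>m k) $$ (i, j) * (\<Sum>l<n. x j l * g i l))"
    unfolding sum_distrib_left[symmetric] by (rule Suc)
  also have "\<dots> = (\<Sum>i<n. \<Sum>l<n. (\<Sum>j<n. (A ^\<^sub>m k) $$ (i, j) * x j l) * g i l)"
    unfolding sum_distrib_left sum_distrib_right
    by (rule sum.cong[OF refl], subst sum.swap) (simp add: mult.assoc)
  also have "\<dots> = (\<Sum>i<n. \<Sum>l<n. (A ^\<^sub>m Suc k) $$ (i, l) * g i l)"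
  proof (intro sum.cong refl)
    fix i l assume "i \<in> {..<n}" "l \<in> {..<n}"
    then have "(A ^\<^sub>m Suc k) $$ (i, l) = (\<Sum>j<n. (A ^\<^sub>m k) $$ (i, j) * A $$ (j, l))"
      using Ac by (simp add: mat_mult_index_sum[of _ n] del: index_mult_mat(1))
    also have "\<dots> = (\<Sum>j<n. (A ^\<^sub>m k) $$ (i, j) * x j l)"
      using \<open>l \<in> {..<n}\<close> by (intro sum.cong refl) (auto simp: A)
    finally show "(\<Sum>j<n. (A ^\<^sub>m k) $$ (i, j) * x j l) * g i l = (A ^\<^sub>m Suc k) $$ (i, l) * g i l" by simp
  qed
  finally show ?case .
qed

lemma closed_walk_sum_trace:
  assumes A: "A = mat n n (\<lambda>(i, j). x i j)" and "0 < k"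
  shows "closed_walk_sum x n k = mat_trace (A ^\<^sub>m k)"
proof -
  obtain m where k: "k = Suc m" using assms(2) gr0_implies_Suc by blast
  have Ac: "A \<in> carrier_mat n n" by (simp add: A)
  have "closed_walk_sum x n k = (\<Sum>w\<in>{..<Suc m} \<rightarrow>\<^sub>E {..<n}. (\<Prod>t<m. x (w t) (w (Suc t))) * x (w m) (w 0))"
    unfolding closed_walk_sum_def k by (intro sum.cong refl) simp
  also have "\<dots> = (\<Sum>i<n. \<Sum>j<n. (A ^\<^sub>m m) $$ (i, j) * x j i)"
    by (rule walk_sum_power[OF A])
  also have "\<dots> = (\<Sum>i<n. (A ^\<^sub>m Suc m) $$ (i, i))"
  proof (intro sum.cong refl)
    fix i assume i: "i \<in> {..<n}"
    have "(A ^\<^sub>m Suc m) $$ (i, i) = (\<Sum>j<n. (A ^\<^sub>m m) $$ (i, j) * A $$ (j, i))"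
      using Ac i by (simp add: mat_mult_index_sum[of _ n] del: index_mult_mat(1))
    then show "(\<Sum>j<n. (A ^\<^sub>m m) $$ (i, j) * x j i) = (A ^\<^sub>m Suc m) $$ (i, i)"
      using i by (auto simp: A intro!: sum.cong)
  qed
  finally show ?thesis using Ac by (simp add: mat_trace_def k)
qed

lemma poly_prod_list: "poly (prod_list ps) (c :: complex) = (\<Prod>p\<leftarrow>ps. poly p c)"
  by (induction ps) auto

text \<open>One list with multiplicities serves the characteristic polynomial, the reversed
  polynomial and all power sums, so that the analytic bounds and the eigenvalue count speak of the
  same numbers.\<close>

lemma eigenvalue_list:
  assumes A: "A = mat n n (\<lambda>(i, j). x i j)"
  obtains es where "char_poly A = (\<Prod>e\<leftarrow>es. [:- e, 1:])"
    "\<forall>z. rev_char x n z = (\<Prod>e\<leftarrow>es. 1 - e * z)"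
    "\<forall>k>0. closed_walk_sum x n k = (\<Sum>e\<leftarrow>es. e ^ k)"
proof -
  have Ac: "A \<in> carrier_mat n n" by (simp add: A)
  obtain es where es: "char_poly A = (\<Prod>e\<leftarrow>es. [:- e, 1:])" "length es = n"
    using char_poly_factorized[OF Ac] by blast
  show thesis
  proof
    show "char_poly A = (\<Prod>e\<leftarrow>es. [:- e, 1:])" by fact
    show "\<forall>k>0. closed_walk_sum x n k = (\<Sum>e\<leftarrow>es. e ^ k)"
      using closed_walk_sum_trace[OF A] mat_trace_power_eigenvalues[OF Ac es(1)] by simp
    show "\<forall>z. rev_char x n z = (\<Prod>e\<leftarrow>es. 1 - e * z)"
    proof
      fix z
      show "rev_char x n z = (\<Prod>e\<leftarrow>es. 1 - e * z)"
      proof (cases "z = 0")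
        case True
        have "(\<Prod>e\<leftarrow>es. 1 - e * 0) = (1::complex)" by (induction es) auto
        moreover have "rev_char x n 0 = 1"
          unfolding rev_char_def by (subst sum.atMost_shift) simp
        ultimately show ?thesis using True by simp
      next
        case False
        have "z ^ n * poly (char_poly A) (1 / z) = rev_char x n z"
          unfolding A using poly_char_poly_rev_char[of "1 / z" n x] False
          by (simp add: power_divide)
        moreover have "z ^ length es * (\<Prod>e\<leftarrow>es. 1 / z - e) = (\<Prod>e\<leftarrow>es. 1 - e * z)" for es
          using False by (induction es) (auto simp: field_simps)
        from this[of es] have "z ^ n * poly (char_poly A) (1 / z) = (\<Prod>e\<leftarrow>es. 1 - e * z)"
          unfolding es(1) poly_prod_list using es(2) by (simp add: o_def)
        ultimately show ?thesis by simp
      qed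
    qed
  qed
qed

lemma order_prod_list_linear:
  "Polynomial.order z (\<Prod>e\<leftarrow>es. [:- e, 1:]) = count_list es (z :: complex)"
proof (induction es)
  case (Cons e es)
  have nz: "(\<Prod>e\<leftarrow>es. [:- e, 1:]) \<noteq> 0" by (auto simp: prod_list_zero_iff)
  have "Polynomial.order z [:- e, 1:] = (if e = z then 1 else 0)"
    using order_power_n_n[of z 1] by (auto intro: order_0I)
  then show ?case using Cons nz by (simp add: order_mult del: mult_pCons_left)
qed simp

lemma eigenvalue_count_list:
  assumes A: "A \<in> carrier_mat n n" and cp: "char_poly A = (\<Prod>e\<leftarrow>es. [:- e, 1:])"
  shows "spectrum A = set es"
    and "eigenvalue_count A (outer_spectrum \<epsilon> A) = length (filter (\<lambda>e. 1 + \<epsilon> \<le> cmod e) es)"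
proof -
  show s: "spectrum A = set es"
    unfolding spectrum_root_char_poly[OF A] cp poly_prod_list by (auto simp: prod_list_zero_iff o_def)
  define fs where "fs = filter (\<lambda>e. 1 + \<epsilon> \<le> cmod e) es"
  have "eigenvalue_count A (outer_spectrum \<epsilon> A) = (\<Sum>z\<in>set fs. count_list es z)"
    unfolding eigenvalue_count_def outer_spectrum_def s cp order_prod_list_linear
    by (intro sum.cong) (auto simp: fs_def)
  also have "\<dots> = (\<Sum>z\<in>set fs. count_list fs z)"
  proof (intro sum.cong refl)
    fix z assume "z \<in> set fs"
    then have "1 + \<epsilon> \<le> cmod z" by (auto simp: fs_def)
    then show "count_list es z = count_list fs z" unfolding fs_def by (induction es) auto
  qed
  also have "\<dots> = length fs" by (intro sum_count_set) auto
  finally show "eigenvalue_count A (outer_spectrum \<epsilon> A) = length (filter (\<lambda>e. 1 + \<epsilon> \<le> cmod e) es)"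
    by (simp add: fs_def)
qed

text \<open>A splitting of the list rather than of the spectrum keeps multiplicities: a second copy
  of l would sit in \<open>as @ bs\<close> and violate the bound there.\<close>

lemma eigenvalue_count_1_iff:
  assumes A: "A \<in> carrier_mat n n" and cp: "char_poly A = (\<Prod>e\<leftarrow>es. [:- e, 1:])"
  shows "eigenvalue_count A (outer_spectrum \<epsilon> A) = 1 \<longleftrightarrow>
    (\<exists>as l bs. es = as @ l # bs \<and> 1 + \<epsilon> \<le> cmod l \<and> (\<forall>e\<in>set (as @ bs). cmod e < 1 + \<epsilon>))"
proof -
  have "length (filter P es) = 1 \<longleftrightarrow> (\<exists>as l bs. es = as @ l # bs \<and> P l \<and> (\<forall>e\<in>set (as @ bs). \<not> P e))" for P
  proof
    assume "length (filter P es) = 1"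
    then obtain l where "filter P es = [l]" by (auto simp: length_Suc_conv)
    then obtain as bs where "es = as @ l # bs" "\<forall>u\<in>set as. \<not> P u" "P l" "[] = filter P bs"
      unfolding filter_eq_Cons_iff by auto
    moreover from this(4)[symmetric] have "\<forall>u\<in>set bs. \<not> P u" by (simp add: filter_empty_conv)
    ultimately have "es = as @ l # bs \<and> P l \<and> (\<forall>e\<in>set (as @ bs). \<not> P e)" by auto
    then show "\<exists>as l bs. es = as @ l # bs \<and> P l \<and> (\<forall>e\<in>set (as @ bs). \<not> P e)" by blast
  next
    assume "\<exists>as l bs. es = as @ l # bs \<and> P l \<and> (\<forall>e\<in>set (as @ bs). \<not> P e)"
    then obtain as l bs where *: "es = as @ l # bs" "P l" "\<forall>e\<in>set (as @ bs). \<not> P e" by blast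
    then have "filter P as = []" "filter P bs = []" by (auto simp: filter_empty_conv)
    then show "length (filter P es) = 1" using * by simp
  qed
  from this[of "\<lambda>e. 1 + \<epsilon> \<le> cmod e"] show ?thesis
    unfolding eigenvalue_count_list(2)[OF A cp] by (simp add: not_le)
qed

lemma lambda_max_eq:
  assumes A: "A \<in> carrier_mat n n" and cp: "char_poly A = (\<Prod>e\<leftarrow>as @ l # bs. [:- e, 1:])"
    and l: "1 + \<epsilon> \<le> cmod l" "\<forall>e\<in>set (as @ bs). cmod e < 1 + \<epsilon>"
  shows "lambda_max \<epsilon> A = l"
proof -
  have c: "eigenvalue_count A (outer_spectrum \<epsilon> A) = 1"
    unfolding eigenvalue_count_1_iff[OF A cp] using l by blast
  have "(THE z. z \<in> spectrum A \<and> (\<forall>w\<in>spectrum A. w \<noteq> z \<longrightarrow> cmod w < cmod z)) = l"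
    unfolding eigenvalue_count_list(1)[OF A cp]
    using l by (intro the_equality) (auto; force)+
  with c show ?thesis by (simp add: lambda_max_def)
qed

subsection \<open>The outlier eigenvalue\<close>

lemma rev_char_holomorphic: "rev_char x n holomorphic_on S"
  unfolding rev_char_def by (intro holomorphic_intros)

text \<open>Eigenvalues of modulus at least 1 + \<epsilon> are the reciprocals of the zeros of det
  (1 - z Y) with |z| \<le> 1 / (1 + \<epsilon>). Division by the nonvanishing
  \<open>rev_char x n\<close> turns the equation into 1 - a z + e z = 0. The larger radius r leaves
  room for Cauchy's estimate on e.\<close>

lemma outlier_unique:
  fixes u w :: "nat \<Rightarrow> complex" and n :: nat
  defines "a \<equiv> \<Sum>j<n. u j * w j"
  assumes A: "A = mat n n (\<lambda>(i, j). x i j + u i * w j)"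
    and r: "0 < \<epsilon>" "1 / (1 + \<epsilon>) < r"
    and q: "\<And>z. cmod z \<le> r \<Longrightarrow> \<delta> \<le> cmod (rev_char x n z)" and \<delta>: "0 < \<delta>"
    and d: "\<And>z. cmod z \<le> r \<Longrightarrow>
      cmod (\<Sum>k\<le>n. (- z) ^ Suc k * (off_sum x u w n k - diag_sum x u w n k)) \<le> \<delta> * \<tau>"
    and \<tau>: "\<tau> < 1" "1 + \<tau> \<le> cmod a / (1 + \<epsilon>)" "\<tau> < cmod a * ((r - 1 / (1 + \<epsilon>)) / 2)"
  shows "eigenvalue_count A (outer_spectrum \<epsilon> A) = 1"
    and "cmod (lambda_max \<epsilon> A - a) \<le> \<tau> * cmod a / (1 - \<tau>)"
proof -
  define r0 where "r0 = 1 / (1 + \<epsilon>)"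
  define D where "D z = (\<Sum>k\<le>n. (- z) ^ Suc k * (off_sum x u w n k - diag_sum x u w n k))" for z
  define e where "e z = D z / rev_char x n z" for z
  have r0: "0 < r0" "r0 < r" using r by (auto simp: r0_def)
  have q0: "rev_char x n z \<noteq> 0" if "cmod z \<le> r" for z using q[OF that] \<delta> by auto
  have Y: "rev_char (\<lambda>i j. x i j + u i * w j) n z = rev_char x n z * (1 - a * z + e z)"
    if "cmod z \<le> r" for z
    unfolding rev_char_rank_one a_def[symmetric] D_def[symmetric] e_def
    using q0[OF that] by (simp add: algebra_simps)
  have hol: "e holomorphic_on ball 0 r"
    unfolding e_def D_def using q0 by (intro holomorphic_intros rev_char_holomorphic) auto
  have eb: "cmod (e z) \<le> \<tau>" if "cmod z \<le> r" for z
  proof -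
    have "cmod (D z) \<le> \<delta> * \<tau>" unfolding D_def by (rule d[OF that])
    moreover have "0 \<le> \<tau>" using d[of 0] \<delta> r0 by (simp add: zero_le_mult_iff)
    then have "\<delta> * \<tau> \<le> \<tau> * cmod (rev_char x n z)"
      using q[OF that] by (subst mult.commute) (rule mult_left_mono)
    ultimately show ?thesis
      unfolding e_def norm_divide using q0[OF that] by (subst pos_divide_le_eq) auto
  qed
  have eb': "cmod (e z) \<le> \<tau>" if "z \<in> ball 0 r" for z using eb that by simp
  have \<tau>': "1 + \<tau> \<le> r0 * cmod a" "\<tau> < cmod a * ((r - r0) / 2)"
    using \<tau> by (auto simp: r0_def)
  have "\<exists>z0. cmod z0 \<le> r0 \<and> 1 - a * z0 + e z0 = 0 \<and>
    (\<forall>z. cmod z \<le> r0 \<longrightarrow> 1 - a * z + e z = 0 \<longrightarrow> z = z0) \<and> deriv e z0 \<noteq> a"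
    by (rule perturbed_linear_zero[OF hol eb' r0 \<tau>']) blast+
  then obtain z0 where z0: "cmod z0 \<le> r0" "1 - a * z0 + e z0 = 0"
    "\<And>z. cmod z \<le> r0 \<Longrightarrow> 1 - a * z + e z = 0 \<Longrightarrow> z = z0" "deriv e z0 \<noteq> a" by blast
  have z0r: "cmod z0 < r" using z0(1) r0 by simp
  \<comment> \<open>At z0 = 0 the equation would force |e| = 1, which \<tau> < 1 excludes.\<close>
  have z00: "z0 \<noteq> 0"
  proof
    assume "z0 = 0"
    then have "e z0 = - 1" using z0(2) by (simp add: add_eq_0_iff)
    then have "cmod (e z0) = 1" by simp
    then show False using eb[of z0] z0r \<tau> by auto
  qed
  obtain es where es: "char_poly A = (\<Prod>e\<leftarrow>es. [:- e, 1:])"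
    "\<forall>z. rev_char (\<lambda>i j. x i j + u i * w j) n z = (\<Prod>e\<leftarrow>es. 1 - e * z)"
    "\<forall>k>0. closed_walk_sum (\<lambda>i j. x i j + u i * w j) n k = (\<Sum>e\<leftarrow>es. e ^ k)"
    by (rule eigenvalue_list[OF A])
  define l where "l = 1 / z0"
  have root: "e' * z0 = 1" if "e' \<in> set es" "1 + \<epsilon> \<le> cmod e'" for e'
  proof -
    have nz: "e' \<noteq> 0" using that r by auto
    have c: "cmod (1 / e') \<le> r0" using that r by (simp add: norm_divide r0_def frac_le)
    have c': "cmod (1 / e') \<le> r" using c r0 by linarith
    have "(\<Prod>e\<leftarrow>es. 1 - e * (1 / e')) = 0"
      using that(1) nz by (auto simp: prod_list_zero_iff image_iff intro!: bexI[of _ e'])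
    then have "rev_char x n (1 / e') * (1 - a * (1 / e') + e (1 / e')) = 0"
      unfolding Y[OF c', symmetric] es(2)[rule_format] .
    then have "1 / e' = z0" using q0[of "1 / e'"] c r0 by (intro z0(3)) auto
    then show ?thesis using nz by (simp add: field_simps)
  qed
  have "(\<Prod>e\<leftarrow>es. 1 - e * z0) = 0"
    unfolding es(2)[rule_format, symmetric] Y[OF less_imp_le[OF z0r]] z0(2) by simp
  then obtain l' where l': "l' \<in> set es" "l' * z0 = 1" by (auto simp: prod_list_zero_iff)
  then have "l' = l" using z00 by (simp add: l_def field_simps)
  with l' obtain as bs where ab: "es = as @ l # bs" by (metis split_list)
  have lc: "1 + \<epsilon> \<le> cmod l"
    using z0(1) z00 r by (simp add: l_def norm_divide r0_def field_simps)
  \<comment> \<open>A second copy of l would put the factor (1 - l z)^2 into the determinant, so its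
    derivative would vanish at z0. The product rule gives q(z0) (e'(z0) - a) instead, which is
    nonzero.\<close>
  have "l \<notin> set (as @ bs)"
  proof
    assume "l \<in> set (as @ bs)"
    then obtain cs ds where cd: "as @ bs = cs @ l # ds" by (metis split_list)
    define g where "g z = (\<Prod>e\<leftarrow>cs @ ds. 1 - e * z)" for z
    have perm: "rev_char (\<lambda>i j. x i j + u i * w j) n z = (1 - l * z)\<^sup>2 * g z" for z
    proof -
      have "(\<Prod>e\<leftarrow>es. 1 - e * z) = (1 - l * z) * (\<Prod>e\<leftarrow>as @ bs. 1 - e * z)"
        unfolding ab by simp
      also have "(\<Prod>e\<leftarrow>as @ bs. 1 - e * z) = (1 - l * z) * g z"
        unfolding cd g_def by simp
      finally show ?thesis using es(2) by (simp add: power2_eq_square mult.assoc)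
    qed
    have gh: "g holomorphic_on UNIV"
    proof -
      have "(\<lambda>z. \<Prod>e\<leftarrow>xs. 1 - e * z) holomorphic_on UNIV" for xs :: "complex list"
        by (induction xs) (auto intro!: holomorphic_intros)
      then show ?thesis unfolding g_def .
    qed
    have lz: "l * z0 = 1" using z00 by (simp add: l_def)
    have "((\<lambda>z. (1 - l * z)\<^sup>2 * g z) has_field_derivative 0) (at z0)"
      using holomorphic_derivI[OF gh, of z0] lz
      by (auto intro!: derivative_eq_intros)
    then have "((\<lambda>z. rev_char x n z * (1 - a * z + e z)) has_field_derivative 0) (at z0)"
    proof (rule has_field_derivative_transform_within)
      show "0 < r - cmod z0" "z0 \<in> UNIV" using z0r by auto
      fix z assume "dist z z0 < r - cmod z0"
      then have "cmod z \<le> r" using norm_triangle_sub[of z z0] by (simp add: dist_norm)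
      from Y[OF this] show "(1 - l * z)\<^sup>2 * g z = rev_char x n z * (1 - a * z + e z)"
        unfolding perm .
    qed
    moreover have "((\<lambda>z. rev_char x n z * (1 - a * z + e z)) has_field_derivative
      rev_char x n z0 * (deriv e z0 - a)) (at z0)"
    proof -
      have q': "(rev_char x n has_field_derivative deriv (rev_char x n) z0) (at z0)"
        by (rule holomorphic_derivI[OF rev_char_holomorphic open_UNIV UNIV_I])
      have e': "(e has_field_derivative deriv e z0) (at z0)"
        by (rule holomorphic_derivI[OF hol open_ball]) (use z0r in auto)
      have "((\<lambda>z. 1 - a * z + e z) has_field_derivative (deriv e z0 - a)) (at z0)"
        by (rule derivative_eq_intros e' refl | simp)+
      from DERIV_mult[OF q' this] show ?thesis unfolding z0(2) by (simp add: mult.commute)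
    qed
    ultimately have "rev_char x n z0 * (deriv e z0 - a) = 0" by (rule DERIV_unique[symmetric])
    then show False using q0[of z0] z0r z0(4) by simp
  qed
  have small: "\<forall>e\<in>set (as @ bs). cmod e < 1 + \<epsilon>"
  proof (rule ccontr)
    assume "\<not> (\<forall>e\<in>set (as @ bs). cmod e < 1 + \<epsilon>)"
    then obtain e' where e': "e' \<in> set (as @ bs)" "1 + \<epsilon> \<le> cmod e'" by (auto simp: not_less)
    then have "e' * z0 = 1" by (intro root) (auto simp: ab)
    then have "e' = l" using z00 by (simp add: l_def field_simps)
    with e'(1) \<open>l \<notin> set (as @ bs)\<close> show False by simp
  qed
  have Ac: "A \<in> carrier_mat n n" by (simp add: A)
  show "eigenvalue_count A (outer_spectrum \<epsilon> A) = 1"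
    unfolding eigenvalue_count_1_iff[OF Ac es(1)] using ab lc small by blast
  have "lambda_max \<epsilon> A = l" by (rule lambda_max_eq[OF Ac es(1)[unfolded ab] lc small])
  \<comment> \<open>With l = 1 / z0 the equation reads l - a = - e(z0) / z0, and |a z0| = |1 +
    e(z0)| \<ge> 1 - \<tau> bounds z0 from below.\<close>
  moreover have "cmod (l - a) \<le> \<tau> * cmod a / (1 - \<tau>)"
  proof -
    have "a * z0 = 1 + e z0" using z0(2) by (simp add: algebra_simps)
    then have la: "l - a = - e z0 / z0" using z00 by (simp add: l_def field_simps)
    have "1 - \<tau> \<le> cmod a * cmod z0"
      using eb[of z0] z0r norm_triangle_ineq2[of 1 "- e z0"] \<open>a * z0 = 1 + e z0\<close>
      by (simp add: norm_mult[symmetric])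
    moreover have "0 \<le> \<tau>" using eb[of z0] z0r norm_ge_zero[of "e z0"] by linarith
    ultimately have "cmod (e z0) * (1 - \<tau>) \<le> \<tau> * (cmod a * cmod z0)"
      using eb[of z0] z0r \<tau> by (intro mult_mono) auto
    then show ?thesis unfolding la using z00 \<tau> by (simp add: norm_divide field_simps)
  qed
  ultimately show "cmod (lambda_max \<epsilon> A - a) \<le> \<tau> * cmod a / (1 - \<tau>)" by simp
qed

section \<open>The outlier as a measurable function of the matrix entries\<close>

lemma tendsto_sum_list:
  fixes f :: "'c \<Rightarrow> nat \<Rightarrow> complex"
  assumes "\<And>x. x \<in> set xs \<Longrightarrow> f x \<longlonglongrightarrow> g x"
  shows "(\<lambda>k. \<Sum>x\<leftarrow>xs. f x k) \<longlonglongrightarrow> (\<Sum>x\<leftarrow>xs. g x)"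
  using assms by (induction xs) (auto intro!: tendsto_intros)

text \<open>Power iteration with traces: a strictly dominant eigenvalue is the limit of ratios of
  consecutive power sums, hence a limit of explicit rational functions of the entries.\<close>

lemma power_sum_ratio_tendsto:
  fixes l :: complex
  assumes "\<forall>e\<in>set (as @ bs). cmod e < cmod l"
  shows "(\<lambda>k. (\<Sum>e\<leftarrow>as @ l # bs. e ^ Suc (Suc k)) / (\<Sum>e\<leftarrow>as @ l # bs. e ^ Suc k)) \<longlonglongrightarrow> l"
proof (cases "l = 0")
  \<comment> \<open>A dominant eigenvalue 0 leaves room for no other list entry, and the ratio is 0
    / 0, which is 0.\<close>
  case True
  then have "as @ bs = []" using assms by (metis norm_not_less_zero norm_zero list.set_intros(1) neq_Nil_conv)
  then show ?thesis using True by simp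
next
  case l: False
  define s where "s k = (\<Sum>e\<leftarrow>as @ l # bs. (e / l) ^ k)" for k
  have s: "s \<longlonglongrightarrow> 1"
  proof -
    have "(\<lambda>k. \<Sum>e\<leftarrow>as @ bs. (e / l) ^ k) \<longlonglongrightarrow> (\<Sum>e\<leftarrow>as @ bs. 0)"
      using assms l by (intro tendsto_sum_list LIMSEQ_power_zero) (auto simp: norm_divide)
    then have "(\<lambda>k. 1 + (\<Sum>e\<leftarrow>as @ bs. (e / l) ^ k)) \<longlonglongrightarrow> 1 + 0"
      by (intro tendsto_intros) auto
    moreover have "s = (\<lambda>k. 1 + (\<Sum>e\<leftarrow>as @ bs. (e / l) ^ k))"
      using l by (auto simp: s_def)
    ultimately show ?thesis by simp
  qed
  have e: "(\<Sum>e\<leftarrow>as @ l # bs. e ^ k) = l ^ k * s k" for k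
    unfolding s_def sum_list_const_mult[symmetric] using l by (simp add: power_divide)
  have "(\<lambda>k. l * (s (Suc (Suc k)) / s (Suc k))) \<longlonglongrightarrow> l * (1 / 1)"
    using LIMSEQ_Suc[OF s] LIMSEQ_Suc[OF LIMSEQ_Suc[OF s]] by (intro tendsto_intros) auto
  moreover have "(\<Sum>e\<leftarrow>as @ l # bs. e ^ Suc (Suc k)) / (\<Sum>e\<leftarrow>as @ l # bs. e ^ Suc k) = l * (s (Suc (Suc k)) / s (Suc k))" for k
    unfolding e using l by simp
  ultimately show ?thesis by simp
qed

text \<open>The closed exterior is the closure of its interior, so a dense set also reaches points
  of the bounding circle from outside. The point c is left out because an inequality will be divided
  by |z - c|.\<close>

lemma closed_exterior_subset_closure:
  fixes D :: "complex set"
  assumes D: "\<And>X. open X \<Longrightarrow> X \<noteq> {} \<Longrightarrow> \<exists>d\<in>D. d \<in> X" and R: "0 < R"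
  shows "{z. R \<le> cmod z} \<subseteq> closure {z \<in> D. R \<le> cmod z \<and> z \<noteq> c}"
proof
  fix z :: complex assume z: "z \<in> {z. R \<le> cmod z}"
  show "z \<in> closure {z \<in> D. R \<le> cmod z \<and> z \<noteq> c}"
    unfolding closure_approachable
  proof (intro allI impI)
    fix e :: real assume e: "0 < e"
    define X where "X = ball z e \<inter> {w. R < cmod w} - {c}"
    have "open X" unfolding X_def
      by (intro open_Diff open_Int open_Collect_less continuous_intros) auto
    moreover have "X \<noteq> {}"
    proof -
      define y where "y s = z * of_real (1 + s)" for s :: real
      define t where "t = e / (2 * cmod z)"
      have zp: "0 < cmod z" using z R by auto
      have y: "y s \<in> ball z e \<inter> {w. R < cmod w}" if "0 < s" "s \<le> t" for s
      proof -
        have "cmod (z - y s) = cmod z * s"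
          using that by (simp add: y_def algebra_simps norm_mult)
        also have "\<dots> \<le> cmod z * t" using that zp by (intro mult_left_mono) auto
        also have "\<dots> < e" using zp e by (simp add: t_def)
        finally have "y s \<in> ball z e" by (simp add: dist_norm)
        have "cmod (y s) = cmod z * (1 + s)"
          using that unfolding y_def norm_mult norm_of_real by simp
        moreover have "0 < cmod z * s" using zp that by simp
        ultimately have "R < cmod (y s)" using z by (simp add: distrib_left)
        with \<open>y s \<in> ball z e\<close> show ?thesis by simp
      qed
      have t: "0 < t" using zp e by (simp add: t_def)
      \<comment> \<open>Two radial displacements are tried because one of them may hit c.\<close>
      have "y t \<noteq> y (t / 2)" using zp t by (auto simp: y_def)
      then have "y t \<in> X \<or> y (t / 2) \<in> X"
        using y[of t] y[of "t / 2"] t unfolding X_def by auto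
      then show ?thesis by auto
    qed
    ultimately obtain d where "d \<in> D" "d \<in> X" using D by blast
    then show "\<exists>y\<in>{z \<in> D. R \<le> cmod z \<and> z \<noteq> c}. dist y z < e"
      by (intro bexI[of _ d]) (auto simp: X_def dist_commute)
  qed
qed

text \<open>The event of a single simple outlier in countably many conditions: L is a root in the
  exterior, and the cofactor p(z) / (z - L) is bounded away from zero there. The bound is some 1 /
  (m + 1) and is tested on a dense set. Any further exterior eigenvalue, including a second copy of
  L, would be a zero of the cofactor. The converse holds whatever value \<open>lim\<close> takes
  when the ratios do not converge.\<close>

lemma eigenvalue_count_1_iff_countable:
  assumes D: "\<And>X. open X \<Longrightarrow> X \<noteq> {} \<Longrightarrow> \<exists>d\<in>D. d \<in> X" and \<epsilon>: "0 < \<epsilon>"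
    and A: "A = mat n n (\<lambda>(i, j). x i j)"
  defines "L \<equiv> lim (\<lambda>k. closed_walk_sum x n (Suc (Suc k)) / closed_walk_sum x n (Suc k))"
    and "p \<equiv> poly (char_poly A)"
  shows "eigenvalue_count A (outer_spectrum \<epsilon> A) = 1 \<longleftrightarrow>
    p L = 0 \<and> 1 + \<epsilon> \<le> cmod L \<and>
    (\<exists>m. \<forall>z\<in>{z \<in> D. 1 + \<epsilon> \<le> cmod z}. 1 / real (Suc m) * cmod (z - L) \<le> cmod (p z))" (is "_ \<longleftrightarrow> ?R")
    and "eigenvalue_count A (outer_spectrum \<epsilon> A) = 1 \<Longrightarrow> lambda_max \<epsilon> A = L"
proof -
  have Ac: "A \<in> carrier_mat n n" by (simp add: A)
  obtain es where es: "char_poly A = (\<Prod>e\<leftarrow>es. [:- e, 1:])"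
    "\<forall>z. rev_char x n z = (\<Prod>e\<leftarrow>es. 1 - e * z)"
    "\<forall>k>0. closed_walk_sum x n k = (\<Sum>e\<leftarrow>es. e ^ k)"
    by (rule eigenvalue_list[OF A])
  have p: "p z = (\<Prod>e\<leftarrow>es. z - e)" for z
    unfolding p_def es(1) poly_prod_list by (simp add: o_def)
  have L: "L = l" if "es = as @ l # bs" "1 + \<epsilon> \<le> cmod l" "\<forall>e\<in>set (as @ bs). cmod e < 1 + \<epsilon>" for as l bs
  proof -
    have "\<forall>e\<in>set (as @ bs). cmod e < cmod l" using that by force
    from power_sum_ratio_tendsto[OF this] show ?thesis
      unfolding L_def using es(3) that(1) by (auto intro!: limI simp del: power_Suc)
  qed
  have 1: "?R" if "eigenvalue_count A (outer_spectrum \<epsilon> A) = 1"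
  proof -
    obtain as l bs where l: "es = as @ l # bs" "1 + \<epsilon> \<le> cmod l" "\<forall>e\<in>set (as @ bs). cmod e < 1 + \<epsilon>"
      using \<open>eigenvalue_count A (outer_spectrum \<epsilon> A) = 1\<close> unfolding eigenvalue_count_1_iff[OF Ac es(1)] by blast
    define \<delta> where "\<delta> = (\<Prod>e\<leftarrow>as @ bs. 1 + \<epsilon> - cmod e)"
    have pf: "p z = (z - l) * (\<Prod>e\<leftarrow>as @ bs. z - e)" for z
      unfolding p l(1) by simp
    have lower: "0 < (\<Prod>e\<leftarrow>xs. 1 + \<epsilon> - cmod e) \<and> (\<Prod>e\<leftarrow>xs. 1 + \<epsilon> - cmod e) \<le> cmod (\<Prod>e\<leftarrow>xs. z - e)"
      if "\<forall>e\<in>set xs. cmod e < 1 + \<epsilon>" "1 + \<epsilon> \<le> cmod z" for xs z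
      using that(1)
    proof (induction xs)
      case (Cons e xs)
      have "1 + \<epsilon> - cmod e \<le> cmod (z - e)" using norm_triangle_ineq2[of z e] that(2) by linarith
      with Cons show ?case by (auto simp: norm_mult intro!: mult_mono)
    qed simp
    have \<delta>: "0 < \<delta>" using lower[OF l(3) l(2)] unfolding \<delta>_def by blast
    obtain m where m: "1 / real (Suc m) < \<delta>"
      using reals_Archimedean[OF \<delta>] by (auto simp: inverse_eq_divide)
    have "1 / real (Suc m) * cmod (z - l) \<le> cmod (p z)" if "1 + \<epsilon> \<le> cmod z" for z
    proof -
      have "1 / real (Suc m) \<le> cmod (\<Prod>e\<leftarrow>as @ bs. z - e)"
        using lower[OF l(3) that] m unfolding \<delta>_def by linarith
      then show ?thesis unfolding pf norm_mult
        by (subst mult.commute) (intro mult_left_mono norm_ge_zero)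
    qed
    then show ?R unfolding L[OF l] using l(2) by (auto simp: pf)
  qed
  have 2: "eigenvalue_count A (outer_spectrum \<epsilon> A) = 1" if R: ?R
  proof -
    obtain m where m: "\<And>z. z \<in> D \<Longrightarrow> 1 + \<epsilon> \<le> cmod z \<Longrightarrow> 1 / real (Suc m) * cmod (z - L) \<le> cmod (p z)"
      using R by blast
    have "L \<in> set es" using R unfolding p by (auto simp: prod_list_zero_iff)
    then obtain as bs where ab: "es = as @ L # bs" by (metis split_list)
    define h where "h z = (\<Prod>e\<leftarrow>as @ bs. z - e)" for z
    have ph: "p z = (z - L) * h z" for z unfolding p ab h_def by simp
    have hc: "continuous_on UNIV h"
    proof -
      have "continuous_on UNIV (\<lambda>z. \<Prod>e\<leftarrow>xs. z - e)" for xs :: "complex list"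
        by (induction xs) (auto intro!: continuous_intros)
      then show ?thesis unfolding h_def .
    qed
    have "closure {z \<in> D. 1 + \<epsilon> \<le> cmod z \<and> z \<noteq> L} \<subseteq> {z. 1 / real (Suc m) \<le> cmod (h z)}"
    proof (rule closure_minimal)
      show "{z \<in> D. 1 + \<epsilon> \<le> cmod z \<and> z \<noteq> L} \<subseteq> {z. 1 / real (Suc m) \<le> cmod (h z)}"
      proof safe
        fix z assume "z \<in> D" "1 + \<epsilon> \<le> cmod z" "z \<noteq> L"
        then have "1 / real (Suc m) * cmod (z - L) \<le> cmod (h z) * cmod (z - L)"
          using m[of z] unfolding ph norm_mult by (simp add: mult.commute)
        then show "1 / real (Suc m) \<le> cmod (h z)" using \<open>z \<noteq> L\<close> by (simp only: mult_le_cancel_right) auto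
      qed
      show "closed {z. 1 / real (Suc m) \<le> cmod (h z)}"
        by (intro closed_Collect_le continuous_intros hc)
    qed
    with closed_exterior_subset_closure[OF D, where c=L and R="1 + \<epsilon>"] \<epsilon>
    have h: "1 / real (Suc m) \<le> cmod (h z)" if "1 + \<epsilon> \<le> cmod z" for z using that by auto
    have "cmod e < 1 + \<epsilon>" if "e \<in> set (as @ bs)" for e
    proof (rule ccontr)
      assume "\<not> cmod e < 1 + \<epsilon>"
      then have "1 / real (Suc m) \<le> cmod (h e)" by (intro h) auto
      moreover have "h e = 0" unfolding h_def using that by (auto simp: prod_list_zero_iff)
      ultimately show False by (simp add: field_simps)
    qed
    then show ?thesis unfolding eigenvalue_count_1_iff[OF Ac es(1)] using ab R by blast
  qed
  from 1 2 show "eigenvalue_count A (outer_spectrum \<epsilon> A) = 1 \<longleftrightarrow> ?R" by blast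
  assume "eigenvalue_count A (outer_spectrum \<epsilon> A) = 1"
  then obtain as l bs where l: "es = as @ l # bs" "1 + \<epsilon> \<le> cmod l" "\<forall>e\<in>set (as @ bs). cmod e < 1 + \<epsilon>"
    unfolding eigenvalue_count_1_iff[OF Ac es(1)] by blast
  show "lambda_max \<epsilon> A = L"
    unfolding L[OF l] by (rule lambda_max_eq[OF Ac es(1)[unfolded l(1)] l(2,3)])
qed

subsection \<open>Orthogonality of monomials in the entries\<close>

text \<open>Exactly what orthogonality of monomials needs; it covers both the identity, for the
  given entries, and their truncation.\<close>

definition centered :: "complex measure \<Rightarrow> (complex \<Rightarrow> complex) \<Rightarrow> bool" where
  "centered law f \<longleftrightarrow> f \<in> borel_measurable borel \<and> integrable law f \<and> (\<integral>x. f x \<partial>law) = 0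
     \<and> integrable law (\<lambda>x. (cmod (f x))\<^sup>2)"

lemma mult_cnj_cmod: "x * cnj x = complex_of_real ((cmod x)\<^sup>2)"
  by (simp only: complex_norm_square)

lemma cmod_sq_Re: "(cmod x)\<^sup>2 = Re (x * cnj x)"
  by (simp only: mult_cnj_cmod Re_complex_of_real)

lemma integral_mult_cnj_self: "(\<integral>x. f x * cnj (f x) \<partial>M) = complex_of_real (\<integral>x. (cmod (f x))\<^sup>2 \<partial>M)"
  by (simp only: mult_cnj_cmod integral_complex_of_real)

lemma cnj_measurable [measurable]: "cnj \<in> borel_measurable borel"
  by (intro borel_measurable_continuous_onI continuous_intros)

lemma integrable_mult_cnj:
  fixes f g :: "'a \<Rightarrow> complex"
  assumes "f \<in> borel_measurable M" "g \<in> borel_measurable M"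
    and "integrable M (\<lambda>x. (cmod (f x))\<^sup>2)" "integrable M (\<lambda>x. (cmod (g x))\<^sup>2)"
  shows "integrable M (\<lambda>x. f x * cnj (g x))"
proof (rule Bochner_Integration.integrable_bound)
  show "integrable M (\<lambda>x. (cmod (f x))\<^sup>2 + (cmod (g x))\<^sup>2)" using assms by auto
  have "cmod (f x * cnj (g x)) \<le> (cmod (f x))\<^sup>2 + (cmod (g x))\<^sup>2" for x
  proof -
    have "0 \<le> cmod (f x) * cmod (g x)" by simp
    then have "cmod (f x) * cmod (g x) \<le> (cmod (f x))\<^sup>2 + (cmod (g x))\<^sup>2"
      using sum_squares_bound[of "cmod (f x)" "cmod (g x)"] by linarith
    then show ?thesis by (simp add: norm_mult)
  qed
  then show "AE x in M. norm (f x * cnj (g x)) \<le> norm ((cmod (f x))\<^sup>2 + (cmod (g x))\<^sup>2)" by simp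
  show "(\<lambda>x. f x * cnj (g x)) \<in> borel_measurable M"
    by (intro borel_measurable_times assms(1) measurable_compose[OF assms(2) cnj_measurable])
qed

lemma orthogonal_sum_second_moment:
  fixes Z :: "'s \<Rightarrow> 'a \<Rightarrow> complex"
  assumes "finite S"
    and int: "\<And>s t. s \<in> S \<Longrightarrow> t \<in> S \<Longrightarrow> integrable M (\<lambda>\<omega>. Z s \<omega> * cnj (Z t \<omega>))"
    and orth: "\<And>s t. s \<in> S \<Longrightarrow> t \<in> S \<Longrightarrow> s \<noteq> t \<Longrightarrow> (\<integral>\<omega>. Z s \<omega> * cnj (Z t \<omega>) \<partial>M) = 0"
  shows "integrable M (\<lambda>\<omega>. (cmod (\<Sum>s\<in>S. c s * Z s \<omega>))\<^sup>2)"
    and "(\<integral>\<omega>. (cmod (\<Sum>s\<in>S. c s * Z s \<omega>))\<^sup>2 \<partial>M) = (\<Sum>s\<in>S. (cmod (c s))\<^sup>2 * (\<integral>\<omega>. (cmod (Z s \<omega>))\<^sup>2 \<partial>M))"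
proof -
  note sq = cmod_sq_Re
  have e: "(\<Sum>s\<in>S. c s * Z s \<omega>) * cnj (\<Sum>s\<in>S. c s * Z s \<omega>) =
      (\<Sum>s\<in>S. \<Sum>t\<in>S. (c s * cnj (c t)) * (Z s \<omega> * cnj (Z t \<omega>)))" for \<omega>
    by (simp add: sum_product cnj_sum mult_ac)
  have i: "integrable M (\<lambda>\<omega>. \<Sum>s\<in>S. \<Sum>t\<in>S. (c s * cnj (c t)) * (Z s \<omega> * cnj (Z t \<omega>)))"
    by (intro Bochner_Integration.integrable_sum integrable_mult_right int)
  show "integrable M (\<lambda>\<omega>. (cmod (\<Sum>s\<in>S. c s * Z s \<omega>))\<^sup>2)"
    unfolding sq e by (rule integrable_Re[OF i])
  have "(\<integral>\<omega>. (cmod (\<Sum>s\<in>S. c s * Z s \<omega>))\<^sup>2 \<partial>M) =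
    Re (\<integral>\<omega>. (\<Sum>s\<in>S. \<Sum>t\<in>S. (c s * cnj (c t)) * (Z s \<omega> * cnj (Z t \<omega>))) \<partial>M)"
    unfolding sq e by (rule integral_Re[OF i])
  also have "(\<integral>\<omega>. (\<Sum>s\<in>S. \<Sum>t\<in>S. (c s * cnj (c t)) * (Z s \<omega> * cnj (Z t \<omega>))) \<partial>M) =
    (\<Sum>s\<in>S. \<Sum>t\<in>S. (c s * cnj (c t)) * (\<integral>\<omega>. Z s \<omega> * cnj (Z t \<omega>) \<partial>M))"
    by (simp add: Bochner_Integration.integral_sum Bochner_Integration.integrable_sum integrable_mult_right int)
  also have "\<dots> = (\<Sum>s\<in>S. \<Sum>t\<in>S. if t = s then (c s * cnj (c s)) * (\<integral>\<omega>. Z s \<omega> * cnj (Z s \<omega>) \<partial>M) else 0)"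
    using orth by (intro sum.cong refl) auto
  also have "\<dots> = (\<Sum>s\<in>S. (c s * cnj (c s)) * (\<integral>\<omega>. Z s \<omega> * cnj (Z s \<omega>) \<partial>M))"
    using assms(1) by simp
  also have "Re \<dots> = (\<Sum>s\<in>S. (cmod (c s))\<^sup>2 * (\<integral>\<omega>. (cmod (Z s \<omega>))\<^sup>2 \<partial>M))"
  proof -
    have "Re ((c s * cnj (c s)) * (\<integral>\<omega>. Z s \<omega> * cnj (Z s \<omega>) \<partial>M)) = (cmod (c s))\<^sup>2 * (\<integral>\<omega>. (cmod (Z s \<omega>))\<^sup>2 \<partial>M)"
      if "s \<in> S" for s
      unfolding integral_mult_cnj_self unfolding mult_cnj_cmod
      by (simp only: of_real_mult[symmetric] Re_complex_of_real)
    then show ?thesis by simp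
  qed
  finally show "(\<integral>\<omega>. (cmod (\<Sum>s\<in>S. c s * Z s \<omega>))\<^sup>2 \<partial>M) = (\<Sum>s\<in>S. (cmod (c s))\<^sup>2 * (\<integral>\<omega>. (cmod (Z s \<omega>))\<^sup>2 \<partial>M))" .
qed

text \<open>The function acts on the factor from A only, so the given and the truncated matrix have
  the same zero pattern and live on the same space.\<close>

definition entry ::
  "nat \<Rightarrow> (nat \<Rightarrow> nat \<Rightarrow> 'a \<Rightarrow> complex) \<Rightarrow> (nat \<Rightarrow> nat \<Rightarrow> 'a \<Rightarrow> complex) \<Rightarrow>
   (complex \<Rightarrow> complex) \<Rightarrow> 'a \<Rightarrow> nat \<Rightarrow> nat \<Rightarrow> complex" where
  "entry k A B f \<omega> i j = complex_of_real (1 / sqrt (real k)) * B i j \<omega> * f (A i j \<omega>)"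

context sparse_iid_model
begin

lemma A_measurable: "i < n \<Longrightarrow> j < n \<Longrightarrow> A i j \<in> borel_measurable M"
  using A_indep unfolding indep_vars_def by force

lemma B_measurable: "i < n \<Longrightarrow> j < n \<Longrightarrow> B i j \<in> borel_measurable M"
  using B_indep unfolding indep_vars_def by force

lemma entry_measurable:
  assumes "f \<in> borel_measurable borel" "i < n" "j < n"
  shows "(\<lambda>\<omega>. entry k A B f \<omega> i j) \<in> borel_measurable M"
  unfolding entry_def
  using measurable_compose[OF A_measurable[OF assms(2,3)] assms(1)] B_measurable[OF assms(2,3)]
  by measurable

lemma integrable_A_iff:
  assumes "i < n" "j < n" "h \<in> borel_measurable borel"
  shows "integrable M (\<lambda>\<omega>. h (A i j \<omega>)) \<longleftrightarrow> integrable law (h :: complex \<Rightarrow> complex)"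
    and "expectation (\<lambda>\<omega>. h (A i j \<omega>)) = (\<integral>x. h x \<partial>law)"
  using assms A_measurable[OF assms(1,2)]
  by (simp_all add: A_law[OF assms(1,2), symmetric] integrable_distr_eq integral_distr)

lemma B_expectation:
  assumes "i < n" "j < n"
  shows "integrable M (B i j)" "expectation (B i j) = complex_of_real (real k / real n)"
proof -
  define E where "E = {\<omega> \<in> space M. B i j \<omega> = 1}"
  have E: "E \<in> sets M" unfolding E_def using B_measurable[OF assms] by measurable
  have e: "B i j \<omega> = complex_of_real (indicator E \<omega>)" if "\<omega> \<in> space M" for \<omega>
    using B_values[OF assms that] that by (auto simp: E_def indicator_def)
  have "integrable M (\<lambda>\<omega>. complex_of_real (indicator E \<omega>))" using E by (intro integrable_of_real) (simp add: emeasure_eq_measure)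
  then show "integrable M (B i j)"
    by (subst Bochner_Integration.integrable_cong[OF refl e])
  have "expectation (B i j) = expectation (\<lambda>\<omega>. complex_of_real (indicator E \<omega>))"
    by (rule Bochner_Integration.integral_cong[OF refl e])
  also have "\<dots> = complex_of_real (prob E)" using E by (simp only: integral_complex_of_real) simp
  finally show "expectation (B i j) = complex_of_real (real k / real n)"
    unfolding E_def B_law[OF assms] .
qed

text \<open>The arrays A and B are independent of each other as wholes, so the two products are
  first written as functions \<open>\<phi>\<close> and \<open>\<psi>\<close> of the arrays.
  Independence inside each array then splits them over the edges.\<close>

lemma expectation_edge_prod:
  fixes h :: "nat \<times> nat \<Rightarrow> complex \<Rightarrow> complex"
  assumes F: "F \<subseteq> {..<n} \<times> {..<n}"
    and h: "\<And>e. e \<in> F \<Longrightarrow> h e \<in> borel_measurable borel" "\<And>e. e \<in> F \<Longrightarrow> integrable law (h e)"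
  shows "integrable M (\<lambda>\<omega>. \<Prod>(i, j)\<in>F. B i j \<omega> * h (i, j) (A i j \<omega>))"
    and "expectation (\<lambda>\<omega>. \<Prod>(i, j)\<in>F. B i j \<omega> * h (i, j) (A i j \<omega>)) =
      (\<Prod>e\<in>F. complex_of_real (real k / real n) * (\<integral>x. h e x \<partial>law))"
proof -
  have fin: "finite F" using F by (rule finite_subset) auto
  have N: "fst e < n" "snd e < n" if "e \<in> F" for e using that F by auto
  have indA: "indep_vars (\<lambda>_. borel) (\<lambda>e \<omega>. h e (A (fst e) (snd e) \<omega>)) F"
  proof -
    have "indep_vars (\<lambda>_. borel) (\<lambda>e. A (fst e) (snd e)) F"
      using indep_vars_subset[OF A_indep F] by (simp add: split_def)
    from indep_vars_compose2[OF this, of h "\<lambda>_. borel"] h(1) show ?thesis by simp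
  qed
  have indB: "indep_vars (\<lambda>_. borel) (\<lambda>e. B (fst e) (snd e)) F"
    using indep_vars_subset[OF B_indep F] by (simp add: split_def)
  have iA: "integrable M (\<lambda>\<omega>. h e (A (fst e) (snd e) \<omega>))" if "e \<in> F" for e
    using integrable_A_iff(1)[of "fst e" "snd e" "h e"] N[OF that] h[OF that] by simp
  have iB: "integrable M (B (fst e) (snd e))" if "e \<in> F" for e
    using B_expectation(1) N[OF that] by simp
  let ?P = "\<lambda>\<omega>. \<Prod>e\<in>F. h e (A (fst e) (snd e) \<omega>)"
  let ?Q = "\<lambda>\<omega>. \<Prod>e\<in>F. B (fst e) (snd e) \<omega>"
  let ?N = "{..<n} \<times> {..<n}"
  define \<phi> where "\<phi> a = (\<Prod>e\<in>F. h e (a e))" for a :: "nat \<times> nat \<Rightarrow> complex"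
  define \<psi> where "\<psi> a = (\<Prod>e\<in>F. a e)" for a :: "nat \<times> nat \<Rightarrow> complex"
  have "\<phi> \<in> borel_measurable (Pi\<^sub>M ?N (\<lambda>_. borel))"
    unfolding \<phi>_def using F h(1)
    by (intro borel_measurable_prod measurable_compose[OF measurable_component_singleton]) auto
  moreover have "\<psi> \<in> borel_measurable (Pi\<^sub>M ?N (\<lambda>_. borel))"
    unfolding \<psi>_def using F by (intro borel_measurable_prod measurable_component_singleton) auto
  ultimately have "indep_var borel (\<phi> \<circ> (\<lambda>\<omega>. \<lambda>(i, j)\<in>?N. A i j \<omega>)) borel (\<psi> \<circ> (\<lambda>\<omega>. \<lambda>(i, j)\<in>?N. B i j \<omega>))"
    by (rule indep_var_compose[OF A_B_indep])
  moreover have "\<phi> \<circ> (\<lambda>\<omega>. \<lambda>(i, j)\<in>?N. A i j \<omega>) = ?P"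
    unfolding \<phi>_def o_def using F by (intro ext prod.cong refl) (auto simp: split_def)
  moreover have "\<psi> \<circ> (\<lambda>\<omega>. \<lambda>(i, j)\<in>?N. B i j \<omega>) = ?Q"
    unfolding \<psi>_def o_def using F by (intro ext prod.cong refl) (auto simp: split_def)
  ultimately have ind: "indep_var borel ?P borel ?Q" by simp
  have iP: "integrable M ?P" by (rule indep_vars_integrable[OF fin indA iA])
  have iQ: "integrable M ?Q" by (rule indep_vars_integrable[OF fin indB iB])
  have eq: "(\<Prod>(i, j)\<in>F. B i j \<omega> * h (i, j) (A i j \<omega>)) = ?P \<omega> * ?Q \<omega>" for \<omega>
    by (simp add: split_def prod.distrib mult.commute)
  show "integrable M (\<lambda>\<omega>. \<Prod>(i, j)\<in>F. B i j \<omega> * h (i, j) (A i j \<omega>))"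
    unfolding eq by (rule indep_var_integrable[OF ind iP iQ])
  have "expectation (\<lambda>\<omega>. ?P \<omega> * ?Q \<omega>) = expectation ?P * expectation ?Q"
    by (rule indep_var_lebesgue_integral[OF ind iP iQ])
  also have "expectation ?P = (\<Prod>e\<in>F. expectation (\<lambda>\<omega>. h e (A (fst e) (snd e) \<omega>)))"
    by (rule indep_vars_lebesgue_integral[OF fin indA iA])
  also have "\<dots> = (\<Prod>e\<in>F. \<integral>x. h e x \<partial>law)"
    using N h by (intro prod.cong refl integrable_A_iff(2)) auto
  also have "expectation ?Q = (\<Prod>e\<in>F. expectation (B (fst e) (snd e)))"
    by (rule indep_vars_lebesgue_integral[OF fin indB iB])
  also have "\<dots> = (\<Prod>e\<in>F. complex_of_real (real k / real n))"
    using N by (intro prod.cong refl B_expectation(2)) auto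
  finally show "expectation (\<lambda>\<omega>. \<Prod>(i, j)\<in>F. B i j \<omega> * h (i, j) (A i j \<omega>)) =
      (\<Prod>e\<in>F. complex_of_real (real k / real n) * (\<integral>x. h e x \<partial>law))"
    unfolding eq prod.distrib
    by (simp only: mult.commute[of "\<Prod>e\<in>F. complex_of_real (real k / real n)"])
qed

text \<open>A word may repeat edges, and each letter carries its own function, which accommodates
  conjugated factors. Grouping the letters by edge restores independent factors.\<close>

lemma expectation_word:
  fixes c :: "'t \<Rightarrow> nat \<times> nat" and g :: "'t \<Rightarrow> complex \<Rightarrow> complex"
  assumes T: "finite T" "c ` T \<subseteq> {..<n} \<times> {..<n}"
    and g: "\<And>t. t \<in> T \<Longrightarrow> g t \<in> borel_measurable borel"
      "\<And>e. e \<in> c ` T \<Longrightarrow> integrable law (\<lambda>x. \<Prod>t | t \<in> T \<and> c t = e. g t x)"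
  shows "integrable M (\<lambda>\<omega>. \<Prod>t\<in>T. entry k A B (g t) \<omega> (fst (c t)) (snd (c t)))"
    and "expectation (\<lambda>\<omega>. \<Prod>t\<in>T. entry k A B (g t) \<omega> (fst (c t)) (snd (c t))) =
      complex_of_real (1 / sqrt (real k)) ^ card T *
      (\<Prod>e\<in>c ` T. complex_of_real (real k / real n) * (\<integral>x. (\<Prod>t | t \<in> T \<and> c t = e. g t x) \<partial>law))"
proof -
  define h where "h e x = (\<Prod>t | t \<in> T \<and> c t = e. g t x)" for e x
  have e: "(\<Prod>t\<in>T. entry k A B (g t) \<omega> (fst (c t)) (snd (c t))) =
    complex_of_real (1 / sqrt (real k)) ^ card T * (\<Prod>(i, j)\<in>c ` T. B i j \<omega> * h (i, j) (A i j \<omega>))"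
    if \<omega>: "\<omega> \<in> space M" for \<omega>
  proof -
    have "(\<Prod>t\<in>T. entry k A B (g t) \<omega> (fst (c t)) (snd (c t))) =
      complex_of_real (1 / sqrt (real k)) ^ card T *
      (\<Prod>t\<in>T. B (fst (c t)) (snd (c t)) \<omega> * g t (A (fst (c t)) (snd (c t)) \<omega>))"
      unfolding entry_def mult.assoc prod.distrib[of "\<lambda>_. complex_of_real (1 / sqrt (real k))"]
      by (simp only: prod_constant)
    also have "(\<Prod>t\<in>T. B (fst (c t)) (snd (c t)) \<omega> * g t (A (fst (c t)) (snd (c t)) \<omega>)) =
      (\<Prod>e\<in>c ` T. \<Prod>t | t \<in> T \<and> c t = e. B (fst (c t)) (snd (c t)) \<omega> * g t (A (fst (c t)) (snd (c t)) \<omega>))"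
      by (rule prod.image_gen[OF T(1)])
    also have "\<dots> = (\<Prod>(i, j)\<in>c ` T. B i j \<omega> * h (i, j) (A i j \<omega>))"
    proof (intro prod.cong refl)
      fix e assume eT: "e \<in> c ` T"
      obtain i j where ij: "e = (i, j)" by (cases e)
      have ij': "i < n" "j < n" using eT T(2) ij by auto
      \<comment> \<open>A Bernoulli variable equals its powers: an edge costs k / n once, however
        often it is used, while each use brings 1 / sqrt k.\<close>
      have "B i j \<omega> ^ m = B i j \<omega>" if "0 < m" for m
        using B_values[OF ij' \<omega>] that by auto
      moreover have "0 < card {t. t \<in> T \<and> c t = e}"
        using eT T(1) by (auto simp: card_gt_0_iff)
      ultimately have "(\<Prod>t | t \<in> T \<and> c t = e. B i j \<omega>) = B i j \<omega>" by simp
      moreover have "(\<Prod>t | t \<in> T \<and> c t = e. B (fst (c t)) (snd (c t)) \<omega> * g t (A (fst (c t)) (snd (c t)) \<omega>))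
        = (\<Prod>t | t \<in> T \<and> c t = e. B i j \<omega> * g t (A i j \<omega>))"
        by (intro prod.cong refl) (auto simp: ij)
      ultimately show "(\<Prod>t | t \<in> T \<and> c t = e. B (fst (c t)) (snd (c t)) \<omega> * g t (A (fst (c t)) (snd (c t)) \<omega>))
        = (case e of (i, j) \<Rightarrow> B i j \<omega> * h (i, j) (A i j \<omega>))"
        unfolding prod.distrib h_def by (simp add: ij)
    qed
    finally show ?thesis .
  qed
  have hm: "h e \<in> borel_measurable borel" for e
    unfolding h_def by (intro borel_measurable_prod g) auto
  have hi: "integrable law (h e)" if "e \<in> c ` T" for e
    using g(2)[OF that] by (simp add: h_def[abs_def])
  have *: "integrable M (\<lambda>\<omega>. \<Prod>(i, j)\<in>c ` T. B i j \<omega> * h (i, j) (A i j \<omega>))"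
    "expectation (\<lambda>\<omega>. \<Prod>(i, j)\<in>c ` T. B i j \<omega> * h (i, j) (A i j \<omega>)) =
      (\<Prod>e\<in>c ` T. complex_of_real (real k / real n) * (\<integral>x. h e x \<partial>law))"
    by (rule expectation_edge_prod[OF T(2) hm hi], assumption)+
  show "integrable M (\<lambda>\<omega>. \<Prod>t\<in>T. entry k A B (g t) \<omega> (fst (c t)) (snd (c t)))"
    by (subst Bochner_Integration.integrable_cong[OF refl e]) (auto intro!: integrable_mult_right *)
  have "expectation (\<lambda>\<omega>. \<Prod>t\<in>T. entry k A B (g t) \<omega> (fst (c t)) (snd (c t))) =
    expectation (\<lambda>\<omega>. complex_of_real (1 / sqrt (real k)) ^ card T * (\<Prod>(i, j)\<in>c ` T. B i j \<omega> * h (i, j) (A i j \<omega>)))"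
    by (rule Bochner_Integration.integral_cong[OF refl e])
  also have "\<dots> = complex_of_real (1 / sqrt (real k)) ^ card T * (\<Prod>e\<in>c ` T. complex_of_real (real k / real n) * (\<integral>x. h e x \<partial>law))"
    unfolding *(2)[symmetric] by (rule Bochner_Integration.integral_mult_right) (use *(1) in auto)
  finally show "expectation (\<lambda>\<omega>. \<Prod>t\<in>T. entry k A B (g t) \<omega> (fst (c t)) (snd (c t))) =
      complex_of_real (1 / sqrt (real k)) ^ card T *
      (\<Prod>e\<in>c ` T. complex_of_real (real k / real n) * (\<integral>x. (\<Prod>t | t \<in> T \<and> c t = e. g t x) \<partial>law))"
    unfolding h_def .
qed

lemma cnj_entry:
  assumes "\<omega> \<in> space M" "i < n" "j < n"
  shows "cnj (entry k A B f \<omega> i j) = entry k A B (\<lambda>x. cnj (f x)) \<omega> i j"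
  using B_values[OF assms(2,3,1)] by (auto simp: entry_def)

definition monomial :: "(complex \<Rightarrow> complex) \<Rightarrow> (nat \<times> nat) set \<Rightarrow> 'a \<Rightarrow> complex" where
  "monomial f F \<omega> = (\<Prod>e\<in>F. entry k A B f \<omega> (fst e) (snd e))"

text \<open>The letters form the disjoint sum of F and G. An edge in only one of the sets has mean
  zero; an edge in both contributes (1 / k) (k / n) = 1 / n times the inner product of the two
  functions, so the sparsity cancels.\<close>

lemma monomial_inner:
  assumes k: "0 < k" and f: "centered law f1" "centered law f2"
    and FG: "F \<subseteq> {..<n} \<times> {..<n}" "G \<subseteq> {..<n} \<times> {..<n}"
  shows "integrable M (\<lambda>\<omega>. monomial f1 F \<omega> * cnj (monomial f2 G \<omega>))"
    and "expectation (\<lambda>\<omega>. monomial f1 F \<omega> * cnj (monomial f2 G \<omega>)) =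
      (if F = G then ((\<integral>x. f1 x * cnj (f2 x) \<partial>law) / of_nat n) ^ card F else 0)"
proof -
  have fin: "finite F" "finite G" using FG finite_subset by blast+
  define T where "T = F <+> G"
  define c where "c = case_sum (\<lambda>e::nat \<times> nat. e) (\<lambda>e::nat \<times> nat. e)"
  define g where "g = case_sum (\<lambda>_::nat \<times> nat. f1) (\<lambda>_::nat \<times> nat. \<lambda>x. cnj (f2 x))"
  have T: "finite T" "c ` T = F \<union> G" "card T = card F + card G"
    using fin by (auto simp: T_def c_def card_Plus image_iff split: sum.splits) (auto intro: rev_bexI[OF InlI] rev_bexI[OF InrI])
  have slice: "{t. t \<in> T \<and> c t = e} = (if e \<in> F then {Inl e} else {}) \<union> (if e \<in> G then {Inr e} else {})" for e
  proof (rule Set.set_eqI)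
    fix t show "t \<in> {t. t \<in> T \<and> c t = e} \<longleftrightarrow> t \<in> (if e \<in> F then {Inl e} else {}) \<union> (if e \<in> G then {Inr e} else {})"
      by (cases t) (auto simp: T_def c_def)
  qed
  have pr: "(\<Prod>t | t \<in> T \<and> c t = e. g t x) = (if e \<in> F then f1 x else 1) * (if e \<in> G then cnj (f2 x) else 1)" for e x
    unfolding slice by (auto simp: g_def)
  have m[measurable]: "f1 \<in> borel_measurable borel" "f2 \<in> borel_measurable borel"
    using f by (auto simp: centered_def)
  have gm: "g t \<in> borel_measurable borel" for t
    unfolding g_def using measurable_compose[OF m(2) cnj_measurable] m(1) by (cases t) auto
  have i1: "integrable law f1" "integrable law (\<lambda>x. cnj (f2 x))"
    using f by (auto simp: centered_def)
  have i2: "integrable law (\<lambda>x. f1 x * cnj (f2 x))" if "e \<in> F \<union> G" for e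
  proof -
    \<comment> \<open>The model describes \<open>law\<close> only through entries, so its
      sigma-algebra is read off at an edge of F or G.\<close>
    have "law = distr M borel (A (fst e) (snd e))" using A_law that FG by force
    then have "sets law = sets borel" by simp
    then have "f1 \<in> borel_measurable law" "f2 \<in> borel_measurable law"
      using m by (simp_all cong: measurable_cong_sets)
    then show ?thesis using f by (intro integrable_mult_cnj) (auto simp: centered_def)
  qed
  have gi: "integrable law (\<lambda>x. \<Prod>t | t \<in> T \<and> c t = e. g t x)" if "e \<in> c ` T" for e
    unfolding pr using that i1 i2[of e] T(2) by (cases "e \<in> F"; cases "e \<in> G") auto
  have eq: "monomial f1 F \<omega> * cnj (monomial f2 G \<omega>) = (\<Prod>t\<in>T. entry k A B (g t) \<omega> (fst (c t)) (snd (c t)))"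
    if "\<omega> \<in> space M" for \<omega>
  proof -
    have "cnj (monomial f2 G \<omega>) = (\<Prod>e\<in>G. entry k A B (\<lambda>x. cnj (f2 x)) \<omega> (fst e) (snd e))"
      unfolding monomial_def cnj_prod using FG(2) by (intro prod.cong refl cnj_entry[OF that]) auto
    then show ?thesis
      unfolding monomial_def T_def c_def g_def using fin by (simp add: prod.Plus)
  qed
  have TN: "c ` T \<subseteq> {..<n} \<times> {..<n}" using T FG by simp
  have E: "integrable M (\<lambda>\<omega>. \<Prod>t\<in>T. entry k A B (g t) \<omega> (fst (c t)) (snd (c t)))"
    by (rule expectation_word(1)[OF T(1) TN gm gi])
  have E2: "expectation (\<lambda>\<omega>. \<Prod>t\<in>T. entry k A B (g t) \<omega> (fst (c t)) (snd (c t))) =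
      complex_of_real (1 / sqrt (real k)) ^ card T *
      (\<Prod>e\<in>c ` T. complex_of_real (real k / real n) * (\<integral>x. (\<Prod>t | t \<in> T \<and> c t = e. g t x) \<partial>law))"
    by (rule expectation_word(2)[OF T(1) TN gm gi])
  show "integrable M (\<lambda>\<omega>. monomial f1 F \<omega> * cnj (monomial f2 G \<omega>))"
    by (subst Bochner_Integration.integrable_cong[OF refl eq]) (auto intro: E)
  have "expectation (\<lambda>\<omega>. monomial f1 F \<omega> * cnj (monomial f2 G \<omega>)) =
    complex_of_real (1 / sqrt (real k)) ^ card T *
      (\<Prod>e\<in>F \<union> G. complex_of_real (real k / real n) * (\<integral>x. (if e \<in> F then f1 x else 1) * (if e \<in> G then cnj (f2 x) else 1) \<partial>law))"
    unfolding E2[unfolded pr T(2), symmetric] by (rule Bochner_Integration.integral_cong[OF refl eq])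
  also have "\<dots> = (if F = G then ((\<integral>x. f1 x * cnj (f2 x) \<partial>law) / of_nat n) ^ card F else 0)"
  proof (cases "F = G")
    case True
    have "complex_of_real (1 / sqrt (real k)) ^ card T = complex_of_real (1 / real k) ^ card F"
      unfolding T(3) True power_add power_mult_distrib[symmetric] by (simp flip: of_real_mult)
    then show ?thesis using True k
      by (simp add: power_mult_distrib[symmetric] power_divide) (simp add: field_simps)
  next
    case False
    then obtain e where e: "e \<in> F \<union> G" "\<not> (e \<in> F \<and> e \<in> G)" by blast
    have "(\<integral>x. (if e \<in> F then f1 x else 1) * (if e \<in> G then cnj (f2 x) else 1) \<partial>law) = 0"
      using e f by (auto simp: centered_def)
    then have "(\<Prod>e\<in>F \<union> G. complex_of_real (real k / real n) * (\<integral>x. (if e \<in> F then f1 x else 1) * (if e \<in> G then cnj (f2 x) else 1) \<partial>law)) = 0"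
      using e fin by (intro prod_zero) (auto intro!: bexI[of _ e])
    then show ?thesis using False by simp
  qed
  finally show "expectation (\<lambda>\<omega>. monomial f1 F \<omega> * cnj (monomial f2 G \<omega>)) =
      (if F = G then ((\<integral>x. f1 x * cnj (f2 x) \<partial>law) / of_nat n) ^ card F else 0)" .
qed

lemma monomial_second_moment:
  assumes k: "0 < k" and f: "centered law f" and F: "F \<subseteq> {..<n} \<times> {..<n}"
  shows "expectation (\<lambda>\<omega>. (cmod (monomial f F \<omega>))\<^sup>2) = ((\<integral>x. (cmod (f x))\<^sup>2 \<partial>law) / n) ^ card F"
proof -
  note * = monomial_inner[OF k f f F F]
  have "complex_of_real (expectation (\<lambda>\<omega>. (cmod (monomial f F \<omega>))\<^sup>2)) =
    complex_of_real (((\<integral>x. (cmod (f x))\<^sup>2 \<partial>law) / n) ^ card F)"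
    using *(2) unfolding integral_mult_cnj_self by simp
  then show ?thesis by (simp only: of_real_eq_iff)
qed

lemma monomial_sum_second_moment:
  assumes k: "0 < k" and f: "centered law f" and S: "finite S" "inj_on F S"
    and F: "\<And>s. s \<in> S \<Longrightarrow> F s \<subseteq> {..<n} \<times> {..<n}" "\<And>s. s \<in> S \<Longrightarrow> card (F s) = m"
  shows "integrable M (\<lambda>\<omega>. (cmod (\<Sum>s\<in>S. c s * monomial f (F s) \<omega>))\<^sup>2)"
    and "expectation (\<lambda>\<omega>. (cmod (\<Sum>s\<in>S. c s * monomial f (F s) \<omega>))\<^sup>2) =
      (\<Sum>s\<in>S. (cmod (c s))\<^sup>2) * ((\<integral>x. (cmod (f x))\<^sup>2 \<partial>law) / n) ^ m"
proof -
  have i: "integrable M (\<lambda>\<omega>. monomial f (F s) \<omega> * cnj (monomial f (F t) \<omega>))" if "s \<in> S" "t \<in> S" for s t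
    using that by (intro monomial_inner k f F)
  have o: "expectation (\<lambda>\<omega>. monomial f (F s) \<omega> * cnj (monomial f (F t) \<omega>)) = 0" if "s \<in> S" "t \<in> S" "s \<noteq> t" for s t
    using that inj_onD[OF S(2), of s t] by (subst monomial_inner(2)) (auto intro!: k f dest!: F(1))
  note * = orthogonal_sum_second_moment[OF S(1) i o]
  show "integrable M (\<lambda>\<omega>. (cmod (\<Sum>s\<in>S. c s * monomial f (F s) \<omega>))\<^sup>2)" by (rule *(1))
  show "expectation (\<lambda>\<omega>. (cmod (\<Sum>s\<in>S. c s * monomial f (F s) \<omega>))\<^sup>2) =
      (\<Sum>s\<in>S. (cmod (c s))\<^sup>2) * ((\<integral>x. (cmod (f x))\<^sup>2 \<partial>law) / n) ^ m"
    using *(2)[where c = c] F by (simp add: monomial_second_moment[OF k f] sum_distrib_right)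
qed

text \<open>Differences over distinct edge sets remain orthogonal, since the mixed inner products of
  \<open>f1\<close> and \<open>f2\<close> vanish as well.\<close>

lemma monomial_diff_sum_second_moment:
  assumes k: "0 < k" and f: "centered law f1" "centered law f2" and S: "finite S" "inj_on F S"
    and F: "\<And>s. s \<in> S \<Longrightarrow> F s \<subseteq> {..<n} \<times> {..<n}" "\<And>s. s \<in> S \<Longrightarrow> card (F s) = m"
  shows "integrable M (\<lambda>\<omega>. (cmod (\<Sum>s\<in>S. c s * (monomial f1 (F s) \<omega> - monomial f2 (F s) \<omega>)))\<^sup>2)"
    and "expectation (\<lambda>\<omega>. (cmod (\<Sum>s\<in>S. c s * (monomial f1 (F s) \<omega> - monomial f2 (F s) \<omega>)))\<^sup>2) =
      (\<Sum>s\<in>S. (cmod (c s))\<^sup>2) * (((\<integral>x. (cmod (f1 x))\<^sup>2 \<partial>law) / n) ^ m + ((\<integral>x. (cmod (f2 x))\<^sup>2 \<partial>law) / n) ^ m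
        - 2 * Re (((\<integral>x. f1 x * cnj (f2 x) \<partial>law) / of_nat n) ^ m))"
proof -
  let ?Z = "\<lambda>s \<omega>. monomial f1 (F s) \<omega> - monomial f2 (F s) \<omega>"
  have ex: "?Z s \<omega> * cnj (?Z t \<omega>) = monomial f1 (F s) \<omega> * cnj (monomial f1 (F t) \<omega>) - monomial f1 (F s) \<omega> * cnj (monomial f2 (F t) \<omega>)
    - monomial f2 (F s) \<omega> * cnj (monomial f1 (F t) \<omega>) + monomial f2 (F s) \<omega> * cnj (monomial f2 (F t) \<omega>)" for s t \<omega>
    by (simp add: algebra_simps)
  have ij: "integrable M (\<lambda>\<omega>. monomial g (F s) \<omega> * cnj (monomial h (F t) \<omega>))"
    if "s \<in> S" "t \<in> S" "centered law g" "centered law h" for s t g h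
    using that by (intro monomial_inner k F)
  have i: "integrable M (\<lambda>\<omega>. ?Z s \<omega> * cnj (?Z t \<omega>))" if "s \<in> S" "t \<in> S" for s t
    unfolding ex using that f by (intro Bochner_Integration.integrable_add Bochner_Integration.integrable_diff ij)
  have eZ: "expectation (\<lambda>\<omega>. ?Z s \<omega> * cnj (?Z t \<omega>)) =
    expectation (\<lambda>\<omega>. monomial f1 (F s) \<omega> * cnj (monomial f1 (F t) \<omega>)) - expectation (\<lambda>\<omega>. monomial f1 (F s) \<omega> * cnj (monomial f2 (F t) \<omega>))
    - expectation (\<lambda>\<omega>. monomial f2 (F s) \<omega> * cnj (monomial f1 (F t) \<omega>)) + expectation (\<lambda>\<omega>. monomial f2 (F s) \<omega> * cnj (monomial f2 (F t) \<omega>))"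
    if "s \<in> S" "t \<in> S" for s t
    unfolding ex using that f
    by (simp add: Bochner_Integration.integral_add Bochner_Integration.integral_diff Bochner_Integration.integrable_diff ij)
  have o: "expectation (\<lambda>\<omega>. ?Z s \<omega> * cnj (?Z t \<omega>)) = 0" if "s \<in> S" "t \<in> S" "s \<noteq> t" for s t
  proof -
    have ne: "F s \<noteq> F t" using inj_onD[OF S(2)] that by blast
    show ?thesis using F(1) f that ne unfolding eZ[OF that(1,2)]
      by (simp add: monomial_inner(2)[OF k])
  qed
  note * = orthogonal_sum_second_moment[OF S(1) i o]
  show "integrable M (\<lambda>\<omega>. (cmod (\<Sum>s\<in>S. c s * (monomial f1 (F s) \<omega> - monomial f2 (F s) \<omega>)))\<^sup>2)" by (rule *(1))
  note sq = cmod_sq_Re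
  have "expectation (\<lambda>\<omega>. (cmod (?Z s \<omega>))\<^sup>2) = ((\<integral>x. (cmod (f1 x))\<^sup>2 \<partial>law) / n) ^ m + ((\<integral>x. (cmod (f2 x))\<^sup>2 \<partial>law) / n) ^ m
        - 2 * Re (((\<integral>x. f1 x * cnj (f2 x) \<partial>law) / of_nat n) ^ m)" if s: "s \<in> S" for s
  proof -
    note d = integral_mult_cnj_self
    have sw: "(\<integral>x. f2 x * cnj (f1 x) \<partial>law) = cnj (\<integral>x. f1 x * cnj (f2 x) \<partial>law)"
      using Bochner_Integration.integral_cnj[of law "\<lambda>x. f1 x * cnj (f2 x)"] by (simp add: mult.commute)
    have "expectation (\<lambda>\<omega>. (cmod (?Z s \<omega>))\<^sup>2) = Re (expectation (\<lambda>\<omega>. ?Z s \<omega> * cnj (?Z s \<omega>)))"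
      unfolding sq by (rule integral_Re[OF i[OF s s]])
    also have "expectation (\<lambda>\<omega>. ?Z s \<omega> * cnj (?Z s \<omega>)) =
      complex_of_real (((\<integral>x. (cmod (f1 x))\<^sup>2 \<partial>law) / n) ^ m + ((\<integral>x. (cmod (f2 x))\<^sup>2 \<partial>law) / n) ^ m)
      - (((\<integral>x. f1 x * cnj (f2 x) \<partial>law) / of_nat n) ^ m + cnj (((\<integral>x. f1 x * cnj (f2 x) \<partial>law) / of_nat n) ^ m))"
      unfolding eZ[OF s s] using F[OF s] f by (simp add: monomial_inner(2)[OF k] sw, simp add: d)
    finally show ?thesis
      by (simp only: minus_complex.sel plus_complex.sel Re_complex_of_real cnj.sel mult_2)
  qed
  then show "expectation (\<lambda>\<omega>. (cmod (\<Sum>s\<in>S. c s * (monomial f1 (F s) \<omega> - monomial f2 (F s) \<omega>)))\<^sup>2) =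
      (\<Sum>s\<in>S. (cmod (c s))\<^sup>2) * (((\<integral>x. (cmod (f1 x))\<^sup>2 \<partial>law) / n) ^ m + ((\<integral>x. (cmod (f2 x))\<^sup>2 \<partial>law) / n) ^ m
        - 2 * Re (((\<integral>x. f1 x * cnj (f2 x) \<partial>law) / of_nat n) ^ m))"
    using *(2)[where c = c] by (simp add: sum_distrib_right)
qed

end

subsection \<open>Second moments of the coefficients\<close>

definition graph_on :: "nat set \<Rightarrow> (nat \<Rightarrow> nat) \<Rightarrow> (nat \<times> nat) set" where
  "graph_on I \<sigma> = (\<lambda>i. (i, \<sigma> i)) ` I"

definition perm_index :: "nat \<Rightarrow> nat \<Rightarrow> (nat set \<times> (nat \<Rightarrow> nat)) set" where
  "perm_index n m = (SIGMA I:{I. I \<subseteq> {..<n} \<and> card I = m}. {\<sigma>. \<sigma> permutes I})"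

lemma inj_on_pair_graph: "inj_on (\<lambda>i. (i, \<sigma> i)) I"
  by (auto intro: inj_onI)

lemma card_graph_on [simp]: "card (graph_on I \<sigma>) = card I"
  unfolding graph_on_def by (rule card_image[OF inj_on_pair_graph])

lemma fst_graph_on: "fst ` graph_on I \<sigma> = I"
  by (auto simp: graph_on_def image_iff)

lemma snd_graph_on: "snd ` graph_on I \<sigma> = \<sigma> ` I"
  by (auto simp: graph_on_def image_iff)

lemma graph_on_eqD:
  assumes "graph_on I \<sigma> = graph_on J \<tau>"
  shows "I = J" "\<And>i. i \<in> I \<Longrightarrow> \<sigma> i = \<tau> i"
proof -
  show IJ: "I = J" using fst_graph_on assms by metis
  fix i assume "i \<in> I"
  then have "(i, \<sigma> i) \<in> graph_on J \<tau>" unfolding assms[symmetric] by (simp add: graph_on_def)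
  then show "\<sigma> i = \<tau> i" by (auto simp: graph_on_def)
qed

lemma finite_perm_index: "finite (perm_index n m)"
  unfolding perm_index_def
  by (intro finite_SigmaI finite_subsets_card) (auto intro!: finite_permutations intro: finite_subset)

text \<open>Distinct Leibniz terms thus have distinct edge sets, hence orthogonal monomials: the
  rows of the edges recover I, and the permutation is the identity elsewhere.\<close>

lemma inj_on_graph_perm_index: "inj_on (\<lambda>(I, \<sigma>). graph_on I \<sigma>) (perm_index n m)"
proof (rule inj_onI, clarify)
  fix I \<sigma> J \<tau>
  assume a: "(I, \<sigma>) \<in> perm_index n m" "(J, \<tau>) \<in> perm_index n m" and g: "graph_on I \<sigma> = graph_on J \<tau>"
  have "\<sigma> i = \<tau> i" for i
  proof (cases "i \<in> I")
    case True then show ?thesis by (rule graph_on_eqD(2)[OF g])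
  next
    case False
    then show ?thesis using a graph_on_eqD(1)[OF g] by (auto simp: perm_index_def permutes_def)
  qed
  then show "I = J \<and> \<sigma> = \<tau>" using graph_on_eqD(1)[OF g] by auto
qed

lemma graph_perm_index:
  assumes "s \<in> perm_index n m"
  shows "(case s of (I, \<sigma>) \<Rightarrow> graph_on I \<sigma>) \<subseteq> {..<n} \<times> {..<n}"
    and "card (case s of (I, \<sigma>) \<Rightarrow> graph_on I \<sigma>) = m"
proof -
  obtain I \<sigma> where s: "s = (I, \<sigma>)" "I \<subseteq> {..<n}" "card I = m" "\<sigma> permutes I"
    using assms by (auto simp: perm_index_def)
  show "(case s of (I, \<sigma>) \<Rightarrow> graph_on I \<sigma>) \<subseteq> {..<n} \<times> {..<n}"
    using s(2) permutes_in_image[OF s(4)] by (auto simp: s(1) graph_on_def)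
  show "card (case s of (I, \<sigma>) \<Rightarrow> graph_on I \<sigma>) = m" using s by simp
qed

lemma sum_perm_index:
  "(\<Sum>(I, \<sigma>)\<in>perm_index n m. g I \<sigma> :: 'b :: comm_monoid_add) =
     (\<Sum>I | I \<subseteq> {..<n} \<and> card I = m. \<Sum>\<sigma> | \<sigma> permutes I. g I \<sigma>)"
  unfolding perm_index_def
  by (rule sum.Sigma[symmetric]) (auto intro!: finite_permutations intro: finite_subset)

lemma card_permutes_subset:
  assumes "I \<subseteq> {..<n::nat}" "card I = m"
  shows "card {\<sigma>. \<sigma> permutes I} = fact m"
  by (rule card_permutations[OF assms(2) finite_subset[OF assms(1) finite_lessThan]])

lemma sum_perm_index_fst:
  "(\<Sum>(I, \<sigma>)\<in>perm_index n m. g I :: real) = fact m * (\<Sum>I | I \<subseteq> {..<n} \<and> card I = m. g I)"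
  unfolding sum_perm_index sum_distrib_left
  by (intro sum.cong refl) (auto simp: card_permutes_subset)

lemma card_subsets_lessThan: "card {I. I \<subseteq> {..<n::nat} \<and> card I = m} = n choose m"
  using n_subsets[of "{..<n}" m] by simp

lemma binomial_fact_le_power: "real (n choose m) * fact m \<le> real n ^ m"
  using binomial_fact_pow[of n m] by (metis of_nat_fact of_nat_le_iff of_nat_mult of_nat_power)

lemma card_supersets_le:
  assumes "J \<subseteq> {..<n}" "card J = s"
  shows "card {I. I \<subseteq> {..<n} \<and> card I = s + m \<and> J \<subseteq> I} \<le> n choose m"
proof -
  have J: "finite J" using assms(1) finite_subset by blast
  have "card {I. I \<subseteq> {..<n} \<and> card I = s + m \<and> J \<subseteq> I} \<le> card {I. I \<subseteq> {..<n} \<and> card I = m}"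
  proof (rule card_inj_on_le[where f = "\<lambda>I. I - J"])
    show "inj_on (\<lambda>I. I - J) {I. I \<subseteq> {..<n} \<and> card I = s + m \<and> J \<subseteq> I}"
      by (rule inj_onI) (metis (mono_tags, lifting) Diff_partition mem_Collect_eq)
    show "(\<lambda>I. I - J) ` {I. I \<subseteq> {..<n} \<and> card I = s + m \<and> J \<subseteq> I} \<subseteq> {I. I \<subseteq> {..<n} \<and> card I = m}"
      using assms J by (auto simp: card_Diff_subset)
  qed simp
  then show ?thesis by (simp add: card_subsets_lessThan)
qed

lemma cmod_sum_sq_le: "(cmod (\<Sum>j\<in>I. z j))\<^sup>2 \<le> real (card I) * (\<Sum>j\<in>I. (cmod (z j))\<^sup>2)"
proof -
  have "(cmod (\<Sum>j\<in>I. z j))\<^sup>2 \<le> (\<Sum>j\<in>I. 1 * cmod (z j))\<^sup>2"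
    using norm_sum[of z I] by (intro power_mono) auto
  also have "\<dots> \<le> (\<Sum>j\<in>I. 1\<^sup>2) * (\<Sum>j\<in>I. (cmod (z j))\<^sup>2)"
    by (rule Cauchy_Schwarz_ineq_sum)
  finally show ?thesis by simp
qed

lemma sum_subsets_le:
  fixes g :: "nat \<Rightarrow> real"
  assumes g: "\<And>j. 0 \<le> g j"
  shows "(\<Sum>I | I \<subseteq> {..<n} \<and> card I = Suc m. \<Sum>j\<in>I. g j) \<le> real (n choose m) * (\<Sum>j<n. g j)"
proof -
  have "(\<Sum>I | I \<subseteq> {..<n} \<and> card I = Suc m. \<Sum>j\<in>I. g j) =
    (\<Sum>I | I \<subseteq> {..<n} \<and> card I = Suc m. \<Sum>j<n. if j \<in> I then g j else 0)"
    by (rule sum.cong[OF refl]) (auto simp: sum.If_cases Int_absorb1)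
  also have "\<dots> = (\<Sum>j<n. \<Sum>I | I \<subseteq> {..<n} \<and> card I = Suc m. if j \<in> I then g j else 0)"
    by (rule sum.swap)
  also have "\<dots> \<le> (\<Sum>j<n. real (n choose m) * g j)"
  proof (intro sum_mono)
    fix j assume "j \<in> {..<n}"
    have "(\<Sum>I | I \<subseteq> {..<n} \<and> card I = Suc m. if j \<in> I then g j else 0)
      = (\<Sum>I\<in>{I. I \<subseteq> {..<n} \<and> card I = 1 + m \<and> {j} \<subseteq> I}. g j)"
      by (intro sum.mono_neutral_cong_right) auto
    also have "\<dots> \<le> real (n choose m) * g j"
      using card_supersets_le[of "{j}" n 1 m] \<open>j \<in> {..<n}\<close> g[of j]
      by (simp add: mult_right_mono)
    finally show "(\<Sum>I | I \<subseteq> {..<n} \<and> card I = Suc m. if j \<in> I then g j else 0) \<le> real (n choose m) * g j" .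
  qed
  finally show ?thesis by (simp add: sum_distrib_left)
qed

lemma one_minus_power_le:
  fixes \<theta> :: real
  assumes "0 \<le> \<theta>" "\<theta> \<le> 1"
  shows "1 - \<theta> ^ m \<le> real m * (1 - \<theta>)"
proof (induction m)
  case (Suc m)
  have "1 - \<theta> ^ Suc m = (1 - \<theta>) + \<theta> * (1 - \<theta> ^ m)" by (simp add: algebra_simps)
  also have "\<theta> * (1 - \<theta> ^ m) \<le> 1 * (1 - \<theta> ^ m)"
    using assms by (intro mult_right_mono) (auto simp: power_le_one)
  also have "1 * (1 - \<theta> ^ m) \<le> real m * (1 - \<theta>)" using Suc by simp
  finally show ?case by (simp add: algebra_simps)
qed simp

section \<open>Edge sets and counting for the non-principal minors\<close>

lemma finite_off_index: "finite (off_index n m)"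
  unfolding off_index_def
  by (intro finite_SigmaI finite_subsets_card)
    (auto intro: finite_subset[OF _ finite_permutations, of _ "_ :: nat set"] finite_subset)

lemma off_indexE:
  assumes "s \<in> off_index n m"
  obtains I j \<sigma> where "s = (I, j, \<sigma>)" "I \<subseteq> {..<n}" "card I = Suc m" "j \<in> I" "\<sigma> permutes I" "\<sigma> j \<noteq> j" "finite I"
  using assms unfolding off_index_def by (auto intro: finite_subset)

text \<open>The deleted row can be read off the edges as the only column in use that is not a row in
  use. This needs \<sigma> j \<noteq> j.\<close>

lemma off_graph_rows_cols:
  assumes "\<sigma> permutes I" "j \<in> I" "\<sigma> j \<noteq> j"
  shows "snd ` graph_on (I - {j}) \<sigma> - fst ` graph_on (I - {j}) \<sigma> = {j}"
proof -
  have "\<sigma> ` (I - {j}) = I - {\<sigma> j}"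
    using permutes_image[OF assms(1)] permutes_inj[OF assms(1)] by (simp add: image_set_diff)
  then show ?thesis unfolding fst_graph_on snd_graph_on using assms by auto
qed

text \<open>Once j is known, I consists of the rows together with j, and \<sigma> j is the one
  element of I missing among the columns.\<close>

lemma inj_on_off_graph: "inj_on (\<lambda>(I, j, \<sigma>). graph_on (I - {j}) \<sigma>) (off_index n m)"
proof (rule inj_onI)
  fix s t
  assume s: "s \<in> off_index n m" and t: "t \<in> off_index n m"
    and eq: "(case s of (I, j, \<sigma>) \<Rightarrow> graph_on (I - {j}) \<sigma>) = (case t of (I, j, \<sigma>) \<Rightarrow> graph_on (I - {j}) \<sigma>)"
  obtain I j \<sigma> where s': "s = (I, j, \<sigma>)" "I \<subseteq> {..<n}" "card I = Suc m" "j \<in> I" "\<sigma> permutes I" "\<sigma> j \<noteq> j" "finite I"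
    by (rule off_indexE[OF s])
  obtain J l \<tau> where t': "t = (J, l, \<tau>)" "J \<subseteq> {..<n}" "card J = Suc m" "l \<in> J" "\<tau> permutes J" "\<tau> l \<noteq> l" "finite J"
    by (rule off_indexE[OF t])
  have g: "graph_on (I - {j}) \<sigma> = graph_on (J - {l}) \<tau>" using eq by (simp add: s' t')
  have "{j} = {l}"
    using off_graph_rows_cols[OF s'(5,4,6)] off_graph_rows_cols[OF t'(5,4,6)] g by simp
  then have jl: "j = l" by simp
  have IJ: "I = J" using graph_on_eqD(1)[OF g] jl s'(4) t'(4) by auto
  have o: "\<sigma> i = \<tau> i" if "i \<noteq> j" for i
  proof (cases "i \<in> I")
    case True
    then show ?thesis using that by (intro graph_on_eqD(2)[OF g]) auto
  next
    case False
    then show ?thesis using s'(5) t'(5) IJ by (simp add: permutes_def)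
  qed
  have "\<sigma> j = \<tau> j"
  proof -
    have "\<sigma> ` (I - {j}) = \<tau> ` (I - {j})" using o by (intro image_cong) auto
    then have "I - {\<sigma> j} = I - {\<tau> j}"
      using permutes_image[OF s'(5)] permutes_inj[OF s'(5)] permutes_image[OF t'(5)] permutes_inj[OF t'(5)]
      by (simp add: image_set_diff IJ)
    moreover have "\<sigma> j \<in> I" "\<tau> j \<in> I"
      using permutes_in_image[OF s'(5)] permutes_in_image[OF t'(5)] s'(4) IJ by auto
    ultimately show ?thesis by blast
  qed
  with o have "\<sigma> = \<tau>" by (intro ext) metis
  then show "s = t" using s' t' jl IJ by simp
qed

text \<open>Composition with the transposition of j and l makes j a fixed point and loses
  nothing.\<close>

lemma card_permutes_point_le:
  assumes "finite I" "card I = Suc m" "j \<in> I"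
  shows "card {\<sigma>. \<sigma> permutes I \<and> \<sigma> j = l} \<le> fact m"
proof -
  have "card {\<sigma>. \<sigma> permutes I \<and> \<sigma> j = l} \<le> card {\<sigma>. \<sigma> permutes (I - {j})}"
  proof (rule card_inj_on_le[where f = "\<lambda>\<sigma>. Transposition.transpose j l \<circ> \<sigma>"])
    show "inj_on (\<lambda>\<sigma>. Transposition.transpose j l \<circ> \<sigma>) {\<sigma>. \<sigma> permutes I \<and> \<sigma> j = l}"
      by (rule inj_onI) (metis comp_assoc id_comp transpose_comp_involutory)
    show "(\<lambda>\<sigma>. Transposition.transpose j l \<circ> \<sigma>) ` {\<sigma>. \<sigma> permutes I \<and> \<sigma> j = l} \<subseteq> {\<sigma>. \<sigma> permutes (I - {j})}"
    proof clarify
      fix \<sigma> assume \<sigma>: "\<sigma> permutes I" "l = \<sigma> j"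
      have "l \<in> I" using \<sigma> permutes_in_image[OF \<sigma>(1)] assms(3) by auto
      then have p: "Transposition.transpose j (\<sigma> j) \<circ> \<sigma> permutes I"
        using \<sigma> assms(3) by (intro permutes_compose permutes_swap_id) auto
      have "(Transposition.transpose j (\<sigma> j) \<circ> \<sigma>) j = j" by simp
      then show "Transposition.transpose j (\<sigma> j) \<circ> \<sigma> permutes I - {j}"
        using permutes_superset[OF p, of "I - {j}"] by auto
    qed
    show "finite {\<sigma>. \<sigma> permutes (I - {j})}" using assms by (intro finite_permutations) auto
  qed
  also have "\<dots> = fact m" using assms by (intro card_permutations) auto
  finally show ?thesis .
qed

text \<open>For a fixed pair (j, l) with l = \<sigma> j and l \<noteq> j, at most
  \<open>n choose m\<close> sets of size m + 2 contain both points, and at most (m+1)! permutations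
  send j to l. That is of order n^m for monomials of degree m + 1; the missing power of n makes the
  off-diagonal part small.\<close>

lemma sum_off_index_le:
  fixes a b :: "nat \<Rightarrow> real"
  assumes a: "\<And>j. 0 \<le> a j" and b: "\<And>j. 0 \<le> b j"
  shows "(\<Sum>(I, j, \<sigma>)\<in>off_index n (Suc m). a j * b (\<sigma> j)) \<le>
    real (n choose m) * fact (Suc m) * ((\<Sum>j<n. a j) * (\<Sum>j<n. b j))"
proof -
  let ?S = "{I. I \<subseteq> {..<n} \<and> card I = Suc (Suc m)}"
  have fin: "finite {\<sigma>. \<sigma> permutes I \<and> \<sigma> j \<noteq> j}" if "I \<in> ?S" for I j
    by (rule finite_subset[OF _ finite_permutations[of I]]) (use that in \<open>auto intro: finite_subset\<close>)
  have fI: "finite I" if "I \<in> ?S" for I using that finite_subset by auto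
  have finP: "finite (SIGMA j:I. {\<sigma>. \<sigma> permutes I \<and> \<sigma> j \<noteq> j})" if "I \<in> ?S" for I
    by (rule finite_SigmaI[OF fI[OF that] fin[OF that]])
  have "(\<Sum>(I, j, \<sigma>)\<in>off_index n (Suc m). a j * b (\<sigma> j)) =
    (\<Sum>I\<in>?S. \<Sum>p\<in>(SIGMA j:I. {\<sigma>. \<sigma> permutes I \<and> \<sigma> j \<noteq> j}). a (fst p) * b (snd p (fst p)))"
  proof (subst sum.Sigma)
    show "finite ?S" by (rule finite_subsets_card)
    show "\<forall>I\<in>?S. finite (SIGMA j:I. {\<sigma>. \<sigma> permutes I \<and> \<sigma> j \<noteq> j})" using finP by blast
  qed (simp add: off_index_def split_def)
  also have "\<dots> = (\<Sum>I\<in>?S. \<Sum>j\<in>I. \<Sum>\<sigma> | \<sigma> permutes I \<and> \<sigma> j \<noteq> j. a j * b (\<sigma> j))"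
  proof (rule sum.cong[OF refl])
    fix I assume I: "I \<in> ?S"
    show "(\<Sum>p\<in>(SIGMA j:I. {\<sigma>. \<sigma> permutes I \<and> \<sigma> j \<noteq> j}). a (fst p) * b (snd p (fst p))) =
      (\<Sum>j\<in>I. \<Sum>\<sigma> | \<sigma> permutes I \<and> \<sigma> j \<noteq> j. a j * b (\<sigma> j))"
    proof (subst sum.Sigma)
      show "finite I" by (rule fI[OF I])
      show "\<forall>j\<in>I. finite {\<sigma>. \<sigma> permutes I \<and> \<sigma> j \<noteq> j}" using fin[OF I] by blast
    qed (simp add: split_def)
  qed
  also have "\<dots> \<le> (\<Sum>I\<in>?S. \<Sum>j\<in>I. \<Sum>l\<in>I - {j}. fact (Suc m) * (a j * b l))"
  proof (intro sum_mono)
    fix I j assume I: "I \<in> ?S" and j: "j \<in> I"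
    have "(\<Sum>\<sigma> | \<sigma> permutes I \<and> \<sigma> j \<noteq> j. a j * b (\<sigma> j)) =
      (\<Sum>l\<in>I - {j}. \<Sum>\<sigma> | \<sigma> \<in> {\<sigma>. \<sigma> permutes I \<and> \<sigma> j \<noteq> j} \<and> \<sigma> j = l. a j * b (\<sigma> j))"
      using fin[OF I] fI[OF I] j by (intro sum.group[symmetric]) (auto simp: permutes_in_image)
    also have "\<dots> \<le> (\<Sum>l\<in>I - {j}. fact (Suc m) * (a j * b l))"
    proof (intro sum_mono)
      fix l assume l: "l \<in> I - {j}"
      have "(\<Sum>\<sigma> | \<sigma> \<in> {\<sigma>. \<sigma> permutes I \<and> \<sigma> j \<noteq> j} \<and> \<sigma> j = l. a j * b (\<sigma> j)) =
        (\<Sum>\<sigma> | \<sigma> permutes I \<and> \<sigma> j = l. a j * b l)"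
        using l by (intro sum.cong) auto
      also have "\<dots> = real (card {\<sigma>. \<sigma> permutes I \<and> \<sigma> j = l}) * (a j * b l)" by simp
      also have "\<dots> \<le> fact (Suc m) * (a j * b l)"
      proof (rule mult_right_mono)
        have "card {\<sigma>. \<sigma> permutes I \<and> \<sigma> j = l} \<le> fact (Suc m)"
          using I fI[OF I] j by (intro card_permutes_point_le) auto
        then show "real (card {\<sigma>. \<sigma> permutes I \<and> \<sigma> j = l}) \<le> fact (Suc m)"
          by (metis of_nat_fact of_nat_le_iff)
      qed (simp add: a b)
      finally show "(\<Sum>\<sigma> | \<sigma> \<in> {\<sigma>. \<sigma> permutes I \<and> \<sigma> j \<noteq> j} \<and> \<sigma> j = l. a j * b (\<sigma> j)) \<le> fact (Suc m) * (a j * b l)" .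
    qed
    finally show "(\<Sum>\<sigma> | \<sigma> permutes I \<and> \<sigma> j \<noteq> j. a j * b (\<sigma> j)) \<le> (\<Sum>l\<in>I - {j}. fact (Suc m) * (a j * b l))" .
  qed
  also have "\<dots> = (\<Sum>I\<in>?S. \<Sum>(j, l)\<in>{..<n} \<times> {..<n}. if j \<in> I \<and> l \<in> I \<and> j \<noteq> l then fact (Suc m) * (a j * b l) else 0)"
  proof (intro sum.cong refl)
    fix I assume I: "I \<in> ?S"
    have "(\<Sum>j\<in>I. \<Sum>l\<in>I - {j}. fact (Suc m) * (a j * b l)) = (\<Sum>(j, l)\<in>(SIGMA j:I. I - {j}). fact (Suc m) * (a j * b l))"
      using fI[OF I] by (intro sum.Sigma) auto
    also have "\<dots> = (\<Sum>(j, l)\<in>{..<n} \<times> {..<n}. if j \<in> I \<and> l \<in> I \<and> j \<noteq> l then fact (Suc m) * (a j * b l) else 0)"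
    proof (rule sum.mono_neutral_cong_left)
      show "(SIGMA j:I. I - {j}) \<subseteq> {..<n} \<times> {..<n}" using I by blast
      fix x assume x: "x \<in> (SIGMA j:I. I - {j})"
      obtain j l where jl: "x = (j, l)" by (cases x)
      have "j \<in> I \<and> l \<in> I \<and> j \<noteq> l" using x by (auto simp: jl)
      then show "(case x of (j, l) \<Rightarrow> fact (Suc m) * (a j * b l)) =
        (case x of (j, l) \<Rightarrow> if j \<in> I \<and> l \<in> I \<and> j \<noteq> l then fact (Suc m) * (a j * b l) else 0)"
        by (simp only: jl prod.case simp_thms if_True)
    qed (auto simp: split_def)
    finally show "(\<Sum>j\<in>I. \<Sum>l\<in>I - {j}. fact (Suc m) * (a j * b l)) = \<dots>" .
  qed
  also have "\<dots> = (\<Sum>(j, l)\<in>{..<n} \<times> {..<n}. \<Sum>I\<in>?S. if j \<in> I \<and> l \<in> I \<and> j \<noteq> l then fact (Suc m) * (a j * b l) else 0)"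
    by (subst sum.swap) (simp add: split_def)
  also have "\<dots> \<le> (\<Sum>(j, l)\<in>{..<n} \<times> {..<n}. real (n choose m) * (fact (Suc m) * (a j * b l)))"
  proof -
    have key: "(\<Sum>I\<in>?S. if j \<in> I \<and> l \<in> I \<and> j \<noteq> l then fact (Suc m) * (a j * b l) else 0) \<le>
      real (n choose m) * (fact (Suc m) * (a j * b l))" if jl: "j \<in> {..<n}" "l \<in> {..<n}" for j l
    proof (cases "j = l")
      case True
      then show ?thesis by (simp add: a b)
    next
      case False
      have "(\<Sum>I\<in>?S. if j \<in> I \<and> l \<in> I \<and> j \<noteq> l then fact (Suc m) * (a j * b l) else 0)
        = (\<Sum>I\<in>{I. I \<subseteq> {..<n} \<and> card I = 2 + m \<and> {j, l} \<subseteq> I}. fact (Suc m) * (a j * b l))"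
        using False by (intro sum.mono_neutral_cong_right) auto
      also have "\<dots> = real (card {I. I \<subseteq> {..<n} \<and> card I = 2 + m \<and> {j, l} \<subseteq> I}) * (fact (Suc m) * (a j * b l))" by simp
      also have "\<dots> \<le> real (n choose m) * (fact (Suc m) * (a j * b l))"
        using card_supersets_le[of "{j, l}" n 2 m] jl False
        by (intro mult_right_mono) (auto simp: a b)
      finally show ?thesis .
    qed
    show ?thesis
    proof (rule sum_mono)
      fix p assume p: "p \<in> {..<n} \<times> {..<n}"
      show "(case p of (j, l) \<Rightarrow> \<Sum>I\<in>?S. if j \<in> I \<and> l \<in> I \<and> j \<noteq> l then fact (Suc m) * (a j * b l) else 0)
        \<le> (case p of (j, l) \<Rightarrow> real (n choose m) * (fact (Suc m) * (a j * b l)))"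
        using key[of "fst p" "snd p"] p by (simp only: split_def mem_Times_iff)
    qed
  qed
  also have "\<dots> = real (n choose m) * fact (Suc m) * ((\<Sum>j<n. a j) * (\<Sum>j<n. b j))"
    unfolding sum.cartesian_product[symmetric] sum_product
    by (simp add: sum_distrib_left mult_ac)
  finally show ?thesis .
qed

context sparse_iid_model
begin

lemma leibniz_monomial:
  "leibniz (entry k A B f \<omega>) I = (\<Sum>\<sigma> | \<sigma> permutes I. of_int (sign \<sigma>) * monomial f (graph_on I \<sigma>) \<omega>)"
  unfolding leibniz_def monomial_def graph_on_def
  by (simp add: prod.reindex[OF inj_on_pair_graph])

lemma minor_sum_monomial:
  "minor_sum (entry k A B f \<omega>) n m =
    (\<Sum>s\<in>perm_index n m. of_int (sign (snd s)) * monomial f (case s of (I, \<sigma>) \<Rightarrow> graph_on I \<sigma>) \<omega>)"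
  unfolding minor_sum_def leibniz_monomial sum_perm_index[symmetric] by (simp add: split_def)

lemma diag_sum_monomial:
  "diag_sum (entry k A B f \<omega>) u w n m =
    (\<Sum>s\<in>perm_index n m. ((\<Sum>j\<in>fst s. u j * w j) * of_int (sign (snd s))) * monomial f (case s of (I, \<sigma>) \<Rightarrow> graph_on I \<sigma>) \<omega>)"
  unfolding diag_sum_def leibniz_monomial sum_distrib_left sum_perm_index[symmetric]
  by (simp add: split_def mult.assoc)

lemma off_sum_monomial:
  "off_sum (entry k A B f \<omega>) u w n m =
    (\<Sum>s\<in>off_index n m. (of_int (sign (snd (snd s))) * (u (fst (snd s)) * w (snd (snd s) (fst (snd s))))) *
      monomial f (case s of (I, j, \<sigma>) \<Rightarrow> graph_on (I - {j}) \<sigma>) \<omega>)"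
  unfolding off_sum_def monomial_def graph_on_def
  by (intro sum.cong refl) (auto simp: prod.reindex[OF inj_on_pair_graph] mult.assoc)

lemma cmod_sign: "cmod (of_int (sign \<sigma>)) = 1"
  by (simp add: sign_def)

lemma second_moment_scale:
  fixes t N :: real
  assumes "0 < n" "0 \<le> t" "t \<le> 1" "0 \<le> N"
  shows "N * (t / n) ^ m \<le> N / real n ^ m"
  using assms by (simp add: power_divide divide_right_mono mult_left_le power_le_one)

text \<open>There are \<open>(n choose m) * fact m\<close>, thus at most n^m, orthogonal terms with
  second moment at most n^(-m) each. The bound is uniform in m and n.\<close>

lemma minor_sum_second_moment:
  assumes k: "0 < k" "0 < n" and f: "centered law f" and t: "(\<integral>x. (cmod (f x))\<^sup>2 \<partial>law) \<le> 1"
  shows "integrable M (\<lambda>\<omega>. (cmod (minor_sum (entry k A B f \<omega>) n m))\<^sup>2)"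
    and "expectation (\<lambda>\<omega>. (cmod (minor_sum (entry k A B f \<omega>) n m))\<^sup>2) \<le> 1"
proof -
  note * = monomial_sum_second_moment[OF k(1) f finite_perm_index inj_on_graph_perm_index graph_perm_index]
  show "integrable M (\<lambda>\<omega>. (cmod (minor_sum (entry k A B f \<omega>) n m))\<^sup>2)"
    unfolding minor_sum_monomial by (rule *(1))
  have N: "(\<Sum>s\<in>perm_index n m. (cmod (of_int (sign (snd s))))\<^sup>2) = real (n choose m) * fact m"
    using sum_perm_index_fst[of "\<lambda>_. 1" n m]
    by (simp only: cmod_sign power_one) (simp add: card_subsets_lessThan split_def)
  have "expectation (\<lambda>\<omega>. (cmod (minor_sum (entry k A B f \<omega>) n m))\<^sup>2) =
    (real (n choose m) * fact m) * ((\<integral>x. (cmod (f x))\<^sup>2 \<partial>law) / n) ^ m"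
    unfolding minor_sum_monomial N[symmetric] by (rule *(2))
  also have "\<dots> \<le> (real (n choose m) * fact m) / real n ^ m"
    using k t by (intro second_moment_scale) auto
  also have "\<dots> \<le> 1" using binomial_fact_le_power[of n m] k by (simp add: divide_le_eq)
  finally show "expectation (\<lambda>\<omega>. (cmod (minor_sum (entry k A B f \<omega>) n m))\<^sup>2) \<le> 1" .
qed

text \<open>The truncated function need not have variance one: with \<open>t2\<close> its second
  moment, one term contributes (1 + t2^m - 2 \<theta>^m) / n^m, and t2 \<le> \<theta> reduces this
  to (1 - \<theta>^m) / n^m. The growth in m is only linear, which the weights R^m absorb.\<close>

lemma minor_sum_diff_second_moment:
  assumes k: "0 < k" "0 < n" and f: "centered law f1" "centered law f2"
    and t: "(\<integral>x. (cmod (f1 x))\<^sup>2 \<partial>law) = 1" "(\<integral>x. f1 x * cnj (f2 x) \<partial>law) = of_real \<theta>"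
      "(\<integral>x. (cmod (f2 x))\<^sup>2 \<partial>law) \<le> \<theta>" "\<theta> \<le> 1"
  shows "integrable M (\<lambda>\<omega>. (cmod (minor_sum (entry k A B f1 \<omega>) n m - minor_sum (entry k A B f2 \<omega>) n m))\<^sup>2)"
    and "expectation (\<lambda>\<omega>. (cmod (minor_sum (entry k A B f1 \<omega>) n m - minor_sum (entry k A B f2 \<omega>) n m))\<^sup>2) \<le> real m * (1 - \<theta>)"
proof -
  note * = monomial_diff_sum_second_moment[OF k(1) f finite_perm_index inj_on_graph_perm_index graph_perm_index]
  have e: "minor_sum (entry k A B f1 \<omega>) n m - minor_sum (entry k A B f2 \<omega>) n m =
    (\<Sum>s\<in>perm_index n m. of_int (sign (snd s)) * (monomial f1 (case s of (I, \<sigma>) \<Rightarrow> graph_on I \<sigma>) \<omega> - monomial f2 (case s of (I, \<sigma>) \<Rightarrow> graph_on I \<sigma>) \<omega>))" for \<omega>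
    unfolding minor_sum_monomial sum_subtractf[symmetric] right_diff_distrib ..
  show "integrable M (\<lambda>\<omega>. (cmod (minor_sum (entry k A B f1 \<omega>) n m - minor_sum (entry k A B f2 \<omega>) n m))\<^sup>2)"
    unfolding e by (rule *(1))
  define t2 where "t2 = (\<integral>x. (cmod (f2 x))\<^sup>2 \<partial>law)"
  have t2: "0 \<le> t2" unfolding t2_def by (intro integral_nonneg_AE) auto
  have \<theta>: "0 \<le> \<theta>" by (rule order_trans[OF t2 t(3)[folded t2_def]])
  have N: "(\<Sum>s\<in>perm_index n m. (cmod (of_int (sign (snd s))))\<^sup>2) = real (n choose m) * fact m"
    using sum_perm_index_fst[of "\<lambda>_. 1" n m]
    by (simp only: cmod_sign power_one) (simp add: card_subsets_lessThan split_def)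
  have "expectation (\<lambda>\<omega>. (cmod (minor_sum (entry k A B f1 \<omega>) n m - minor_sum (entry k A B f2 \<omega>) n m))\<^sup>2) =
    (real (n choose m) * fact m) * ((1 / n) ^ m + (t2 / n) ^ m - 2 * Re ((complex_of_real \<theta> / of_nat n) ^ m))"
    unfolding e N[symmetric] t2_def t(1,2)[symmetric] by (rule *(2))
  also have "Re ((complex_of_real \<theta> / of_nat n) ^ m) = (\<theta> / n) ^ m"
    by (metis Re_complex_of_real of_real_divide of_real_of_nat_eq of_real_power)
  also have "(real (n choose m) * fact m) * ((1 / n) ^ m + (t2 / n) ^ m - 2 * (\<theta> / n) ^ m) =
    (real (n choose m) * fact m) / real n ^ m * (1 + t2 ^ m - 2 * \<theta> ^ m)"
    using k by (simp add: power_divide field_simps)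
  also have "\<dots> \<le> (real (n choose m) * fact m) / real n ^ m * (1 - \<theta> ^ m)"
    using power_mono[of t2 \<theta> m] t2 t(3) by (intro mult_left_mono) (auto simp: t2_def)
  also have "\<dots> \<le> 1 * (1 - \<theta> ^ m)"
    using binomial_fact_le_power[of n m] k \<theta> t(4)
    by (intro mult_right_mono) (auto simp: divide_le_eq power_le_one)
  also have "\<dots> \<le> real m * (1 - \<theta>)" using one_minus_power_le[OF \<theta> t(4), of m] by simp
  finally show "expectation (\<lambda>\<omega>. (cmod (minor_sum (entry k A B f1 \<omega>) n m - minor_sum (entry k A B f2 \<omega>) n m))\<^sup>2) \<le> real m * (1 - \<theta>)" .
qed

lemma binomial_fact_div_le:
  assumes "0 < n"
  shows "real (n choose m) * fact (Suc m) / real n ^ Suc m \<le> real (Suc m) / n"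
proof -
  have "real (n choose m) * fact (Suc m) = real (Suc m) * (real (n choose m) * fact m)" by (simp add: mult_ac)
  also have "\<dots> \<le> real (Suc m) * real n ^ m" by (intro mult_left_mono binomial_fact_le_power) auto
  finally have "real (n choose m) * fact (Suc m) / real n ^ Suc m \<le> real (Suc m) * real n ^ m / real n ^ Suc m"
    by (rule divide_right_mono) simp
  then show ?thesis using assms by simp
qed

text \<open>Cauchy-Schwarz inside I costs a factor m, and a given j lies in at most
  \<open>n choose (m - 1)\<close> of the sets I. Against n^m this leaves m^2 / n.\<close>

lemma diag_sum_second_moment:
  assumes k: "0 < k" "0 < n" and f: "centered law f" and t: "(\<integral>x. (cmod (f x))\<^sup>2 \<partial>law) \<le> 1"
  shows "integrable M (\<lambda>\<omega>. (cmod (diag_sum (entry k A B f \<omega>) u w n m))\<^sup>2)"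
    and "expectation (\<lambda>\<omega>. (cmod (diag_sum (entry k A B f \<omega>) u w n m))\<^sup>2) \<le>
      (real m)\<^sup>2 / n * ((\<Sum>j<n. (cmod (u j))\<^sup>2) * (\<Sum>j<n. (cmod (w j))\<^sup>2))"
proof -
  note * = monomial_sum_second_moment[OF k(1) f finite_perm_index inj_on_graph_perm_index graph_perm_index]
  show "integrable M (\<lambda>\<omega>. (cmod (diag_sum (entry k A B f \<omega>) u w n m))\<^sup>2)"
    unfolding diag_sum_monomial by (rule *(1))
  define c where "c s = (\<Sum>j\<in>fst s. u j * w j) * of_int (sign (snd s))" for s :: "nat set \<times> (nat \<Rightarrow> nat)"
  define V where "V = (\<Sum>j<n. (cmod (u j))\<^sup>2) * (\<Sum>j<n. (cmod (w j))\<^sup>2)"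
  have V: "(\<Sum>j<n. (cmod (u j * w j))\<^sup>2) \<le> V"
  proof -
    have "(\<Sum>j<n. (cmod (u j * w j))\<^sup>2) \<le> (\<Sum>j<n. (cmod (u j))\<^sup>2 * (\<Sum>j<n. (cmod (w j))\<^sup>2))"
      unfolding norm_mult power_mult_distrib
      by (intro sum_mono mult_left_mono member_le_sum) auto
    then show ?thesis by (simp add: V_def sum_distrib_right)
  qed
  have E: "expectation (\<lambda>\<omega>. (cmod (diag_sum (entry k A B f \<omega>) u w n m))\<^sup>2) =
    (\<Sum>s\<in>perm_index n m. (cmod (c s))\<^sup>2) * ((\<integral>x. (cmod (f x))\<^sup>2 \<partial>law) / n) ^ m"
    unfolding diag_sum_monomial c_def by (rule *(2))
  also have "\<dots> \<le> (\<Sum>s\<in>perm_index n m. (cmod (c s))\<^sup>2) / real n ^ m"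
    using k t by (intro second_moment_scale) (auto intro: sum_nonneg)
  also have "\<dots> \<le> (real m)\<^sup>2 / n * V"
  proof (cases m)
    case 0
    have "(\<Sum>s\<in>perm_index n 0. (cmod (c s))\<^sup>2) = 0"
      by (intro sum.neutral ballI) (auto simp: perm_index_def c_def dest: finite_subset)
    then show ?thesis using 0 by simp
  next
    case (Suc l)
    have "(\<Sum>s\<in>perm_index n m. (cmod (c s))\<^sup>2) = (\<Sum>(I, \<sigma>)\<in>perm_index n m. (cmod (\<Sum>j\<in>I. u j * w j))\<^sup>2)"
      by (intro sum.cong refl) (simp only: c_def norm_mult cmod_sign mult_1_right split_def)
    also have "\<dots> = fact m * (\<Sum>I | I \<subseteq> {..<n} \<and> card I = m. (cmod (\<Sum>j\<in>I. u j * w j))\<^sup>2)"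
      by (rule sum_perm_index_fst)
    also have "\<dots> \<le> fact m * (\<Sum>I | I \<subseteq> {..<n} \<and> card I = m. real m * (\<Sum>j\<in>I. (cmod (u j * w j))\<^sup>2))"
    proof (intro mult_left_mono sum_mono)
      fix I assume "I \<in> {I. I \<subseteq> {..<n} \<and> card I = m}"
      then show "(cmod (\<Sum>j\<in>I. u j * w j))\<^sup>2 \<le> real m * (\<Sum>j\<in>I. (cmod (u j * w j))\<^sup>2)"
        using cmod_sum_sq_le[of "\<lambda>j. u j * w j" I] by simp
    qed simp
    also have "\<dots> = fact m * (real m * (\<Sum>I | I \<subseteq> {..<n} \<and> card I = Suc l. \<Sum>j\<in>I. (cmod (u j * w j))\<^sup>2))"
      by (simp add: Suc sum_distrib_left)
    also have "\<dots> \<le> fact m * (real m * (real (n choose l) * V))"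
      by (intro mult_left_mono order_trans[OF sum_subsets_le mult_left_mono[OF V]]) auto
    also have "\<dots> = (real (n choose l) * fact (Suc l)) * (real m * V)" by (simp add: Suc mult_ac)
    finally have "(\<Sum>s\<in>perm_index n m. (cmod (c s))\<^sup>2) / real n ^ m \<le>
      (real (n choose l) * fact (Suc l)) * (real m * V) / real n ^ m"
      by (rule divide_right_mono) simp
    also have "\<dots> = (real (n choose l) * fact (Suc l) / real n ^ Suc l) * (real m * V)" by (simp add: Suc)
    also have "\<dots> \<le> (real (Suc l) / n) * (real m * V)"
      using binomial_fact_div_le[OF k(2), of l] by (intro mult_right_mono) (auto simp: V_def sum_nonneg)
    finally show ?thesis by (simp add: Suc power2_eq_square mult.assoc)
  qed
  finally show "expectation (\<lambda>\<omega>. (cmod (diag_sum (entry k A B f \<omega>) u w n m))\<^sup>2) \<le>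
      (real m)\<^sup>2 / n * ((\<Sum>j<n. (cmod (u j))\<^sup>2) * (\<Sum>j<n. (cmod (w j))\<^sup>2))"
    unfolding V_def .
qed

lemma off_graph:
  assumes "s \<in> off_index n m"
  shows "(case s of (I, j, \<sigma>) \<Rightarrow> graph_on (I - {j}) \<sigma>) \<subseteq> {..<n} \<times> {..<n}"
    and "card (case s of (I, j, \<sigma>) \<Rightarrow> graph_on (I - {j}) \<sigma>) = m"
proof -
  obtain I j \<sigma> where s: "s = (I, j, \<sigma>)" "I \<subseteq> {..<n}" "card I = Suc m" "j \<in> I" "\<sigma> permutes I" "\<sigma> j \<noteq> j" "finite I"
    by (rule off_indexE[OF assms])
  show "(case s of (I, j, \<sigma>) \<Rightarrow> graph_on (I - {j}) \<sigma>) \<subseteq> {..<n} \<times> {..<n}"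
    using s(2) permutes_in_image[OF s(5)] by (auto simp: s(1) graph_on_def)
  show "card (case s of (I, j, \<sigma>) \<Rightarrow> graph_on (I - {j}) \<sigma>) = m" using s by simp
qed

lemma off_sum_second_moment:
  assumes k: "0 < k" "0 < n" and f: "centered law f" and t: "(\<integral>x. (cmod (f x))\<^sup>2 \<partial>law) \<le> 1"
  shows "integrable M (\<lambda>\<omega>. (cmod (off_sum (entry k A B f \<omega>) u w n m))\<^sup>2)"
    and "expectation (\<lambda>\<omega>. (cmod (off_sum (entry k A B f \<omega>) u w n m))\<^sup>2) \<le>
      real m / n * ((\<Sum>j<n. (cmod (u j))\<^sup>2) * (\<Sum>j<n. (cmod (w j))\<^sup>2))"
proof -
  note * = monomial_sum_second_moment[OF k(1) f finite_off_index inj_on_off_graph off_graph]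
  show "integrable M (\<lambda>\<omega>. (cmod (off_sum (entry k A B f \<omega>) u w n m))\<^sup>2)"
    unfolding off_sum_monomial by (rule *(1))
  define c where "c s = of_int (sign (snd (snd s))) * (u (fst (snd s)) * w (snd (snd s) (fst (snd s))))"
    for s :: "nat set \<times> nat \<times> (nat \<Rightarrow> nat)"
  define V where "V = (\<Sum>j<n. (cmod (u j))\<^sup>2) * (\<Sum>j<n. (cmod (w j))\<^sup>2)"
  have E: "expectation (\<lambda>\<omega>. (cmod (off_sum (entry k A B f \<omega>) u w n m))\<^sup>2) =
    (\<Sum>s\<in>off_index n m. (cmod (c s))\<^sup>2) * ((\<integral>x. (cmod (f x))\<^sup>2 \<partial>law) / n) ^ m"
    unfolding off_sum_monomial c_def by (rule *(2))
  also have "\<dots> \<le> (\<Sum>s\<in>off_index n m. (cmod (c s))\<^sup>2) / real n ^ m"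
    using k t by (intro second_moment_scale) (auto intro: sum_nonneg)
  also have "\<dots> \<le> real m / n * V"
  proof (cases m)
    case 0
    \<comment> \<open>A singleton has no permutation moving its point; this settles order 0, where
      the count below would need a negative index.\<close>
    have "off_index n 0 = {}"
    proof (rule equals0I)
      fix s assume "s \<in> off_index n 0"
      then obtain I j \<sigma> where s: "s = (I, j, \<sigma>)" "I \<subseteq> {..<n}" "card I = Suc 0" "j \<in> I"
        "\<sigma> permutes I" "\<sigma> j \<noteq> j" "finite I"
        by (rule off_indexE)
      then obtain i where "I = {i}" by (auto simp: card_Suc_eq)
      then show False using s permutes_in_image[OF s(5), of j] by auto
    qed
    then show ?thesis using 0 by simp
  next
    case (Suc l)
    have "(\<Sum>s\<in>off_index n m. (cmod (c s))\<^sup>2) = (\<Sum>(I, j, \<sigma>)\<in>off_index n m. (cmod (u j))\<^sup>2 * (cmod (w (\<sigma> j)))\<^sup>2)"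
      by (intro sum.cong refl) (simp only: c_def norm_mult cmod_sign mult_1_left power_mult_distrib split_def)
    also have "\<dots> \<le> real (n choose l) * fact (Suc l) * V"
      unfolding Suc V_def by (rule sum_off_index_le) auto
    finally have "(\<Sum>s\<in>off_index n m. (cmod (c s))\<^sup>2) / real n ^ m \<le> real (n choose l) * fact (Suc l) * V / real n ^ m"
      by (rule divide_right_mono) simp
    also have "\<dots> = (real (n choose l) * fact (Suc l) / real n ^ Suc l) * V" by (simp add: Suc)
    also have "\<dots> \<le> (real (Suc l) / n) * V"
      using binomial_fact_div_le[OF k(2), of l] by (intro mult_right_mono) (auto simp: V_def sum_nonneg)
    finally show ?thesis by (simp add: Suc)
  qed
  finally show "expectation (\<lambda>\<omega>. (cmod (off_sum (entry k A B f \<omega>) u w n m))\<^sup>2) \<le>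
      real m / n * ((\<Sum>j<n. (cmod (u j))\<^sup>2) * (\<Sum>j<n. (cmod (w j))\<^sup>2))"
    unfolding V_def .
qed

end

subsection \<open>Second moments of the traces\<close>

text \<open>A crude count, choosing the image and then any word in it. The factor \<nu>^(card T)
  does not involve n, and the count is used only where a spare factor 1 / n is available.\<close>

lemma card_words_image:
  assumes T: "finite T"
  shows "card {c \<in> T \<rightarrow>\<^sub>E {..<n::nat}. card (c ` T) = \<nu>} \<le> (n choose \<nu>) * \<nu> ^ card T"
proof -
  let ?U = "{U. U \<subseteq> {..<n} \<and> card U = \<nu>}"
  have fin: "finite U" if "U \<in> ?U" for U using that finite_subset by auto
  have "card {c \<in> T \<rightarrow>\<^sub>E {..<n}. card (c ` T) = \<nu>} \<le> card (SIGMA U:?U. T \<rightarrow>\<^sub>E U)"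
  proof (rule card_inj_on_le[where f = "\<lambda>c. (c ` T, c)"])
    show "inj_on (\<lambda>c. (c ` T, c)) {c \<in> T \<rightarrow>\<^sub>E {..<n}. card (c ` T) = \<nu>}" by (auto intro: inj_onI)
    show "(\<lambda>c. (c ` T, c)) ` {c \<in> T \<rightarrow>\<^sub>E {..<n}. card (c ` T) = \<nu>} \<subseteq> (SIGMA U:?U. T \<rightarrow>\<^sub>E U)"
      by (auto simp: PiE_iff extensional_def)
    show "finite (SIGMA U:?U. T \<rightarrow>\<^sub>E U)"
      using T fin by (intro finite_SigmaI finite_PiE finite_subsets_card) auto
  qed
  also have "\<dots> = (\<Sum>U\<in>?U. card (T \<rightarrow>\<^sub>E U))"
    using T fin by (intro card_SigmaI finite_subsets_card ballI finite_PiE) auto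
  also have "\<dots> = (\<Sum>U\<in>?U. \<nu> ^ card T)"
    using T by (intro sum.cong refl) (simp add: card_funcsetE)
  also have "\<dots> = (n choose \<nu>) * \<nu> ^ card T"
    using n_subsets[of "{..<n}" \<nu>] by simp
  finally show ?thesis .
qed

text \<open>A word labels an abstract index set T whose successor map s has the closed walks as its
  cycles. Pairs of walks are then words for a map with two cycles.\<close>

definition word_edges :: "('t \<Rightarrow> 't) \<Rightarrow> 't set \<Rightarrow> ('t \<Rightarrow> nat) \<Rightarrow> (nat \<times> nat) set" where
  "word_edges s T c = (\<lambda>t. (c t, c (s t))) ` T"

definition functional_word :: "('t \<Rightarrow> 't) \<Rightarrow> 't set \<Rightarrow> ('t \<Rightarrow> nat) \<Rightarrow> bool" where
  "functional_word s T c \<longleftrightarrow> (\<exists>\<phi>. \<forall>t\<in>T. c (s t) = \<phi> (c t))"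

lemma fst_word_edges: "fst ` word_edges s T c = c ` T"
  by (auto simp: word_edges_def image_iff)

text \<open>The first coordinate maps edges onto vertices; equal cardinalities make it injective, so
  every vertex has exactly one outgoing edge.\<close>

lemma functional_wordI:
  assumes "finite T" "card (word_edges s T c) = card (c ` T)"
  shows "functional_word s T c"
proof -
  have "inj_on fst (word_edges s T c)"
  proof (rule eq_card_imp_inj_on)
    show "finite (word_edges s T c)" using assms(1) by (simp add: word_edges_def)
    show "card (fst ` word_edges s T c) = card (word_edges s T c)"
      unfolding fst_word_edges by (rule assms(2)[symmetric])
  qed
  then have "c (s t) = snd (inv_into (word_edges s T c) fst (c t))" if "t \<in> T" for t
    using inv_into_f_f[of fst "word_edges s T c" "(c t, c (s t))"] that by (simp add: word_edges_def)
  then show ?thesis unfolding functional_word_def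
    by (intro exI[of _ "\<lambda>x. snd (inv_into (word_edges s T c) fst x)"]) blast
qed

text \<open>Since s maps T onto itself, the induced map of the finite vertex set is onto and hence
  bijective.\<close>

lemma functional_word_permutation:
  assumes T: "finite T" "s ` T = T" and c: "functional_word s T c"
  shows "\<exists>\<phi>. \<phi> permutes (c ` T) \<and> (\<forall>t\<in>T. c (s t) = \<phi> (c t))"
proof -
  obtain \<psi> where \<psi>: "\<forall>t\<in>T. c (s t) = \<psi> (c t)" using c by (auto simp: functional_word_def)
  define \<phi> where "\<phi> x = (if x \<in> c ` T then \<psi> x else x)" for x
  have \<phi>: "\<forall>t\<in>T. c (s t) = \<phi> (c t)" using \<psi> by (simp add: \<phi>_def)
  have im: "\<phi> ` (c ` T) = c ` T"
  proof -
    have "\<phi> ` (c ` T) = (\<lambda>t. c (s t)) ` T" using \<phi> by (auto simp: image_iff)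
    also have "\<dots> = c ` (s ` T)" by auto
    finally show ?thesis using T by simp
  qed
  then have "inj_on \<phi> (c ` T)" using T(1) by (intro finite_surj_inj) auto
  then have "bij_betw \<phi> (c ` T) (c ` T)" using im by (simp add: bij_betw_def)
  then have "\<phi> permutes (c ` T)" by (rule bij_imp_permutes) (simp add: \<phi>_def)
  with \<phi> show ?thesis by blast
qed

text \<open>A word whose edges form the graph of a function is determined by that function, which
  permutes the vertices of the word, and by its values on one index of each cycle of \<open>s\<close>.\<close>

lemma card_functional_words:
  assumes T: "finite T" "s ` T = T" and T0: "T0 \<subseteq> T" "\<And>t. t \<in> T \<Longrightarrow> \<exists>t0\<in>T0. \<exists>i. t = (s ^^ i) t0"
  shows "card {c \<in> T \<rightarrow>\<^sub>E {..<n}. card (c ` T) = \<nu> \<and> functional_word s T c} \<le>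
    (n choose \<nu>) * fact \<nu> * \<nu> ^ card T0"
proof -
  let ?U = "{U. U \<subseteq> {..<n} \<and> card U = \<nu>}"
  let ?C = "{c \<in> T \<rightarrow>\<^sub>E {..<n}. card (c ` T) = \<nu> \<and> functional_word s T c}"
  let ?B = "SIGMA U:?U. {\<phi>. \<phi> permutes U} \<times> (T0 \<rightarrow>\<^sub>E U)"
  have fin: "finite U" if "U \<in> ?U" for U using that finite_subset by auto
  have finT0: "finite T0" using T(1) T0(1) finite_subset by blast
  have finB: "finite ({\<phi>. \<phi> permutes U} \<times> (T0 \<rightarrow>\<^sub>E U))" if "U \<in> ?U" for U
    using fin[OF that] finT0 by (intro finite_cartesian_product finite_permutations finite_PiE) auto
  define p where "p c = (SOME \<phi>. \<phi> permutes (c ` T) \<and> (\<forall>t\<in>T. c (s t) = \<phi> (c t)))"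
    for c :: "'a \<Rightarrow> nat"
  have p: "p c permutes (c ` T)" "\<And>t. t \<in> T \<Longrightarrow> c (s t) = p c (c t)" if "functional_word s T c" for c
    using someI_ex[OF functional_word_permutation[OF T that]] unfolding p_def by blast+
  define code where "code c = (c ` T, p c, restrict c T0)" for c
  have sT: "(s ^^ i) t \<in> T" if "t \<in> T" for i t
    using that T(2) by (induction i) auto
  have "card ?C \<le> card ?B"
  proof (rule card_inj_on_le[where f = code])
    show "inj_on code ?C"
    proof (rule inj_onI)
      fix c d assume c: "c \<in> ?C" and d: "d \<in> ?C" and eq: "code c = code d"
      have pe: "p c = p d" and re: "restrict c T0 = restrict d T0" using eq by (auto simp: code_def)
      have orb: "c ((s ^^ i) t0) = d ((s ^^ i) t0)" if "t0 \<in> T0" for i t0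
      proof (induction i)
        case 0
        show ?case using fun_cong[OF re, of t0] that by simp
      next
        case (Suc i)
        have "(s ^^ i) t0 \<in> T" using sT that T0(1) by blast
        then show ?case using p(2)[of c "(s ^^ i) t0"] p(2)[of d "(s ^^ i) t0"] c d Suc pe by simp
      qed
      show "c = d"
      proof (rule PiE_ext)
        show "c \<in> T \<rightarrow>\<^sub>E {..<n}" "d \<in> T \<rightarrow>\<^sub>E {..<n}" using c d by auto
        fix t assume "t \<in> T"
        then show "c t = d t" using T0(2)[of t] orb by auto
      qed
    qed
    show "code ` ?C \<subseteq> ?B"
    proof
      fix z assume "z \<in> code ` ?C"
      then obtain c where c: "c \<in> ?C" "z = code c" by blast
      have "c ` T \<in> ?U" using c by (auto simp: PiE_iff)
      moreover have "restrict c T0 \<in> T0 \<rightarrow>\<^sub>E c ` T" using T0(1) by auto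
      ultimately show "z \<in> ?B" using p(1)[of c] c unfolding code_def by auto
    qed
    show "finite ?B" by (intro finite_SigmaI finite_subsets_card finB)
  qed
  also have "card ?B = (\<Sum>U\<in>?U. card ({\<phi>. \<phi> permutes U} \<times> (T0 \<rightarrow>\<^sub>E U)))"
    by (intro card_SigmaI finite_subsets_card ballI finB)
  also have "\<dots> = (\<Sum>U\<in>?U. fact \<nu> * \<nu> ^ card T0)"
  proof (rule sum.cong[OF refl])
    fix U assume U: "U \<in> ?U"
    then have "card {\<phi>. \<phi> permutes U} = fact \<nu>" by (intro card_permutations fin) auto
    then show "card ({\<phi>. \<phi> permutes U} \<times> (T0 \<rightarrow>\<^sub>E U)) = fact \<nu> * \<nu> ^ card T0"
      using U finT0 by (simp add: card_cartesian_product card_funcsetE)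
  qed
  also have "\<dots> = (n choose \<nu>) * fact \<nu> * \<nu> ^ card T0"
    using n_subsets[of "{..<n}" \<nu>] by simp
  finally show ?thesis .
qed

lemma binomial_fact_div_power_le_1:
  assumes "0 < n"
  shows "real (n choose \<nu>) * fact \<nu> * (1 / real n) ^ \<nu> \<le> 1"
proof -
  have "real ((n choose \<nu>) * fact \<nu>) \<le> real (n ^ \<nu>)" using binomial_fact_pow[of n \<nu>] by (subst of_nat_le_iff)
  then show ?thesis using assms by (simp add: power_divide divide_le_eq)
qed

text \<open>Compare F edges with U vertices; about n^U words have U vertices. If F > U, the weight
  n^(-F) beats this by a factor 1 / n, which gives the second term with a constant depending on K
  only. If F = U, the word is functional and its weight is summable: one free starting label per
  cycle gives K^(card T0), and the powers of \<rho> \<le> 1/2 sum to at most 2.\<close>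

lemma sum_words_le:
  fixes \<rho> :: real
  assumes n: "0 < n" and T: "finite T" "s ` T = T" "card T = 2 * K"
    and T0: "T0 \<subseteq> T" "\<And>t. t \<in> T \<Longrightarrow> \<exists>t0\<in>T0. \<exists>i. t = (s ^^ i) t0"
    and \<rho>: "0 \<le> \<rho>" "\<rho> \<le> 1 / 2"
  shows "(\<Sum>c\<in>T \<rightarrow>\<^sub>E {..<n}. if card (word_edges s T c) \<le> K
      then (1 / real n) ^ card (word_edges s T c) * \<rho> ^ (K - card (word_edges s T c)) else 0)
    \<le> 2 * real K ^ card T0 + real (2 * K + 1) * real (2 * K) ^ (2 * K) / n"
proof -
  let ?W = "T \<rightarrow>\<^sub>E {..<n}"
  define U where "U c = card (c ` T)" for c :: "'a \<Rightarrow> nat"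
  define a where "a c = (1 / real n) ^ U c" for c :: "'a \<Rightarrow> nat"
  define b where "b c = (if functional_word s T c \<and> U c \<le> K then (1 / real n) ^ U c * \<rho> ^ (K - U c) else 0)" for c
  have finW: "finite ?W" using T(1) by (intro finite_PiE) auto
  have U2K: "U c \<le> 2 * K" for c unfolding U_def T(3)[symmetric] by (rule card_image_le[OF T(1)])
  have n1: "1 / real n \<le> 1" using n by simp
  have pointwise: "(if card (word_edges s T c) \<le> K then (1 / real n) ^ card (word_edges s T c) * \<rho> ^ (K - card (word_edges s T c)) else 0)
    \<le> a c / n + b c" for c
  proof -
    have b0: "0 \<le> b c" using \<rho> by (simp add: b_def)
    have a0: "0 \<le> a c / n" by (simp add: a_def)
    have UF: "U c \<le> card (word_edges s T c)"
      unfolding U_def fst_word_edges[symmetric, of c T s] using T(1) by (intro card_image_le) (simp add: word_edges_def)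
    show ?thesis
    proof (cases "card (word_edges s T c) \<le> K")
      case True
      show ?thesis
      proof (cases "U c = card (word_edges s T c)")
        case eq: True
        have "functional_word s T c" using eq by (intro functional_wordI[OF T(1)]) (simp add: U_def)
        then show ?thesis using True eq a0 by (simp add: b_def)
      next
        case False
        then have lt: "Suc (U c) \<le> card (word_edges s T c)" using UF by simp
        have "(1 / real n) ^ card (word_edges s T c) * \<rho> ^ (K - card (word_edges s T c)) \<le> (1 / real n) ^ Suc (U c) * 1"
          using \<rho> n1 lt by (intro mult_mono power_decreasing power_le_one) auto
        then show ?thesis using True b0 by (simp add: a_def)
      qed
    next
      case False
      then show ?thesis using a0 b0 by simp
    qed
  qed
  have "(\<Sum>c\<in>?W. a c) = (\<Sum>\<nu>\<le>2 * K. \<Sum>c | c \<in> ?W \<and> U c = \<nu>. a c)"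
    using finW U2K by (intro sum.group[symmetric]) auto
  also have "\<dots> \<le> (\<Sum>\<nu>\<le>2 * K. real (2 * K) ^ (2 * K))"
  proof (rule sum_mono)
    fix \<nu> assume \<nu>: "\<nu> \<in> {..2 * K}"
    have "(\<Sum>c | c \<in> ?W \<and> U c = \<nu>. a c) = real (card {c \<in> ?W. U c = \<nu>}) * (1 / real n) ^ \<nu>"
      by (simp add: a_def)
    also have "\<dots> \<le> real ((n choose \<nu>) * \<nu> ^ (2 * K)) * (1 / real n) ^ \<nu>"
      using card_words_image[OF T(1), of n \<nu>] unfolding T(3) U_def
      by (intro mult_right_mono) (auto simp only: of_nat_le_iff zero_le_power zero_le_divide_1_iff of_nat_0_le_iff)
    also have "\<dots> = (real (n choose \<nu>) * 1 * (1 / real n) ^ \<nu>) * real \<nu> ^ (2 * K)" by simp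
    \<comment> \<open>The factor \<open>fact \<nu>\<close> is at least 1 and is inserted so that the
      falling factorial bound applies.\<close>
    also have "\<dots> \<le> (real (n choose \<nu>) * fact \<nu> * (1 / real n) ^ \<nu>) * real \<nu> ^ (2 * K)"
      by (intro mult_right_mono mult_left_mono) (auto simp: fact_ge_1)
    also have "\<dots> \<le> 1 * real (2 * K) ^ (2 * K)"
      using \<nu> binomial_fact_div_power_le_1[OF n, of \<nu>] by (intro mult_mono power_mono) auto
    finally show "(\<Sum>c | c \<in> ?W \<and> U c = \<nu>. a c) \<le> real (2 * K) ^ (2 * K)" by simp
  qed
  also have "\<dots> = real (2 * K + 1) * real (2 * K) ^ (2 * K)" by simp
  finally have Sa: "(\<Sum>c\<in>?W. a c) \<le> real (2 * K + 1) * real (2 * K) ^ (2 * K)" .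
  have geo: "(\<Sum>i\<le>K. \<rho> ^ i) \<le> 2"
  proof -
    have "(1 - \<rho>) * (\<Sum>i\<le>K. \<rho> ^ i) = 1 - \<rho> ^ Suc K" using sum_gp_basic[of \<rho> K] by simp
    also have "\<dots> \<le> 1" using \<rho> by simp
    finally have *: "(1 - \<rho>) * (\<Sum>i\<le>K. \<rho> ^ i) \<le> 1" .
    have "(1 / 2) * (\<Sum>i\<le>K. \<rho> ^ i) \<le> (1 - \<rho>) * (\<Sum>i\<le>K. \<rho> ^ i)"
      using \<rho> by (intro mult_right_mono sum_nonneg) auto
    with * show ?thesis by linarith
  qed
  have "(\<Sum>c\<in>?W. b c) = (\<Sum>\<nu>\<le>2 * K. \<Sum>c | c \<in> ?W \<and> U c = \<nu>. b c)"
    using finW U2K by (intro sum.group[symmetric]) auto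
  also have "\<dots> \<le> (\<Sum>\<nu>\<le>2 * K. if \<nu> \<le> K then real K ^ card T0 * \<rho> ^ (K - \<nu>) else 0)"
  proof (rule sum_mono)
    fix \<nu> assume "\<nu> \<in> {..2 * K}"
    show "(\<Sum>c | c \<in> ?W \<and> U c = \<nu>. b c) \<le> (if \<nu> \<le> K then real K ^ card T0 * \<rho> ^ (K - \<nu>) else 0)"
    proof (cases "\<nu> \<le> K")
      case True
      have "(\<Sum>c | c \<in> ?W \<and> U c = \<nu>. b c) =
        (\<Sum>c\<in>{c \<in> ?W. U c = \<nu> \<and> functional_word s T c}. (1 / real n) ^ \<nu> * \<rho> ^ (K - \<nu>))"
        using finW True by (intro sum.mono_neutral_cong_right) (auto simp: b_def)
      also have "\<dots> = real (card {c \<in> ?W. U c = \<nu> \<and> functional_word s T c}) * ((1 / real n) ^ \<nu> * \<rho> ^ (K - \<nu>))" by simp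
      also have "\<dots> \<le> real ((n choose \<nu>) * fact \<nu> * \<nu> ^ card T0) * ((1 / real n) ^ \<nu> * \<rho> ^ (K - \<nu>))"
      proof (rule mult_right_mono)
        show "real (card {c \<in> ?W. U c = \<nu> \<and> functional_word s T c}) \<le> real ((n choose \<nu>) * fact \<nu> * \<nu> ^ card T0)"
          unfolding of_nat_le_iff U_def by (rule card_functional_words[OF T(1,2) T0])
      qed (use \<rho> in simp)
      also have "\<dots> = (real (n choose \<nu>) * fact \<nu> * (1 / real n) ^ \<nu>) * (real \<nu> ^ card T0 * \<rho> ^ (K - \<nu>))" by simp
      also have "\<dots> \<le> 1 * (real K ^ card T0 * \<rho> ^ (K - \<nu>))"
        using True \<rho> binomial_fact_div_power_le_1[OF n, of \<nu>]
        by (intro mult_mono power_mono mult_nonneg_nonneg) auto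
      finally show ?thesis using True by simp
    next
      case False
      then have "(\<Sum>c | c \<in> ?W \<and> U c = \<nu>. b c) = 0" by (intro sum.neutral) (auto simp: b_def)
      then show ?thesis using False by simp
    qed
  qed
  also have "\<dots> = (\<Sum>\<nu>\<le>K. real K ^ card T0 * \<rho> ^ (K - \<nu>))"
    by (intro sum.mono_neutral_cong_right) auto
  also have "\<dots> = real K ^ card T0 * (\<Sum>i\<le>K. \<rho> ^ i)"
    unfolding sum_distrib_left[symmetric]
    by (rule arg_cong[of _ _ "\<lambda>x. real K ^ card T0 * x"], rule sum.reindex_bij_witness[of _ "\<lambda>i. K - i" "\<lambda>i. K - i"]) auto
  also have "\<dots> \<le> real K ^ card T0 * 2" by (intro mult_left_mono geo) simp
  finally have Sb: "(\<Sum>c\<in>?W. b c) \<le> real K ^ card T0 * 2" .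
  from pointwise have "(\<Sum>c\<in>?W. if card (word_edges s T c) \<le> K then (1 / real n) ^ card (word_edges s T c) * \<rho> ^ (K - card (word_edges s T c)) else 0)
    \<le> (\<Sum>c\<in>?W. a c / n + b c)"
    by (intro sum_mono)
  also have "\<dots> = (\<Sum>c\<in>?W. a c) / n + (\<Sum>c\<in>?W. b c)"
    by (simp add: sum.distrib sum_divide_distrib)
  also have "\<dots> \<le> real (2 * K + 1) * real (2 * K) ^ (2 * K) / n + real K ^ card T0 * 2"
    using Sa Sb by (intro add_mono divide_right_mono) auto
  finally show ?thesis by (simp only: add.commute mult.commute)
qed

context sparse_iid_model
begin

text \<open>An edge used once has mean zero and kills the word. Otherwise each edge is used at least
  twice, so there are F \<le> K edges; two uses of each are paid by the variance and the remaining 2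
  (K - F) by D. The total k^(-K) (k / n)^F D^(2 (K - F)) is the stated bound, so every edge short of
  K gains D^2 / k.\<close>

lemma expectation_word_bound:
  fixes s :: "'t \<Rightarrow> 't"
  assumes k: "0 < k" and law: "prob_space law" "sets law = sets borel"
    and f: "f \<in> borel_measurable borel" "\<And>x. cmod (f x) \<le> D" "(\<integral>x. (cmod (f x))\<^sup>2 \<partial>law) \<le> 1" and n: "0 < n"
    and T: "finite T" "s ` T = T" "card T = 2 * K"
    and g: "\<And>t. g t \<in> borel_measurable borel" "\<And>t x. cmod (g t x) = cmod (f x)" "\<And>t. (\<integral>x. g t x \<partial>law) = 0"
    and c: "c \<in> T \<rightarrow>\<^sub>E {..<n}"
  shows "integrable M (\<lambda>\<omega>. \<Prod>t\<in>T. entry k A B (g t) \<omega> (c t) (c (s t)))"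
    and "cmod (expectation (\<lambda>\<omega>. \<Prod>t\<in>T. entry k A B (g t) \<omega> (c t) (c (s t)))) \<le>
      (if card (word_edges s T c) \<le> K
       then (1 / real n) ^ card (word_edges s T c) * (D\<^sup>2 / k) ^ (K - card (word_edges s T c)) else 0)"
proof -
  interpret L: prob_space law by (rule law(1))
  define ed where "ed t = (c t, c (s t))" for t
  define F where "F = word_edges s T c"
  have F: "F = ed ` T" by (simp add: F_def word_edges_def ed_def[abs_def])
  have finF: "finite F" using T(1) by (simp add: F)
  have D: "0 \<le> D" using f(2)[of 0] by (rule order_trans[OF norm_ge_zero])
  define Te where "Te e = {t. t \<in> T \<and> ed t = e}" for e
  have finTe: "finite (Te e)" for e using T(1) by (simp add: Te_def)
  have gl: "g t \<in> borel_measurable law" for t using g(1) law(2) by (simp cong: measurable_cong_sets)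
  have pm: "(\<lambda>x. \<Prod>t\<in>Te e. g t x) \<in> borel_measurable law" for e by (intro borel_measurable_prod gl)
  have pn: "cmod (\<Prod>t\<in>Te e. g t x) = cmod (f x) ^ card (Te e)" for e x
    by (simp add: prod_norm[symmetric] g(2))
  have pb: "cmod (\<Prod>t\<in>Te e. g t x) \<le> D ^ card (Te e)" for e x
    unfolding pn by (intro power_mono f(2)) auto
  have gi: "integrable law (\<lambda>x. \<Prod>t\<in>Te e. g t x)" for e
    by (rule L.integrable_const_bound[of _ "D ^ card (Te e)"]) (use pb pm in auto)
  have sub: "ed ` T \<subseteq> {..<n} \<times> {..<n}"
  proof -
    have "s t \<in> T" if "t \<in> T" for t using T(2) that by blast
    then show ?thesis using c by (auto simp: ed_def PiE_iff)
  qed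
  have I: "integrable M (\<lambda>\<omega>. \<Prod>t\<in>T. entry k A B (g t) \<omega> (fst (ed t)) (snd (ed t)))"
    by (rule expectation_word(1)[OF T(1) sub g(1)]) (use gi in \<open>simp add: Te_def\<close>)
  then show "integrable M (\<lambda>\<omega>. \<Prod>t\<in>T. entry k A B (g t) \<omega> (c t) (c (s t)))" by (simp add: ed_def)
  define X where "X = expectation (\<lambda>\<omega>. \<Prod>t\<in>T. entry k A B (g t) \<omega> (c t) (c (s t)))"
  have E: "X = complex_of_real (1 / sqrt (real k)) ^ card T *
      (\<Prod>e\<in>F. complex_of_real (real k / real n) * (\<integral>x. (\<Prod>t\<in>Te e. g t x) \<partial>law))"
  proof -
    have "X = expectation (\<lambda>\<omega>. \<Prod>t\<in>T. entry k A B (g t) \<omega> (fst (ed t)) (snd (ed t)))"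
      by (simp add: X_def ed_def)
    also have "\<dots> = complex_of_real (1 / sqrt (real k)) ^ card T *
      (\<Prod>e\<in>ed ` T. complex_of_real (real k / real n) * (\<integral>x. (\<Prod>t | t \<in> T \<and> ed t = e. g t x) \<partial>law))"
      by (rule expectation_word(2)[OF T(1) sub g(1)]) (use gi in \<open>simp add: Te_def\<close>)
    finally show ?thesis unfolding F Te_def .
  qed
  have cT: "0 < card (Te e)" if "e \<in> F" for e
    using that finTe[of e] by (auto simp: card_gt_0_iff F Te_def)
  have "cmod X \<le> (if card F \<le> K then (1 / real n) ^ card F * (D\<^sup>2 / k) ^ (K - card F) else 0)"
  proof (cases "\<exists>e\<in>F. card (Te e) = 1")
    case True
    then obtain e t where e: "e \<in> F" "Te e = {t}" by (auto simp: card_1_singleton_iff)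
    then have "(\<Prod>e\<in>F. complex_of_real (real k / real n) * (\<integral>x. (\<Prod>t\<in>Te e. g t x) \<partial>law)) = 0"
      using finF g(3) by (intro prod_zero) (auto intro!: bexI[of _ e])
    then have "X = 0" by (simp only: E mult_zero_right)
    then show ?thesis using D by simp
  next
    case False
    then have m2: "2 \<le> card (Te e)" if "e \<in> F" for e using cT[OF that] that by (cases "card (Te e)") (auto simp: numeral_2_eq_2 Suc_le_eq)
    have sumT: "(\<Sum>e\<in>F. card (Te e)) = 2 * K"
    proof -
      have "(\<Sum>t\<in>T. 1::nat) = (\<Sum>e\<in>ed ` T. \<Sum>t | t \<in> T \<and> ed t = e. 1)" by (rule sum.image_gen[OF T(1)])
      then show ?thesis using T(3) by (simp add: F Te_def)
    qed
    have "(\<Sum>e\<in>F. 2) \<le> (\<Sum>e\<in>F. card (Te e))" by (intro sum_mono m2)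
    then have FK: "card F \<le> K" using sumT by simp
    have sum2: "(\<Sum>e\<in>F. card (Te e) - 2) = 2 * (K - card F)"
    proof -
      have "(\<Sum>e\<in>F. card (Te e) - 2) = (\<Sum>e\<in>F. card (Te e)) - (\<Sum>e\<in>F. 2)"
        by (rule sum_subtractf_nat) (use m2 in auto)
      then show ?thesis using sumT by simp
    qed
    have Ib: "cmod (\<integral>x. (\<Prod>t\<in>Te e. g t x) \<partial>law) \<le> D ^ (card (Te e) - 2)" if e: "e \<in> F" for e
    proof -
      have sq: "integrable law (\<lambda>x. (cmod (f x))\<^sup>2)"
      proof (rule L.integrable_const_bound[of _ "D\<^sup>2"])
        show "(\<lambda>x. (cmod (f x))\<^sup>2) \<in> borel_measurable law"
          using f(1) law(2) by (auto cong: measurable_cong_sets)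
        show "AE x in law. norm ((cmod (f x))\<^sup>2) \<le> D\<^sup>2" using f(2) by (auto intro!: power_mono)
      qed
      have "cmod (\<integral>x. (\<Prod>t\<in>Te e. g t x) \<partial>law) \<le> (\<integral>x. cmod (\<Prod>t\<in>Te e. g t x) \<partial>law)"
        by (rule integral_norm_bound)
      also have "\<dots> \<le> (\<integral>x. D ^ (card (Te e) - 2) * (cmod (f x))\<^sup>2 \<partial>law)"
      proof (rule integral_mono)
        fix x
        have "cmod (f x) ^ card (Te e) = cmod (f x) ^ ((card (Te e) - 2) + 2)"
          using m2[OF e] by (simp only: le_add_diff_inverse2)
        also have "\<dots> = cmod (f x) ^ (card (Te e) - 2) * (cmod (f x))\<^sup>2" by (rule power_add)
        also have "\<dots> \<le> D ^ (card (Te e) - 2) * (cmod (f x))\<^sup>2"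
          by (intro mult_right_mono power_mono f(2)) auto
        finally show "cmod (\<Prod>t\<in>Te e. g t x) \<le> D ^ (card (Te e) - 2) * (cmod (f x))\<^sup>2" unfolding pn .
      qed (use gi sq in auto)
      also have "\<dots> = D ^ (card (Te e) - 2) * (\<integral>x. (cmod (f x))\<^sup>2 \<partial>law)" by simp
      also have "\<dots> \<le> D ^ (card (Te e) - 2) * 1" using D f(3) by (intro mult_left_mono) auto
      finally show ?thesis by simp
    qed
    have "cmod X = (1 / sqrt (real k)) ^ (2 * K) * (\<Prod>e\<in>F. (real k / real n) * cmod (\<integral>x. (\<Prod>t\<in>Te e. g t x) \<partial>law))"
      unfolding E T(3) norm_mult norm_power prod_norm[symmetric] norm_of_real by simp
    also have "\<dots> \<le> (1 / sqrt (real k)) ^ (2 * K) * (\<Prod>e\<in>F. (real k / real n) * D ^ (card (Te e) - 2))"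
      by (intro mult_left_mono prod_mono) (auto intro!: mult_left_mono divide_right_mono Ib)
    also have "(\<Prod>e\<in>F. (real k / real n) * D ^ (card (Te e) - 2)) = (real k / real n) ^ card F * D ^ (2 * (K - card F))"
      unfolding prod.distrib sum2[symmetric] power_sum by simp
    also have "(1 / sqrt (real k)) ^ (2 * K) = (1 / real k) ^ K"
      by (simp add: power_mult power_divide)
    also have "(1 / real k) ^ K = (1 / real k) ^ card F * (1 / real k) ^ (K - card F)"
      using FK by (simp flip: power_add)
    also have "(1 / real k) ^ card F * (1 / real k) ^ (K - card F) * ((real k / real n) ^ card F * D ^ (2 * (K - card F)))
      = (1 / real n) ^ card F * (D\<^sup>2 / k) ^ (K - card F)"
      using k by (simp add: power_divide power_mult field_simps)
    finally show ?thesis using FK by simp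
  qed
  then show "cmod (expectation (\<lambda>\<omega>. \<Prod>t\<in>T. entry k A B (g t) \<omega> (c t) (c (s t)))) \<le>
      (if card (word_edges s T c) \<le> K
       then (1 / real n) ^ card (word_edges s T c) * (D\<^sup>2 / k) ^ (K - card (word_edges s T c)) else 0)"
    unfolding X_def F_def .
qed

text \<open>The squared modulus is a sum over words on two disjoint K-cycles, told apart by a
  Boolean; the letters marked \<open>False\<close> carry the conjugated function. One starting index
  on each cycle generates T, hence the exponent 2.\<close>

lemma closed_walk_sum_second_moment:
  assumes k: "0 < k" and law: "prob_space law" "sets law = sets borel"
    and f: "f \<in> borel_measurable borel" "\<And>x. cmod (f x) \<le> D" "(\<integral>x. f x \<partial>law) = 0" "(\<integral>x. (cmod (f x))\<^sup>2 \<partial>law) \<le> 1"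
    and n: "0 < n" and K: "0 < K" and D: "D\<^sup>2 / k \<le> 1 / 2"
  shows "integrable M (\<lambda>\<omega>. (cmod (closed_walk_sum (entry k A B f \<omega>) n K))\<^sup>2)"
    and "expectation (\<lambda>\<omega>. (cmod (closed_walk_sum (entry k A B f \<omega>) n K))\<^sup>2) \<le>
      2 * (real K)\<^sup>2 + real (2 * K + 1) * real (2 * K) ^ (2 * K) / n"
proof -
  define T where "T = {..<K} \<times> (UNIV :: bool set)"
  define s where "s p = (Suc (fst p) mod K, snd p)" for p :: "nat \<times> bool"
  define T0 where "T0 = {0::nat} \<times> (UNIV :: bool set)"
  define g where "g p = (if snd p then f else (\<lambda>x. cnj (f x)))" for p :: "nat \<times> bool"
  have T: "finite T" "card T = 2 * K" by (auto simp: T_def card_cartesian_product)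
  have T0: "T0 \<subseteq> T" "card T0 = 2" using K by (auto simp: T0_def T_def card_cartesian_product)
  have orb: "(s ^^ i) (0, b) = (i, b)" if "i < K" for i b
    using that by (induction i) (auto simp: s_def)
  have gen: "\<exists>t0\<in>T0. \<exists>i. t = (s ^^ i) t0" if "t \<in> T" for t
  proof -
    obtain i b where "t = (i, b)" by (cases t)
    with that have t: "t = (i, b)" "i < K" by (auto simp: T_def)
    show ?thesis using orb[OF t(2), of b] t(1) by (intro bexI[of _ "(0, b)"] exI[of _ i]) (auto simp: T0_def)
  qed
  have sT: "s ` T = T"
  proof
    show "s ` T \<subseteq> T" using K by (auto simp: s_def T_def)
    show "T \<subseteq> s ` T"
    proof
      fix t assume tT: "t \<in> T"
      obtain i b where "t = (i, b)" by (cases t)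
      with tT have t: "t = (i, b)" "i < K" by (auto simp: T_def)
      show "t \<in> s ` T"
      proof (cases i)
        case 0
        then show ?thesis using t K by (intro image_eqI[of _ _ "(K - 1, b)"]) (auto simp: s_def T_def)
      next
        case (Suc l)
        then show ?thesis using t by (intro image_eqI[of _ _ "(l, b)"]) (auto simp: s_def T_def)
      qed
    qed
  qed
  have gm: "g t \<in> borel_measurable borel" for t
    unfolding g_def using f(1) measurable_compose[OF f(1) cnj_measurable] by auto
  have gn: "cmod (g t x) = cmod (f x)" for t x by (simp add: g_def)
  have g0: "(\<integral>x. g t x \<partial>law) = 0" for t
    unfolding g_def using f(3) Bochner_Integration.integral_cnj[of law f] by auto
  let ?W = "T \<rightarrow>\<^sub>E {..<n}"
  let ?x = "\<lambda>\<omega>. entry k A B f \<omega>"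
  have exp: "closed_walk_sum (?x \<omega>) n K * cnj (closed_walk_sum (?x \<omega>) n K) =
    (\<Sum>c\<in>?W. \<Prod>t\<in>T. entry k A B (g t) \<omega> (c t) (c (s t)))" if \<omega>: "\<omega> \<in> space M" for \<omega>
  proof -
    let ?w = "{..<K} \<rightarrow>\<^sub>E {..<n}"
    define enc where "enc c = (\<lambda>t\<in>{..<K}. c (t, True), \<lambda>t\<in>{..<K}. c (t, False))" for c :: "nat \<times> bool \<Rightarrow> nat"
    define dec where "dec = (\<lambda>(v, w). \<lambda>(t, b)\<in>T. if b then v t else (w t :: nat))"
    have "closed_walk_sum (?x \<omega>) n K * cnj (closed_walk_sum (?x \<omega>) n K) =
      (\<Sum>(v, w)\<in>?w \<times> ?w. (\<Prod>t<K. ?x \<omega> (v t) (v (Suc t mod K))) * cnj (\<Prod>t<K. ?x \<omega> (w t) (w (Suc t mod K))))"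
      unfolding closed_walk_sum_def cnj_sum sum_product sum.cartesian_product ..
    also have "\<dots> = (\<Sum>c\<in>?W. \<Prod>t\<in>T. entry k A B (g t) \<omega> (c t) (c (s t)))"
    proof (rule sum.reindex_bij_witness[of _ enc dec])
      fix p assume p: "p \<in> ?w \<times> ?w"
      obtain v w where vw: "p = (v, w)" by (cases p)
      have pv: "v \<in> ?w" "w \<in> ?w" using p vw by auto
      show "enc (dec p) = p"
        using pv unfolding vw enc_def dec_def by (auto simp: T_def PiE_iff extensional_def fun_eq_iff)
      show "dec p \<in> ?W"
        using pv unfolding vw dec_def by (auto simp: T_def PiE_iff)
      have c1: "dec p (t, True) = v t" "dec p (t, False) = w t" if "t < K" for t
        using that by (auto simp: T_def dec_def vw)
      have "(\<Prod>t\<in>T. entry k A B (g t) \<omega> (dec p t) (dec p (s t))) =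
        (\<Prod>t<K. \<Prod>b\<in>UNIV. entry k A B (g (t, b)) \<omega> (dec p (t, b)) (dec p (s (t, b))))"
        unfolding T_def by (subst prod.cartesian_product) (simp add: split_def)
      also have "\<dots> = (\<Prod>t<K. ?x \<omega> (v t) (v (Suc t mod K)) * cnj (?x \<omega> (w t) (w (Suc t mod K))))"
      proof (rule prod.cong[OF refl])
        fix t assume t: "t \<in> {..<K}"
        have t': "Suc t mod K < K" using K by simp
        have w: "w t < n" "w (Suc t mod K) < n" using pv(2) t t' by (auto simp: PiE_iff)
        show "(\<Prod>b\<in>UNIV. entry k A B (g (t, b)) \<omega> (dec p (t, b)) (dec p (s (t, b)))) =
          ?x \<omega> (v t) (v (Suc t mod K)) * cnj (?x \<omega> (w t) (w (Suc t mod K)))"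
          using t t' unfolding cnj_entry[OF \<omega> w] UNIV_bool
          by (simp add: g_def s_def c1 mult.commute)
      qed
      finally show "(\<Prod>t\<in>T. entry k A B (g t) \<omega> (dec p t) (dec p (s t))) =
        (case p of (v, w) \<Rightarrow> (\<Prod>t<K. ?x \<omega> (v t) (v (Suc t mod K))) * cnj (\<Prod>t<K. ?x \<omega> (w t) (w (Suc t mod K))))"
        unfolding vw by (simp add: prod.distrib)
    next
      fix c assume c: "c \<in> ?W"
      show "dec (enc c) = c"
        using c unfolding enc_def dec_def by (auto simp: T_def PiE_iff extensional_def fun_eq_iff)
      show "enc c \<in> ?w \<times> ?w"
        using c by (auto simp: T_def PiE_iff enc_def)
    qed
    finally show ?thesis .
  qed
  note B = expectation_word_bound[OF k law f(1,2,4) n T(1) sT T(2) gm gn g0]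
  have int: "integrable M (\<lambda>\<omega>. \<Sum>c\<in>?W. \<Prod>t\<in>T. entry k A B (g t) \<omega> (c t) (c (s t)))"
    by (intro Bochner_Integration.integrable_sum B(1))
  have int': "integrable M (\<lambda>\<omega>. closed_walk_sum (?x \<omega>) n K * cnj (closed_walk_sum (?x \<omega>) n K))"
    by (subst Bochner_Integration.integrable_cong[OF refl exp]) (auto intro: int)
  show "integrable M (\<lambda>\<omega>. (cmod (closed_walk_sum (?x \<omega>) n K))\<^sup>2)"
    unfolding cmod_sq_Re by (rule integrable_Re[OF int'])
  have "complex_of_real (expectation (\<lambda>\<omega>. (cmod (closed_walk_sum (?x \<omega>) n K))\<^sup>2)) =
    expectation (\<lambda>\<omega>. \<Sum>c\<in>?W. \<Prod>t\<in>T. entry k A B (g t) \<omega> (c t) (c (s t)))"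
    unfolding integral_mult_cnj_self[symmetric] by (rule Bochner_Integration.integral_cong[OF refl exp])
  also have "\<dots> = (\<Sum>c\<in>?W. expectation (\<lambda>\<omega>. \<Prod>t\<in>T. entry k A B (g t) \<omega> (c t) (c (s t))))"
    by (intro Bochner_Integration.integral_sum B(1))
  finally have e: "complex_of_real (expectation (\<lambda>\<omega>. (cmod (closed_walk_sum (?x \<omega>) n K))\<^sup>2)) =
    (\<Sum>c\<in>?W. expectation (\<lambda>\<omega>. \<Prod>t\<in>T. entry k A B (g t) \<omega> (c t) (c (s t))))" .
  have "expectation (\<lambda>\<omega>. (cmod (closed_walk_sum (?x \<omega>) n K))\<^sup>2) \<le>
    cmod (complex_of_real (expectation (\<lambda>\<omega>. (cmod (closed_walk_sum (?x \<omega>) n K))\<^sup>2)))" by simp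
  also have "\<dots> \<le> (\<Sum>c\<in>?W. cmod (expectation (\<lambda>\<omega>. \<Prod>t\<in>T. entry k A B (g t) \<omega> (c t) (c (s t)))))"
    unfolding e by (rule norm_sum)
  also have "\<dots> \<le> (\<Sum>c\<in>?W. if card (word_edges s T c) \<le> K
      then (1 / real n) ^ card (word_edges s T c) * (D\<^sup>2 / k) ^ (K - card (word_edges s T c)) else 0)"
    by (intro sum_mono B(2))
  also have "\<dots> \<le> 2 * real K ^ card T0 + real (2 * K + 1) * real (2 * K) ^ (2 * K) / n"
    by (rule sum_words_le[OF n T(1) sT T(2) T0(1) gen _ D]) auto
  finally show "expectation (\<lambda>\<omega>. (cmod (closed_walk_sum (?x \<omega>) n K))\<^sup>2) \<le>
      2 * (real K)\<^sup>2 + real (2 * K + 1) * real (2 * K) ^ (2 * K) / n"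
    unfolding T0(2) .
qed

end

subsection \<open>Measurability, truncation and the lower bound\<close>

lemma measurable_closed_walk_sum:
  assumes y: "\<And>i j. i < n \<Longrightarrow> j < n \<Longrightarrow> (\<lambda>\<omega>. y \<omega> i j) \<in> borel_measurable M"
  shows "(\<lambda>\<omega>. closed_walk_sum (y \<omega>) n k) \<in> borel_measurable M"
  unfolding closed_walk_sum_def
proof (intro borel_measurable_sum borel_measurable_prod y)
  fix w t assume w: "w \<in> {..<k} \<rightarrow>\<^sub>E {..<n}" and t: "t \<in> {..<k}"
  then have "Suc t mod k < k" by auto
  with w t show "w t < n" "w (Suc t mod k) < n" by (auto simp: PiE_iff)
qed

lemma measurable_minor_sum:
  assumes y: "\<And>i j. i < n \<Longrightarrow> j < n \<Longrightarrow> (\<lambda>\<omega>. y \<omega> i j) \<in> borel_measurable M"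
  shows "(\<lambda>\<omega>. minor_sum (y \<omega>) n k) \<in> borel_measurable M"
  unfolding minor_sum_def leibniz_def
proof (intro borel_measurable_sum borel_measurable_times borel_measurable_const borel_measurable_prod y)
  fix I \<sigma> i assume *: "I \<in> {I. I \<subseteq> {..<n} \<and> card I = k}" "\<sigma> \<in> {\<sigma>. \<sigma> permutes I}" "i \<in> I"
  then have "\<sigma> i \<in> I" by (simp add: permutes_in_image)
  then show "i < n" "\<sigma> i < n" using * by auto
qed

text \<open>Neither orders of roots nor the definite description are visibly measurable, so the
  countable criterion replaces both. Off the event the outlier is 0 by definition.\<close>

lemma measurable_eigenvalue_count_lambda_max:
  assumes y: "\<And>i j. i < n \<Longrightarrow> j < n \<Longrightarrow> (\<lambda>\<omega>. y \<omega> i j) \<in> borel_measurable M" and \<epsilon>: "0 < \<epsilon>"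
  defines "Y \<equiv> \<lambda>\<omega>. mat n n (\<lambda>(i, j). y \<omega> i j)"
  shows "{\<omega> \<in> space M. eigenvalue_count (Y \<omega>) (outer_spectrum \<epsilon> (Y \<omega>)) = 1} \<in> sets M"
    and "(\<lambda>\<omega>. lambda_max \<epsilon> (Y \<omega>)) \<in> borel_measurable M"
proof -
  obtain D :: "complex set" where D: "countable D" "\<And>X. open X \<Longrightarrow> X \<noteq> {} \<Longrightarrow> \<exists>d\<in>D. d \<in> X"
    using countable_dense_exists by blast
  define L where "L \<omega> = lim (\<lambda>k. closed_walk_sum (y \<omega>) n (Suc (Suc k)) / closed_walk_sum (y \<omega>) n (Suc k))" for \<omega>
  define p where "p \<omega> = poly (char_poly (Y \<omega>))" for \<omega>
  define G where "G = {\<omega> \<in> space M. eigenvalue_count (Y \<omega>) (outer_spectrum \<epsilon> (Y \<omega>)) = 1}"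
  have C: "eigenvalue_count (Y \<omega>) (outer_spectrum \<epsilon> (Y \<omega>)) = 1 \<longleftrightarrow> p \<omega> (L \<omega>) = 0 \<and> 1 + \<epsilon> \<le> cmod (L \<omega>) \<and>
      (\<exists>m. \<forall>z\<in>{z \<in> D. 1 + \<epsilon> \<le> cmod z}. 1 / real (Suc m) * cmod (z - L \<omega>) \<le> cmod (p \<omega> z))" for \<omega>
    unfolding Y_def L_def p_def by (rule eigenvalue_count_1_iff_countable(1)[OF D(2) \<epsilon> refl])
  have C': "lambda_max \<epsilon> (Y \<omega>) = L \<omega>" if "eigenvalue_count (Y \<omega>) (outer_spectrum \<epsilon> (Y \<omega>)) = 1" for \<omega>
    unfolding Y_def L_def by (rule eigenvalue_count_1_iff_countable(2)[OF D(2) \<epsilon> refl that[unfolded Y_def]])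
  have Lm [measurable]: "L \<in> borel_measurable M"
    unfolding L_def
    by (intro borel_measurable_lim_metric borel_measurable_divide measurable_closed_walk_sum y)
  have pm: "(\<lambda>\<omega>. p \<omega> (h \<omega>)) \<in> borel_measurable M" if [measurable]: "h \<in> borel_measurable M" for h
    unfolding p_def Y_def poly_char_poly_minor_sum
    by (intro borel_measurable_sum borel_measurable_times measurable_minor_sum y) measurable
  have [measurable]: "(\<lambda>\<omega>. p \<omega> (L \<omega>)) \<in> borel_measurable M" by (rule pm[OF Lm])
  have [measurable]: "(\<lambda>\<omega>. p \<omega> z) \<in> borel_measurable M" for z by (rule pm) simp
  have "G = {\<omega> \<in> space M. p \<omega> (L \<omega>) = 0} \<inter> {\<omega> \<in> space M. 1 + \<epsilon> \<le> cmod (L \<omega>)} \<inter>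
    {\<omega> \<in> space M. \<exists>m. \<forall>z\<in>{z \<in> D. 1 + \<epsilon> \<le> cmod z}. 1 / real (Suc m) * cmod (z - L \<omega>) \<le> cmod (p \<omega> z)}"
    unfolding G_def C by blast
  also have "\<dots> \<in> sets M"
  proof (intro sets.Int)
    show "{\<omega> \<in> space M. p \<omega> (L \<omega>) = 0} \<in> sets M" by measurable
    show "{\<omega> \<in> space M. 1 + \<epsilon> \<le> cmod (L \<omega>)} \<in> sets M" by measurable
    have "countable {z \<in> D. 1 + \<epsilon> \<le> cmod z}" using D(1) by (rule countable_subset[rotated]) auto
    then show "{\<omega> \<in> space M. \<exists>m. \<forall>z\<in>{z \<in> D. 1 + \<epsilon> \<le> cmod z}. 1 / real (Suc m) * cmod (z - L \<omega>) \<le> cmod (p \<omega> z)} \<in> sets M"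
      by (intro sets.sets_Collect_countable_Ex sets.sets_Collect_countable_Ball) measurable
  qed
  finally have G: "G \<in> sets M" .
  then show "{\<omega> \<in> space M. eigenvalue_count (Y \<omega>) (outer_spectrum \<epsilon> (Y \<omega>)) = 1} \<in> sets M"
    unfolding G_def .
  have "(\<lambda>\<omega>. if \<omega> \<in> G then L \<omega> else 0) \<in> borel_measurable M"
    using G by measurable
  moreover have "lambda_max \<epsilon> (Y \<omega>) = (if \<omega> \<in> G then L \<omega> else 0)" if "\<omega> \<in> space M" for \<omega>
  proof (cases "\<omega> \<in> G")
    case True
    then have "eigenvalue_count (Y \<omega>) (outer_spectrum \<epsilon> (Y \<omega>)) = 1" by (simp add: G_def)
    then show ?thesis using True C' by simp
  next
    case False
    then show ?thesis using that by (simp add: G_def lambda_max_def)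
  qed
  ultimately show "(\<lambda>\<omega>. lambda_max \<epsilon> (Y \<omega>)) \<in> borel_measurable M"
    by (subst measurable_cong) auto
qed

lemma (in prob_space) expectation_cmod_le:
  fixes Z :: "'a \<Rightarrow> complex"
  assumes i: "integrable M (\<lambda>\<omega>. (cmod (Z \<omega>))\<^sup>2)" and b: "expectation (\<lambda>\<omega>. (cmod (Z \<omega>))\<^sup>2) \<le> b\<^sup>2" "0 \<le> b"
  shows "integrable M (\<lambda>\<omega>. cmod (Z \<omega>))" and "expectation (\<lambda>\<omega>. cmod (Z \<omega>)) \<le> b"
proof -
  \<comment> \<open>No measurability of Z is assumed; that of its modulus is recovered from the
    integrable square.\<close>
  have "(\<lambda>\<omega>. sqrt ((cmod (Z \<omega>))\<^sup>2)) \<in> borel_measurable M"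
    using borel_measurable_integrable[OF i] by measurable
  then have m: "(\<lambda>\<omega>. cmod (Z \<omega>)) \<in> borel_measurable M" by simp
  show int: "integrable M (\<lambda>\<omega>. cmod (Z \<omega>))"
  proof (rule Bochner_Integration.integrable_bound)
    show "integrable M (\<lambda>\<omega>. 1 + (cmod (Z \<omega>))\<^sup>2)" using i by simp
    have "cmod (Z \<omega>) \<le> 1 + (cmod (Z \<omega>))\<^sup>2" for \<omega>
    proof -
      have "2 * cmod (Z \<omega>) \<le> (cmod (Z \<omega>))\<^sup>2 + 1" using sum_squares_bound[of "cmod (Z \<omega>)" 1] by simp
      then show ?thesis using norm_ge_zero[of "Z \<omega>"] by linarith
    qed
    then show "AE \<omega> in M. norm (cmod (Z \<omega>)) \<le> norm (1 + (cmod (Z \<omega>))\<^sup>2)" by simp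
  qed (rule m)
  have "(expectation (\<lambda>\<omega>. cmod (Z \<omega>)))\<^sup>2 \<le> expectation (\<lambda>\<omega>. (cmod (Z \<omega>))\<^sup>2)"
    using variance_positive[of "\<lambda>\<omega>. cmod (Z \<omega>)"] variance_eq[OF int i] by simp
  from power2_le_imp_le[OF order_trans[OF this b(1)] b(2)]
  show "expectation (\<lambda>\<omega>. cmod (Z \<omega>)) \<le> b" .
qed

text \<open>f is the cutoff t of x, recentred by its mean \<mu>, and \<theta> is the second moment
  of t. Because x is centered and x cnj t = |t|^2, the cross moment is exactly \<theta>, while
  recentring lowers the second moment of f to \<theta> - |\<mu>|^2. Dominated convergence brings
  \<theta> near 1.\<close>

lemma truncation_exists:
  fixes law :: "complex measure"
  assumes law: "prob_space law" "sets law = sets borel"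
    and i: "integrable law (\<lambda>x. x)" "(\<integral>x. x \<partial>law) = 0"
      "integrable law (\<lambda>x. (cmod x)\<^sup>2)" "(\<integral>x. (cmod x)\<^sup>2 \<partial>law) = 1"
    and \<eta>: "0 < \<eta>"
  obtains f D \<theta> where "f \<in> borel_measurable borel" "\<forall>x. cmod (f x) \<le> D" "(\<integral>x. f x \<partial>law) = 0"
    "(\<integral>x. x * cnj (f x) \<partial>law) = complex_of_real \<theta>" "(\<integral>x. (cmod (f x))\<^sup>2 \<partial>law) \<le> \<theta>"
    "1 - \<eta> \<le> \<theta>" "\<theta> \<le> (1::real)"
proof -
  interpret L: prob_space law by (rule law(1))
  have ml: "g \<in> borel_measurable law" if "g \<in> borel_measurable borel" for g :: "complex \<Rightarrow> 'z::topological_space"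
    using that law(2) by (simp cong: measurable_cong_sets)
  define t where "t d x = (if cmod x \<le> real d then x else 0)" for d :: nat and x :: complex
  have tm [measurable]: "t d \<in> borel_measurable borel" for d unfolding t_def[abs_def] by measurable
  define \<Theta> where "\<Theta> d = (\<integral>x. (cmod (t d x))\<^sup>2 \<partial>law)" for d
  have tb: "cmod (t d x) \<le> real d" for d x by (simp add: t_def)
  have ts: "(cmod (t d x))\<^sup>2 \<le> (cmod x)\<^sup>2" for d x by (simp add: t_def)
  have si: "integrable law (\<lambda>x. (cmod (t d x))\<^sup>2)" for d
    by (rule Bochner_Integration.integrable_bound[OF i(3)]) (use ts in \<open>auto intro!: ml\<close>)
  have "\<Theta> \<longlonglongrightarrow> (\<integral>x. (cmod x)\<^sup>2 \<partial>law)"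
    unfolding \<Theta>_def
  proof (rule integral_dominated_convergence[where w = "\<lambda>x. (cmod x)\<^sup>2"])
    show "AE x in law. (\<lambda>d. (cmod (t d x))\<^sup>2) \<longlonglongrightarrow> (cmod x)\<^sup>2"
    proof (rule AE_I2)
      fix x
      have "eventually (\<lambda>d. real d \<ge> cmod x) sequentially"
        using filterlim_real_sequentially by (auto simp: filterlim_at_top)
      then have "eventually (\<lambda>d. (cmod (t d x))\<^sup>2 = (cmod x)\<^sup>2) sequentially"
        by eventually_elim (simp add: t_def)
      then show "(\<lambda>d. (cmod (t d x))\<^sup>2) \<longlonglongrightarrow> (cmod x)\<^sup>2" by (rule tendsto_eventually)
    qed
  qed (use i(3) ts in \<open>auto intro!: ml\<close>)
  then have "eventually (\<lambda>d. 1 - \<eta> < \<Theta> d) sequentially"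
    using \<eta> unfolding i(4) by (intro order_tendstoD(1)) auto
  then obtain d where d: "1 - \<eta> < \<Theta> d" by (auto simp: eventually_sequentially)
  define \<mu> where "\<mu> = (\<integral>x. t d x \<partial>law)"
  define f where "f x = t d x - \<mu>" for x
  have ti: "integrable law (t d)"
    by (rule L.integrable_const_bound[of _ "real d"]) (use tb in \<open>auto intro!: ml\<close>)
  have fm: "f \<in> borel_measurable borel" unfolding f_def[abs_def] by measurable
  have \<mu>b: "cmod \<mu> \<le> real d"
  proof -
    have "cmod \<mu> \<le> (\<integral>x. cmod (t d x) \<partial>law)" unfolding \<mu>_def by (rule integral_norm_bound)
    also have "\<dots> \<le> (\<integral>x. real d \<partial>law)" using ti tb by (intro integral_mono) auto
    finally show ?thesis by (simp add: L.prob_space)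
  qed
  have fb: "cmod (f x) \<le> 2 * real d" for x
    using norm_triangle_ineq4[of "t d x" \<mu>] tb[of d x] \<mu>b by (simp add: f_def)
  have f0: "(\<integral>x. f x \<partial>law) = 0"
    unfolding f_def using ti by (simp add: \<mu>_def L.prob_space)
  have xt: "x * cnj (t d x) = complex_of_real ((cmod (t d x))\<^sup>2)" for x
    by (simp add: t_def mult_cnj_cmod del: of_real_power)
  have cross: "(\<integral>x. x * cnj (f x) \<partial>law) = complex_of_real (\<Theta> d)"
  proof -
    have "(\<integral>x. x * cnj (f x) \<partial>law) = (\<integral>x. complex_of_real ((cmod (t d x))\<^sup>2) - cnj \<mu> * x \<partial>law)"
      by (rule Bochner_Integration.integral_cong[OF refl]) (simp add: f_def right_diff_distrib xt mult.commute)
    also have "\<dots> = (\<integral>x. complex_of_real ((cmod (t d x))\<^sup>2) \<partial>law) - (\<integral>x. cnj \<mu> * x \<partial>law)"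
      using si i(1) by (intro Bochner_Integration.integral_diff) (auto simp del: of_real_power)
    also have "(\<integral>x. cnj \<mu> * x \<partial>law) = 0" using i by simp
    also have "(\<integral>x. complex_of_real ((cmod (t d x))\<^sup>2) \<partial>law) = complex_of_real (\<Theta> d)"
      unfolding \<Theta>_def by (rule integral_complex_of_real)
    finally show ?thesis by simp
  qed
  have f2: "(\<integral>x. (cmod (f x))\<^sup>2 \<partial>law) \<le> \<Theta> d"
  proof -
    have e: "(cmod (f x))\<^sup>2 = (cmod (t d x))\<^sup>2 - 2 * Re (cnj \<mu> * t d x) + (cmod \<mu>)\<^sup>2" for x
      unfolding f_def cmod_power2 by (simp add: power2_eq_square algebra_simps)
    have ri: "integrable law (\<lambda>x. Re (cnj \<mu> * t d x))" using ti by simp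
    have "(\<integral>x. Re (cnj \<mu> * t d x) \<partial>law) = Re (cnj \<mu> * \<mu>)"
      using ti integral_Re[of law "\<lambda>x. cnj \<mu> * t d x"] by (simp add: \<mu>_def)
    also have "\<dots> = (cmod \<mu>)\<^sup>2" by (simp only: cmod_sq_Re mult.commute)
    finally have "(\<integral>x. (cmod (f x))\<^sup>2 \<partial>law) = \<Theta> d - 2 * (cmod \<mu>)\<^sup>2 + (cmod \<mu>)\<^sup>2"
      unfolding e using si ri by (simp add: \<Theta>_def L.prob_space del: Re_complex_of_real times_complex.sel)
    then show ?thesis by simp
  qed
  have "\<Theta> d \<le> 1"
    unfolding \<Theta>_def i(4)[symmetric] by (intro integral_mono si i(3) ts)
  then show thesis using that[of f "2 * real d" "\<Theta> d"] fm fb f0 cross f2 d by auto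
qed

lemma rev_char_norm_le:
  assumes "cmod z \<le> R"
  shows "cmod (rev_char x n z) \<le> (\<Sum>m\<le>n. R ^ m * cmod (minor_sum x n m))"
    and "cmod (rev_char x n z - rev_char y n z) \<le> (\<Sum>m\<le>n. R ^ m * cmod (minor_sum x n m - minor_sum y n m))"
proof -
  have *: "cmod ((- z) ^ m * c) \<le> R ^ m * cmod c" for m c
    unfolding norm_mult norm_power norm_minus_cancel
    using assms by (intro mult_right_mono power_mono) auto
  show "cmod (rev_char x n z) \<le> (\<Sum>m\<le>n. R ^ m * cmod (minor_sum x n m))"
    unfolding rev_char_def by (rule sum_norm_le) (rule *)
  show "cmod (rev_char x n z - rev_char y n z) \<le> (\<Sum>m\<le>n. R ^ m * cmod (minor_sum x n m - minor_sum y n m))"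
    unfolding rev_char_def sum_subtractf[symmetric] right_diff_distrib[symmetric]
    by (rule sum_norm_le) (rule *)
qed

text \<open>The traces of the truncated matrix x' give exp (- b) / 2 for its polynomial; half of
  this is given up to the error of replacing x' by x.\<close>

lemma rev_char_lower_bound:
  assumes r: "0 \<le> r" "r < R"
    and a: "(\<Sum>m\<le>n. R ^ m * cmod (minor_sum x' n m)) \<le> a"
    and b: "(\<Sum>m=1..m0. R ^ m / m * cmod (closed_walk_sum x' n m)) \<le> b"
    and m0: "(a * exp b + 1) * (r / R) ^ Suc m0 \<le> 1 / 2"
    and d: "(\<Sum>m\<le>n. R ^ m * cmod (minor_sum x n m - minor_sum x' n m)) \<le> exp (- b) / 4"
    and z: "cmod z \<le> r"
  shows "exp (- b) / 4 \<le> cmod (rev_char x n z)"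
proof -
  obtain es where es: "char_poly (mat n n (\<lambda>(i, j). x' i j)) = (\<Prod>e\<leftarrow>es. [:- e, 1:])"
    "\<forall>z. rev_char x' n z = (\<Prod>e\<leftarrow>es. 1 - e * z)"
    "\<forall>k>0. closed_walk_sum x' n k = (\<Sum>e\<leftarrow>es. e ^ k)"
    by (rule eigenvalue_list[OF refl])
  have "exp (- b) / 2 \<le> cmod (\<Prod>e\<leftarrow>es. 1 - e * z)"
  proof (rule prod_linear_lower_bound[OF r _ _ m0 z])
    fix w assume w: "cmod w \<le> R"
    show "cmod (\<Prod>e\<leftarrow>es. 1 - e * w) \<le> a"
      using rev_char_norm_le(1)[OF w, of x' n] a es(2) by simp
    have "cmod (\<Sum>k=1..m0. w ^ k / of_nat k * (\<Sum>e\<leftarrow>es. e ^ k)) \<le> (\<Sum>k=1..m0. R ^ k / k * cmod (closed_walk_sum x' n k))"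
    proof (rule sum_norm_le)
      fix k assume k: "k \<in> {1..m0}"
      have e: "(\<Sum>e\<leftarrow>es. e ^ k) = closed_walk_sum x' n k" using es(3) k by simp
      show "cmod (w ^ k / of_nat k * (\<Sum>e\<leftarrow>es. e ^ k)) \<le> R ^ k / k * cmod (closed_walk_sum x' n k)"
        unfolding e norm_mult norm_divide norm_power norm_of_nat
        using w by (intro mult_right_mono divide_right_mono power_mono) auto
    qed
    then show "cmod (\<Sum>k=1..m0. w ^ k / of_nat k * (\<Sum>e\<leftarrow>es. e ^ k)) \<le> b" using b by linarith
  qed
  moreover have "cmod (rev_char x n z - rev_char x' n z) \<le> exp (- b) / 4"
    using rev_char_norm_le(2)[of z R x n x'] z r d by linarith
  ultimately show ?thesis
    using norm_triangle_sub[of "rev_char x' n z" "rev_char x n z"] es(2)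
    by (simp add: norm_minus_commute)
qed

lemma deviation_norm_le:
  assumes z: "cmod z \<le> R"
  shows "cmod (\<Sum>m\<le>n. (- z) ^ Suc m * (off_sum x u w n m - diag_sum x u w n m)) \<le>
    (\<Sum>m\<le>n. R ^ Suc m * (cmod (off_sum x u w n m) + cmod (diag_sum x u w n m)))"
proof (rule sum_norm_le)
  fix m
  have R: "0 \<le> R" using z norm_ge_zero order_trans by blast
  show "cmod ((- z) ^ Suc m * (off_sum x u w n m - diag_sum x u w n m)) \<le>
    R ^ Suc m * (cmod (off_sum x u w n m) + cmod (diag_sum x u w n m))"
    unfolding norm_mult norm_power norm_minus_cancel
    using z R by (intro mult_mono power_mono norm_triangle_ineq4) auto
qed

text \<open>Every weighted mean below grows at most linearly in the degree, so this single constant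
  dominates all the coefficient series, uniformly in n.\<close>

lemma geometric_deriv_partial_le:
  fixes R :: real
  assumes "0 \<le> R" "R < 1"
  shows "(\<Sum>m\<le>n. real (Suc m) * R ^ m) \<le> 1 / (1 - R)\<^sup>2"
proof -
  have s: "(\<lambda>n. of_nat (Suc n) * R ^ n) sums (1 / (1 - R)\<^sup>2)" using assms by (intro geometric_deriv_sums) auto
  have "(\<Sum>m\<in>{..n}. real (Suc m) * R ^ m) \<le> (\<Sum>m. real (Suc m) * R ^ m)"
    using s assms by (intro sum_le_suminf) (auto simp: sums_iff)
  then show ?thesis using s by (simp add: sums_iff)
qed

subsection \<open>Convergence in probability\<close>

lemma (in prob_space) markov_gt:
  assumes u: "integrable M u" "\<And>\<omega>. 0 \<le> u \<omega>" and e: "expectation u \<le> c" and a: "0 < (a::real)"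
  shows "{\<omega> \<in> space M. a < u \<omega>} \<in> sets M" "prob {\<omega> \<in> space M. a < u \<omega>} \<le> c / a"
proof -
  have [measurable]: "u \<in> borel_measurable M" using u(1) by (rule borel_measurable_integrable)
  show "{\<omega> \<in> space M. a < u \<omega>} \<in> sets M" by measurable
  have "prob {\<omega> \<in> space M. a < u \<omega>} \<le> prob {\<omega> \<in> space M. a \<le> u \<omega>}"
    by (intro finite_measure_mono) (auto, measurable)
  also have "\<dots> \<le> expectation u / a"
    using u a by (intro integral_Markov_inequality_measure[where A = "{}"]) auto
  also have "\<dots> \<le> c / a" using e a by (intro divide_right_mono) auto
  finally show "prob {\<omega> \<in> space M. a < u \<omega>} \<le> c / a" .
qed

lemma (in prob_space) expectation_weighted_sum_le:
  fixes Z :: "'i \<Rightarrow> 'a \<Rightarrow> real"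
  assumes "\<And>m. m \<in> I \<Longrightarrow> integrable M (Z m)" "\<And>m. m \<in> I \<Longrightarrow> expectation (Z m) \<le> c m"
    and "\<And>m. m \<in> I \<Longrightarrow> 0 \<le> w m"
  shows "integrable M (\<lambda>\<omega>. \<Sum>m\<in>I. w m * Z m \<omega>)" "expectation (\<lambda>\<omega>. \<Sum>m\<in>I. w m * Z m \<omega>) \<le> (\<Sum>m\<in>I. w m * c m)"
proof -
  have i: "integrable M (\<lambda>\<omega>. w m * Z m \<omega>)" if "m \<in> I" for m using assms(1)[OF that] by simp
  show "integrable M (\<lambda>\<omega>. \<Sum>m\<in>I. w m * Z m \<omega>)"
    by (rule Bochner_Integration.integrable_sum[OF i])
  have "expectation (\<lambda>\<omega>. \<Sum>m\<in>I. w m * Z m \<omega>) = (\<Sum>m\<in>I. expectation (\<lambda>\<omega>. w m * Z m \<omega>))"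
    by (rule Bochner_Integration.integral_sum[OF i])
  also have "\<dots> = (\<Sum>m\<in>I. w m * expectation (Z m))" by simp
  also have "\<dots> \<le> (\<Sum>m\<in>I. w m * c m)"
    using assms(2,3) by (intro sum_mono mult_left_mono)
  finally show "expectation (\<lambda>\<omega>. \<Sum>m\<in>I. w m * Z m \<omega>) \<le> (\<Sum>m\<in>I. w m * c m)" .
qed

text \<open>Markov's inequality for four random sums: coefficients and traces of the truncated
  matrix (\<open>Q\<close>, \<open>S\<close>), the truncation error (\<open>Df\<close>) and the
  deviation from the factored determinant (\<open>Er\<close>), the latter with the original entries.
  Each bounds its polynomial on a whole disc at once, so no union over z is needed.\<close>

lemma (in sparse_iid_model) good_event:
  fixes u w :: "nat \<Rightarrow> complex"
  defines "V \<equiv> (\<Sum>j<n. (cmod (u j))\<^sup>2) * (\<Sum>j<n. (cmod (w j))\<^sup>2)"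
    and "x \<equiv> entry k A B (\<lambda>x. x)"
  assumes k: "0 < k" "0 < n" and law: "prob_space law" "sets law = sets borel"
    and id: "centered law (\<lambda>x. x)" "(\<integral>x. (cmod x)\<^sup>2 \<partial>law) = 1"
    and f: "f \<in> borel_measurable borel" "\<And>x. cmod (f x) \<le> D" "(\<integral>x. f x \<partial>law) = 0"
      "(\<integral>x. x * cnj (f x) \<partial>law) = complex_of_real \<theta>" "(\<integral>x. (cmod (f x))\<^sup>2 \<partial>law) \<le> \<theta>" "\<theta> \<le> 1"
    and D: "D\<^sup>2 / k \<le> 1 / 2"
    and r: "0 \<le> r" "r < R" "R < 1"
    and m0: "(a * exp b + 1) * (r / R) ^ Suc m0 \<le> 1 / 2"
    and n: "\<And>m. m \<in> {1..m0} \<Longrightarrow> real (2 * m + 1) * real (2 * m) ^ (2 * m) / n \<le> 2 * (real m)\<^sup>2"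
    and pos: "0 < a" "0 < b" "0 < d"
  defines "G \<equiv> 1 / (1 - R)\<^sup>2"
  obtains E where "E \<in> sets M"
    "1 - (G / a + 2 * G / b + sqrt (1 - \<theta>) * G / (exp (- b) / 4) + 2 * sqrt V / sqrt n * G / d) \<le> prob E"
    "\<And>\<omega> z. \<omega> \<in> E \<Longrightarrow> cmod z \<le> r \<Longrightarrow> exp (- b) / 4 \<le> cmod (rev_char (x \<omega>) n z)"
    "\<And>\<omega> z. \<omega> \<in> E \<Longrightarrow> cmod z \<le> r \<Longrightarrow>
      cmod (\<Sum>m\<le>n. (- z) ^ Suc m * (off_sum (x \<omega>) u w n m - diag_sum (x \<omega>) u w n m)) \<le> d"
proof -
  interpret L: prob_space law by (rule law(1))
  define x' where "x' = entry k A B f"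
  have R: "0 < R" using r by simp
  have cf: "centered law f"
    unfolding centered_def
  proof (intro conjI f(1,3))
    have fl: "f \<in> borel_measurable law" using f(1) law(2) by (simp cong: measurable_cong_sets)
    show "integrable law f"
      by (rule L.integrable_const_bound[of _ D, OF _ fl]) (simp add: f(2))
    show "integrable law (\<lambda>x. (cmod (f x))\<^sup>2)"
    proof (rule L.integrable_const_bound[of _ "D\<^sup>2"])
      have "(cmod (f x))\<^sup>2 \<le> D\<^sup>2" for x by (intro power_mono f(2)) simp
      then show "AE x in law. norm ((cmod (f x))\<^sup>2) \<le> D\<^sup>2" by simp
      show "(\<lambda>x. (cmod (f x))\<^sup>2) \<in> borel_measurable law" using fl by measurable
    qed
  qed
  have t1: "(\<integral>x. (cmod (f x))\<^sup>2 \<partial>law) \<le> 1" using f(5,6) by linarith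
  have V: "0 \<le> V" unfolding V_def by (intro mult_nonneg_nonneg sum_nonneg) auto
  have G0: "(\<Sum>m\<le>n. real (Suc m) * R ^ m) \<le> G" for n
    unfolding G_def using geometric_deriv_partial_le[of R n] r R by simp
  define Q where "Q \<omega> = (\<Sum>m\<le>n. R ^ m * cmod (minor_sum (x' \<omega>) n m))" for \<omega>
  define S where "S \<omega> = (\<Sum>m=1..m0. R ^ m / m * cmod (closed_walk_sum (x' \<omega>) n m))" for \<omega>
  define Df where "Df \<omega> = (\<Sum>m\<le>n. R ^ m * cmod (minor_sum (x \<omega>) n m - minor_sum (x' \<omega>) n m))" for \<omega>
  define Er where "Er \<omega> = (\<Sum>m\<le>n. R ^ Suc m * (cmod (off_sum (x \<omega>) u w n m) + cmod (diag_sum (x \<omega>) u w n m)))" for \<omega>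
  have Qi: "integrable M Q" "expectation Q \<le> G"
  proof -
    have 1: "integrable M (\<lambda>\<omega>. cmod (minor_sum (x' \<omega>) n m))" "expectation (\<lambda>\<omega>. cmod (minor_sum (x' \<omega>) n m)) \<le> 1" for m
      using expectation_cmod_le[OF minor_sum_second_moment(1)[OF k cf t1, of m], of 1]
        minor_sum_second_moment(2)[OF k cf t1, of m] by (auto simp: x'_def)
    note * = expectation_weighted_sum_le[of "{..n}" "\<lambda>m \<omega>. cmod (minor_sum (x' \<omega>) n m)" "\<lambda>_. 1" "\<lambda>m. R ^ m", OF 1]
    show "integrable M Q" unfolding Q_def using R by (intro *) auto
    have "expectation Q \<le> (\<Sum>m\<le>n. R ^ m * 1)" unfolding Q_def using R by (intro *) auto
    also have "\<dots> \<le> (\<Sum>m\<le>n. real (Suc m) * R ^ m)" using R by (intro sum_mono) auto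
    finally show "expectation Q \<le> G" using G0[of n] by linarith
  qed
  have Si: "integrable M S" "expectation S \<le> 2 * G"
  proof -
    have 1: "integrable M (\<lambda>\<omega>. cmod (closed_walk_sum (x' \<omega>) n m))"
      "expectation (\<lambda>\<omega>. cmod (closed_walk_sum (x' \<omega>) n m)) \<le> 2 * real m" if m: "m \<in> {1..m0}" for m
    proof -
      have "0 < m" using m by simp
      note C = closed_walk_sum_second_moment[OF k(1) law f(1,2,3) t1 k(2) this D]
      \<comment> \<open>The condition on n makes the term in 1 / n at most 2 m^2, for a total of 4
        m^2. The resulting mean 2 m is then cancelled by the weight 1 / m in
        \<open>S\<close>.\<close>
      have "expectation (\<lambda>\<omega>. (cmod (closed_walk_sum (x' \<omega>) n m))\<^sup>2) \<le> (2 * real m)\<^sup>2"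
        using C(2) n[OF m] unfolding x'_def by (simp add: power_mult_distrib)
      with expectation_cmod_le[OF C(1), of "2 * real m"]
      show "integrable M (\<lambda>\<omega>. cmod (closed_walk_sum (x' \<omega>) n m))"
        "expectation (\<lambda>\<omega>. cmod (closed_walk_sum (x' \<omega>) n m)) \<le> 2 * real m" by (auto simp: x'_def)
    qed
    note * = expectation_weighted_sum_le[of "{1..m0}" "\<lambda>m \<omega>. cmod (closed_walk_sum (x' \<omega>) n m)" "\<lambda>m. 2 * real m" "\<lambda>m. R ^ m / m", OF 1]
    show "integrable M S" unfolding S_def using R by (intro *) auto
    have "expectation S \<le> (\<Sum>m=1..m0. R ^ m / m * (2 * real m))" unfolding S_def using R by (intro *) auto
    also have "\<dots> \<le> (\<Sum>m=1..m0. 2 * (real (Suc m) * R ^ m))"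
    proof (rule sum_mono)
      fix m assume "m \<in> {1..m0}"
      then have "R ^ m / m * (2 * real m) = 2 * (1 * R ^ m)" by simp
      also have "\<dots> \<le> 2 * (real (Suc m) * R ^ m)" using R by (intro mult_left_mono mult_right_mono) auto
      finally show "R ^ m / m * (2 * real m) \<le> 2 * (real (Suc m) * R ^ m)" .
    qed
    also have "\<dots> \<le> (\<Sum>m\<le>m0. 2 * (real (Suc m) * R ^ m))"
      using R by (intro sum_mono2) auto
    also have "\<dots> \<le> 2 * G" unfolding sum_distrib_left[symmetric] using G0[of m0] by simp
    finally show "expectation S \<le> 2 * G" .
  qed
  have Di: "integrable M Df" "expectation Df \<le> sqrt (1 - \<theta>) * G"
  proof -
    have 1: "integrable M (\<lambda>\<omega>. cmod (minor_sum (x \<omega>) n m - minor_sum (x' \<omega>) n m))"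
      "expectation (\<lambda>\<omega>. cmod (minor_sum (x \<omega>) n m - minor_sum (x' \<omega>) n m)) \<le> real (Suc m) * sqrt (1 - \<theta>)" for m
    proof -
      note C = minor_sum_diff_second_moment[OF k id(1) cf id(2) f(4,5,6), of m]
      have "real m * (1 - \<theta>) \<le> (real (Suc m))\<^sup>2 * (1 - \<theta>)"
        using f(6) by (intro mult_right_mono) (auto simp: power2_eq_square algebra_simps)
      then have "expectation (\<lambda>\<omega>. (cmod (minor_sum (x \<omega>) n m - minor_sum (x' \<omega>) n m))\<^sup>2) \<le> (real (Suc m) * sqrt (1 - \<theta>))\<^sup>2"
        using C(2) f(6) unfolding x_def x'_def power_mult_distrib by simp
      with expectation_cmod_le[OF C(1), of "real (Suc m) * sqrt (1 - \<theta>)"] f(6)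
      show "integrable M (\<lambda>\<omega>. cmod (minor_sum (x \<omega>) n m - minor_sum (x' \<omega>) n m))"
        "expectation (\<lambda>\<omega>. cmod (minor_sum (x \<omega>) n m - minor_sum (x' \<omega>) n m)) \<le> real (Suc m) * sqrt (1 - \<theta>)"
        by (auto simp: x_def x'_def)
    qed
    note * = expectation_weighted_sum_le[of "{..n}" "\<lambda>m \<omega>. cmod (minor_sum (x \<omega>) n m - minor_sum (x' \<omega>) n m)"
        "\<lambda>m. real (Suc m) * sqrt (1 - \<theta>)" "\<lambda>m. R ^ m", OF 1]
    show "integrable M Df" unfolding Df_def using R by (intro *) auto
    have "expectation Df \<le> (\<Sum>m\<le>n. R ^ m * (real (Suc m) * sqrt (1 - \<theta>)))" unfolding Df_def using R by (intro *) auto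
    also have "\<dots> = sqrt (1 - \<theta>) * (\<Sum>m\<le>n. real (Suc m) * R ^ m)"
      unfolding sum_distrib_left by (intro sum.cong refl) (simp only: mult_ac)
    also have "\<dots> \<le> sqrt (1 - \<theta>) * G" using G0[of n] f(6) by (intro mult_left_mono) auto
    finally show "expectation Df \<le> sqrt (1 - \<theta>) * G" .
  qed
  have Ei: "integrable M Er" "expectation Er \<le> 2 * sqrt V / sqrt n * G"
  proof -
    define q where "q = sqrt V / sqrt n"
    have q: "0 \<le> q" "q\<^sup>2 = V / n" using V by (auto simp: q_def power_divide)
    have 1: "integrable M (\<lambda>\<omega>. cmod (off_sum (x \<omega>) u w n m))" "expectation (\<lambda>\<omega>. cmod (off_sum (x \<omega>) u w n m)) \<le> real (Suc m) * q" for m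
    proof -
      note C = off_sum_second_moment[OF k id(1) eq_refl[OF id(2)], of u w m, folded V_def x_def]
      have "real m / n * V = real m * q\<^sup>2" by (simp add: q)
      also have "\<dots> \<le> (real (Suc m))\<^sup>2 * q\<^sup>2"
        by (intro mult_right_mono) (auto simp: power2_eq_square algebra_simps)
      finally have "expectation (\<lambda>\<omega>. (cmod (off_sum (x \<omega>) u w n m))\<^sup>2) \<le> (real (Suc m) * q)\<^sup>2"
        using C(2) unfolding power_mult_distrib by linarith
      with expectation_cmod_le[OF C(1), of "real (Suc m) * q"] q(1)
      show "integrable M (\<lambda>\<omega>. cmod (off_sum (x \<omega>) u w n m))" "expectation (\<lambda>\<omega>. cmod (off_sum (x \<omega>) u w n m)) \<le> real (Suc m) * q"
        by auto
    qed
    have 2: "integrable M (\<lambda>\<omega>. cmod (diag_sum (x \<omega>) u w n m))" "expectation (\<lambda>\<omega>. cmod (diag_sum (x \<omega>) u w n m)) \<le> real (Suc m) * q" for m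
    proof -
      note C = diag_sum_second_moment[OF k id(1) eq_refl[OF id(2)], of u w m, folded V_def x_def]
      have "(real m)\<^sup>2 / n * V = (real m)\<^sup>2 * q\<^sup>2" by (simp add: q)
      also have "\<dots> \<le> (real (Suc m))\<^sup>2 * q\<^sup>2"
        by (intro mult_right_mono power_mono) auto
      finally have "expectation (\<lambda>\<omega>. (cmod (diag_sum (x \<omega>) u w n m))\<^sup>2) \<le> (real (Suc m) * q)\<^sup>2"
        using C(2) unfolding power_mult_distrib by linarith
      with expectation_cmod_le[OF C(1), of "real (Suc m) * q"] q(1)
      show "integrable M (\<lambda>\<omega>. cmod (diag_sum (x \<omega>) u w n m))" "expectation (\<lambda>\<omega>. cmod (diag_sum (x \<omega>) u w n m)) \<le> real (Suc m) * q"
        by auto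
    qed
    have 3: "integrable M (\<lambda>\<omega>. cmod (off_sum (x \<omega>) u w n m) + cmod (diag_sum (x \<omega>) u w n m))"
      "expectation (\<lambda>\<omega>. cmod (off_sum (x \<omega>) u w n m) + cmod (diag_sum (x \<omega>) u w n m)) \<le> real (Suc m) * (2 * q)" for m
    proof -
      show "integrable M (\<lambda>\<omega>. cmod (off_sum (x \<omega>) u w n m) + cmod (diag_sum (x \<omega>) u w n m))"
        by (rule Bochner_Integration.integrable_add[OF 1(1) 2(1)])
      show "expectation (\<lambda>\<omega>. cmod (off_sum (x \<omega>) u w n m) + cmod (diag_sum (x \<omega>) u w n m)) \<le> real (Suc m) * (2 * q)"
        unfolding Bochner_Integration.integral_add[OF 1(1) 2(1)] using add_mono[OF 1(2)[of m] 2(2)[of m]] by (simp only: mult_2 distrib_left)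
    qed
    note * = expectation_weighted_sum_le[of "{..n}" "\<lambda>m \<omega>. cmod (off_sum (x \<omega>) u w n m) + cmod (diag_sum (x \<omega>) u w n m)"
        "\<lambda>m. real (Suc m) * (2 * q)" "\<lambda>m. R ^ Suc m", OF 3]
    show "integrable M Er" unfolding Er_def using R by (intro *) auto
    have "expectation Er \<le> (\<Sum>m\<le>n. R ^ Suc m * (real (Suc m) * (2 * q)))" unfolding Er_def using R by (intro *) auto
    also have "\<dots> \<le> (\<Sum>m\<le>n. R ^ m * (real (Suc m) * (2 * q)))"
      using r R q by (intro sum_mono mult_right_mono power_decreasing) auto
    also have "\<dots> = 2 * q * (\<Sum>m\<le>n. real (Suc m) * R ^ m)"
      unfolding sum_distrib_left by (intro sum.cong refl) (simp only: mult_ac)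
    also have "\<dots> \<le> 2 * q * G" using G0[of n] q by (intro mult_left_mono) auto
    finally show "expectation Er \<le> 2 * sqrt V / sqrt n * G" by (simp add: q_def)
  qed
  have nn: "0 \<le> Q \<omega>" "0 \<le> S \<omega>" "0 \<le> Df \<omega>" "0 \<le> Er \<omega>" for \<omega>
    unfolding Q_def S_def Df_def Er_def using R by (auto intro!: sum_nonneg)
  define c where "c = exp (- b) / 4"
  have c: "0 < c" by (simp add: c_def)
  note MQ = markov_gt[OF Qi(1) nn(1) Qi(2) pos(1)]
  note MS = markov_gt[OF Si(1) nn(2) Si(2) pos(2)]
  note MD = markov_gt[OF Di(1) nn(3) Di(2) c]
  note ME = markov_gt[OF Ei(1) nn(4) Ei(2) pos(3)]
  define Bad where "Bad = ({\<omega> \<in> space M. a < Q \<omega>} \<union> {\<omega> \<in> space M. b < S \<omega>}) \<union> ({\<omega> \<in> space M. c < Df \<omega>} \<union> {\<omega> \<in> space M. d < Er \<omega>})"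
  have Bm: "Bad \<in> sets M" unfolding Bad_def by (intro sets.Un MQ(1) MS(1) MD(1) ME(1))
  have "prob Bad \<le> (prob {\<omega> \<in> space M. a < Q \<omega>} + prob {\<omega> \<in> space M. b < S \<omega>}) + (prob {\<omega> \<in> space M. c < Df \<omega>} + prob {\<omega> \<in> space M. d < Er \<omega>})"
    unfolding Bad_def
    by (rule order_trans[OF measure_Un_le add_mono])
      (intro sets.Un measure_Un_le MQ(1) MS(1) MD(1) ME(1))+
  also have "\<dots> \<le> (G / a + 2 * G / b) + (sqrt (1 - \<theta>) * G / c + 2 * sqrt V / sqrt n * G / d)"
    unfolding c_def by (intro add_mono MQ(2) MS(2) MD(2)[unfolded c_def] ME(2))
  finally have PB: "prob Bad \<le> (G / a + 2 * G / b) + (sqrt (1 - \<theta>) * G / c + 2 * sqrt V / sqrt n * G / d)" .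
  show thesis
  proof (rule that[of "space M - Bad"])
    show "space M - Bad \<in> sets M" using Bm by auto
    show "1 - (G / a + 2 * G / b + sqrt (1 - \<theta>) * G / (exp (- b) / 4) + 2 * sqrt V / sqrt n * G / d) \<le> prob (space M - Bad)"
      unfolding prob_compl[OF Bm] c_def[symmetric] using PB by linarith
    fix \<omega> z assume \<omega>: "\<omega> \<in> space M - Bad" and z: "cmod z \<le> r"
    have le: "Q \<omega> \<le> a" "S \<omega> \<le> b" "Df \<omega> \<le> exp (- b) / 4" "Er \<omega> \<le> d"
      using \<omega> by (auto simp: Bad_def not_less c_def)
    show "exp (- b) / 4 \<le> cmod (rev_char (x \<omega>) n z)"
      by (rule rev_char_lower_bound[OF r(1,2) le(1)[unfolded Q_def] le(2)[unfolded S_def] m0 le(3)[unfolded Df_def] z])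
    have "cmod z \<le> R" using z r by simp
    from deviation_norm_le[OF this, where n = n and x = "x \<omega>" and u = u and w = w]
    show "cmod (\<Sum>m\<le>n. (- z) ^ Suc m * (off_sum (x \<omega>) u w n m - diag_sum (x \<omega>) u w n m)) \<le> d"
      using le(4) unfolding Er_def by linarith
  qed
qed

section \<open>Translation to vectors and matrices, and the limit theorem\<close>

lemma hinner_sum:
  assumes "u \<in> carrier_vec n" "v \<in> carrier_vec n"
  shows "hinner v u = (\<Sum>j<n. u $ j * cnj (v $ j))"
  using assms unfolding hinner_def scalar_prod_def by (auto simp: atLeast0LessThan intro!: sum.cong)

lemma vnorm_sq: "v \<in> carrier_vec n \<Longrightarrow> (vnorm v)\<^sup>2 = (\<Sum>j<n. (cmod (v $ j))\<^sup>2)"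
  unfolding vnorm_def by (auto simp: sum_nonneg)

lemma vnorm_nonneg: "0 \<le> vnorm v"
  unfolding vnorm_def by (auto intro: sum_nonneg)

lemma cmod_hinner_le:
  assumes "u \<in> carrier_vec n" "v \<in> carrier_vec n"
  shows "cmod (hinner v u) \<le> vnorm u * vnorm v"
proof -
  have "(cmod (hinner v u))\<^sup>2 \<le> (\<Sum>j<n. cmod (u $ j) * cmod (v $ j))\<^sup>2"
    unfolding hinner_sum[OF assms]
    by (intro power_mono) (auto simp: norm_mult intro!: sum_norm_le)
  also have "\<dots> \<le> (\<Sum>j<n. (cmod (u $ j))\<^sup>2) * (\<Sum>j<n. (cmod (v $ j))\<^sup>2)"
    by (rule Cauchy_Schwarz_ineq_sum)
  also have "\<dots> = (vnorm u * vnorm v)\<^sup>2"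
    by (simp add: power_mult_distrib vnorm_sq[OF assms(1)] vnorm_sq[OF assms(2)])
  finally show ?thesis
    by (rule power2_le_imp_le) (simp add: vnorm_nonneg)
qed

lemma deformed_mat_eq:
  assumes "u \<in> carrier_vec n" "v \<in> carrier_vec n"
  shows "sparse_mat n k A B \<omega> + rank_one u v =
    mat n n (\<lambda>(i, j). entry k A B (\<lambda>x. x) \<omega> i j + u $ i * cnj (v $ j))"
  using assms unfolding sparse_mat_def rank_one_def entry_def by (intro eq_matI) auto

lemma eventually_real_ge: "eventually (\<lambda>n. c \<le> real n) sequentially"
  using filterlim_real_sequentially by (auto simp: filterlim_at_top)

theorem corollary1p5:
  fixes P :: "'b measure" and \<chi> :: "'b \<Rightarrow> complex"
    and M :: "nat \<Rightarrow> 'a measure"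
    and A B :: "nat \<Rightarrow> nat \<Rightarrow> nat \<Rightarrow> 'a \<Rightarrow> complex"
    and K :: "nat \<Rightarrow> nat"
    and u v :: "nat \<Rightarrow> complex vec"
    and Y :: "nat \<Rightarrow> 'a \<Rightarrow> complex mat"
    and C \<epsilon> :: real
  assumes "prob_space P" and "\<chi> \<in> borel_measurable P"
    and "integrable P \<chi>" and "(\<integral>x. \<chi> x \<partial>P) = 0"
    and "integrable P (\<lambda>x. (cmod (\<chi> x))\<^sup>2)" and "(\<integral>x. (cmod (\<chi> x))\<^sup>2 \<partial>P) = 1"
    and "\<And>n. n \<ge> 1 \<Longrightarrow> 0 < K n \<and> K n \<le> n"
    and "\<And>n. n \<ge> 1 \<Longrightarrow> sparse_iid_model (M n) n (K n) (distr P borel \<chi>) (A n) (B n)"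
    and "\<And>n. n \<ge> 1 \<Longrightarrow> u n \<in> carrier_vec n \<and> v n \<in> carrier_vec n"
    and Y: "\<And>n \<omega>. Y n \<omega> = sparse_mat n (K n) (A n) (B n) \<omega> + rank_one (u n) (v n)"
    and "filterlim K at_top sequentially"
    and "C > 0" and "\<And>n. n \<ge> 1 \<Longrightarrow> vnorm (u n) + vnorm (v n) \<le> C"
    and "liminf (\<lambda>n. ereal (cmod (hinner (v n) (u n)))) > 1"
    and "0 < \<epsilon>"
    and "ereal \<epsilon> < (liminf (\<lambda>n. ereal (cmod (hinner (v n) (u n)))) - 1) / 2"
  shows "((\<lambda>n. measure (M n) {\<omega> \<in> space (M n).
             eigenvalue_count (Y n \<omega>) (outer_spectrum \<epsilon> (Y n \<omega>)) = 1}) \<longlonglongrightarrow> 1)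
    \<and> tendsto_zero_in_prob M (\<lambda>n \<omega>. lambda_max \<epsilon> (Y n \<omega>) - hinner (v n) (u n))"
proof -
  define law where "law = distr P borel \<chi>"
  define h where "h n = hinner (v n) (u n)" for n
  interpret P: prob_space P by fact
  note \<chi> [measurable] = assms(2)
  have law: "prob_space law" "sets law = sets borel"
    unfolding law_def by (auto intro: P.prob_space_distr)
  have li: "integrable law (\<lambda>x. x)" "(\<integral>x. x \<partial>law) = 0"
    "integrable law (\<lambda>x. (cmod x)\<^sup>2)" "(\<integral>x. (cmod x)\<^sup>2 \<partial>law) = 1"
    unfolding law_def using assms(3-6) by (simp_all add: integrable_distr_eq integral_distr)
  have lc: "centered law (\<lambda>x. x)" unfolding centered_def by (intro conjI li(1-3)) simp
  have model: "sparse_iid_model (M n) n (K n) law (A n) (B n)" if "1 \<le> n" for n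
    using assms(8)[OF that] by (simp add: law_def)
  have Kn: "0 < K n" and uv: "u n \<in> carrier_vec n" "v n \<in> carrier_vec n" if "1 \<le> n" for n
    using assms(7,9) that by auto
  have Ye: "Y n \<omega> = mat n n (\<lambda>(i, j). entry (K n) (A n) (B n) (\<lambda>x. x) \<omega> i j + u n $ i * cnj (v n $ j))"
    if "1 \<le> n" for n \<omega>
    unfolding Y by (rule deformed_mat_eq[OF uv[OF that]])
  have he: "h n = (\<Sum>j<n. u n $ j * cnj (v n $ j))" if "1 \<le> n" for n
    unfolding h_def by (rule hinner_sum[OF uv[OF that]])
  define good where "good n \<omega> \<longleftrightarrow> eigenvalue_count (Y n \<omega>) (outer_spectrum \<epsilon> (Y n \<omega>)) = 1" for n \<omega>
  have meas: "{\<omega> \<in> space (M n). good n \<omega>} \<in> sets (M n)" "(\<lambda>\<omega>. lambda_max \<epsilon> (Y n \<omega>)) \<in> borel_measurable (M n)"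
    if n: "1 \<le> n" for n
  proof -
    interpret sparse_iid_model "M n" n "K n" law "A n" "B n" by (rule model[OF n])
    have "(\<lambda>\<omega>. entry (K n) (A n) (B n) (\<lambda>x. x) \<omega> i j + u n $ i * cnj (v n $ j)) \<in> borel_measurable (M n)"
      if "i < n" "j < n" for i j
      using entry_measurable[of "\<lambda>x. x" i j] that by simp
    note * = measurable_eigenvalue_count_lambda_max[OF this assms(15)]
    show "{\<omega> \<in> space (M n). good n \<omega>} \<in> sets (M n)" "(\<lambda>\<omega>. lambda_max \<epsilon> (Y n \<omega>)) \<in> borel_measurable (M n)"
      unfolding good_def Ye[OF n] by (rule *; assumption)+
  qed
  have meas2: "{\<omega> \<in> space (M n). good n \<omega> \<and> cmod (lambda_max \<epsilon> (Y n \<omega>) - h n) \<le> \<eta>} \<in> sets (M n)"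
    if n: "1 \<le> n" for n \<eta>
  proof -
    have [measurable]: "(\<lambda>\<omega>. lambda_max \<epsilon> (Y n \<omega>)) \<in> borel_measurable (M n)" by (rule meas(2)[OF n])
    have "{\<omega> \<in> space (M n). good n \<omega>} \<inter> {\<omega> \<in> space (M n). cmod (lambda_max \<epsilon> (Y n \<omega>) - h n) \<le> \<eta>} \<in> sets (M n)"
      by (intro sets.Int meas(1)[OF n]) measurable
    moreover have "{\<omega> \<in> space (M n). good n \<omega>} \<inter> {\<omega> \<in> space (M n). cmod (lambda_max \<epsilon> (Y n \<omega>) - h n) \<le> \<eta>} =
      {\<omega> \<in> space (M n). good n \<omega> \<and> cmod (lambda_max \<epsilon> (Y n \<omega>) - h n) \<le> \<eta>}" by blast
    ultimately show ?thesis by simp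
  qed
  have hb: "cmod (h n) \<le> C\<^sup>2" "(\<Sum>j<n. (cmod (u n $ j))\<^sup>2) * (\<Sum>j<n. (cmod (cnj (v n $ j)))\<^sup>2) \<le> (C\<^sup>2)\<^sup>2"
    if n: "1 \<le> n" for n
  proof -
    have le: "vnorm (u n) \<le> C" "vnorm (v n) \<le> C"
      using assms(13)[OF n] vnorm_nonneg[of "u n"] vnorm_nonneg[of "v n"] by linarith+
    have m: "vnorm (u n) * vnorm (v n) \<le> C\<^sup>2"
      unfolding power2_eq_square using le vnorm_nonneg assms(12) by (intro mult_mono) auto
    show "cmod (h n) \<le> C\<^sup>2" unfolding h_def using cmod_hinner_le[OF uv[OF n]] m by linarith
    have "(\<Sum>j<n. (cmod (u n $ j))\<^sup>2) * (\<Sum>j<n. (cmod (cnj (v n $ j)))\<^sup>2) = (vnorm (u n) * vnorm (v n))\<^sup>2"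
      by (simp add: power_mult_distrib vnorm_sq[OF uv(1)[OF n]] vnorm_sq[OF uv(2)[OF n]])
    also have "\<dots> \<le> (C\<^sup>2)\<^sup>2" using m vnorm_nonneg by (intro power_mono) auto
    finally show "(\<Sum>j<n. (cmod (u n $ j))\<^sup>2) * (\<Sum>j<n. (cmod (cnj (v n $ j)))\<^sup>2) \<le> (C\<^sup>2)\<^sup>2" .
  qed
  \<comment> \<open>The factor 2 in the condition on \<epsilon> is the margin of the perturbation
    argument: |h n| / (1 + \<epsilon>) then exceeds 1 by more than \<epsilon> / (1 +
    \<epsilon>).\<close>
  have hlarge: "eventually (\<lambda>n. 1 + 2 * \<epsilon> < cmod (h n)) sequentially"
  proof -
    have "ereal (1 + 2 * \<epsilon>) < liminf (\<lambda>n. ereal (cmod (h n)))"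
    proof (cases "liminf (\<lambda>n. ereal (cmod (h n)))")
      case (real l)
      then show ?thesis using assms(16) unfolding h_def[symmetric] by (simp add: one_ereal_def)
    next
      case PInf
      then show ?thesis by simp
    next
      case MInf
      then show ?thesis using assms(14) unfolding h_def[symmetric] by simp
    qed
    then show ?thesis by (auto dest!: less_LiminfD)
  qed
  \<comment> \<open>Zeros are sought up to r0, the quotient by q is controlled up to r, and the
    coefficient series are summed at R < 1. The gap from r0 to r serves Cauchy's estimate, the one
    from r to R the Schwarz lemma.\<close>
  define r0 where "r0 = 1 / (1 + \<epsilon>)"
  define r where "r = (1 + r0) / 2"
  define R where "R = (1 + r) / 2"
  have r0: "0 < r0" "r0 < 1" using assms(15) by (auto simp: r0_def)
  have r: "0 \<le> r" "r < R" "R < 1" "r0 < r" using r0 by (auto simp: r_def R_def)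
  define G where "G = 1 / (1 - R)\<^sup>2"
  have G: "0 < G" using r by (simp add: G_def)
  \<comment> \<open>Both claims follow from this: the bad event joins failure of uniqueness with an
    error above \<eta>.\<close>
  have key: "eventually (\<lambda>n. measure (M n) {\<omega> \<in> space (M n). \<not> (good n \<omega> \<and> cmod (lambda_max \<epsilon> (Y n \<omega>) - h n) \<le> \<eta>)} \<le> p) sequentially"
    if p: "0 < p" and \<eta>: "0 < \<eta>" for p \<eta> :: real
  proof -
    \<comment> \<open>The four bounds serve, in order, 1 / (1 - \<tau>) \<le> 2, the margin beyond 1
      + \<epsilon>, the strict Cauchy condition (as |h n| > 1), and the final error \<tau> |h n| /
      (1 - \<tau>) \<le> \<eta>.\<close>
    define \<tau> where "\<tau> = min (min (1 / 2) (\<epsilon> / (1 + \<epsilon>))) (min ((r - r0) / 4) (\<eta> / (2 * C\<^sup>2)))"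
    have "0 < \<tau>" using assms(12,15) r \<eta> by (auto simp: \<tau>_def)
    moreover have "\<tau> \<le> 1 / 2" "\<tau> \<le> \<epsilon> / (1 + \<epsilon>)" "\<tau> \<le> (r - r0) / 4" "\<tau> \<le> \<eta> / (2 * C\<^sup>2)"
      unfolding \<tau>_def min_le_iff_disj by blast+
    ultimately have \<tau>: "0 < \<tau>" "\<tau> \<le> 1 / 2" "\<tau> \<le> \<epsilon> / (1 + \<epsilon>)" "\<tau> \<le> (r - r0) / 4" "\<tau> \<le> \<eta> / (2 * C\<^sup>2)"
      by blast+
    \<comment> \<open>The four failure probabilities get p / 4 each: G / a and 2 G / b are equal to
      it by choice of a and b.\<close>
    define a where "a = 4 * G / p"
    define b where "b = 8 * G / p"
    have ab: "0 < a" "0 < b" using G p by (auto simp: a_def b_def)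
    obtain m0 where m0: "(a * exp b + 1) * (r / R) ^ Suc m0 \<le> 1 / 2"
    proof -
      have "(\<lambda>m. (a * exp b + 1) * (r / R) ^ Suc m) \<longlonglongrightarrow> (a * exp b + 1) * 0"
        using r by (intro tendsto_intros LIMSEQ_Suc LIMSEQ_power_zero) auto
      then have "eventually (\<lambda>m. (a * exp b + 1) * (r / R) ^ Suc m < 1 / 2) sequentially"
        by (intro order_tendstoD(2)) auto
      then show thesis using that by (auto simp: eventually_sequentially intro: less_imp_le)
    qed
    define \<delta> where "\<delta> = exp (- b) / 4"
    have \<delta>: "0 < \<delta>" by (simp add: \<delta>_def)
    \<comment> \<open>The tolerance is chosen so that sqrt (1 - \<theta>) G / \<delta> \<le> p / 4.
      It may depend on \<delta> because b, and with it \<delta>, does not depend on the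
      truncation.\<close>
    obtain f D \<theta> where f: "f \<in> borel_measurable borel" "\<forall>x. cmod (f x) \<le> D" "(\<integral>x. f x \<partial>law) = 0"
      "(\<integral>x. x * cnj (f x) \<partial>law) = complex_of_real \<theta>" "(\<integral>x. (cmod (f x))\<^sup>2 \<partial>law) \<le> \<theta>"
      "1 - (p * \<delta> / (4 * G))\<^sup>2 \<le> \<theta>" "\<theta> \<le> 1"
      by (rule truncation_exists[OF law li, of "(p * \<delta> / (4 * G))\<^sup>2"]) (use p \<delta> G in auto)
    define d where "d = \<delta> * \<tau>"
    have d: "0 < d" using \<delta> \<tau> by (simp add: d_def)
    have ev1: "eventually (\<lambda>n. \<forall>m\<in>{1..m0}. real (2 * m + 1) * real (2 * m) ^ (2 * m) / n \<le> 2 * (real m)\<^sup>2) sequentially"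
    proof (rule eventually_ball_finite[rule_format], simp)
      fix m assume m: "m \<in> {1..m0}"
      show "eventually (\<lambda>n. real (2 * m + 1) * real (2 * m) ^ (2 * m) / n \<le> 2 * (real m)\<^sup>2) sequentially"
        using eventually_real_ge[of "real (2 * m + 1) * real (2 * m) ^ (2 * m)"] eventually_gt_at_top[of 0]
      proof eventually_elim
        case (elim n)
        have "real (2 * m + 1) * real (2 * m) ^ (2 * m) / n \<le> 1" using elim by (simp add: divide_le_eq)
        also have "1 \<le> 2 * (real m)\<^sup>2"
        proof -
          have "1 \<le> (real m)\<^sup>2" using m by (intro one_le_power) auto
          then show ?thesis by simp
        qed
        finally show ?case .
      qed
    qed
    have ev2: "eventually (\<lambda>n. D\<^sup>2 / real (K n) \<le> 1 / 2) sequentially"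
    proof -
      \<comment> \<open>The summand 1 keeps \<open>K n\<close> positive even if D = 0, so that the
        division can be cleared.\<close>
      have "eventually (\<lambda>n. 2 * D\<^sup>2 + 1 \<le> real (K n)) sequentially"
        using eventually_compose_filterlim[OF eventually_real_ge assms(11)] .
      then show ?thesis
      proof eventually_elim
        case (elim n)
        have "0 < real (K n)" using elim zero_le_power2[of D] by linarith
        then show ?case using elim by (simp add: divide_le_eq)
      qed
    qed
    have ev3: "eventually (\<lambda>n. 2 * C\<^sup>2 / sqrt n * G / d \<le> p / 4) sequentially"
      using eventually_real_ge[of "(8 * C\<^sup>2 * G / (d * p))\<^sup>2"] eventually_gt_at_top[of 0]
    proof eventually_elim
      case (elim n)
      have "8 * C\<^sup>2 * G / (d * p) \<le> sqrt n" using elim(1) by (rule real_le_rsqrt)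
      then show ?case using elim(2) d p by (simp add: field_simps)
    qed
    show ?thesis
      using ev1 ev2 ev3 hlarge eventually_ge_at_top[of 1]
    proof eventually_elim
      case (elim n)
      have n: "1 \<le> n" by (rule elim(5))
      interpret sparse_iid_model "M n" n "K n" law "A n" "B n" by (rule model[OF n])
      let ?V = "(\<Sum>j<n. (cmod (u n $ j))\<^sup>2) * (\<Sum>j<n. (cmod (cnj (v n $ j)))\<^sup>2)"
      let ?S = "{\<omega> \<in> space (M n). good n \<omega> \<and> cmod (lambda_max \<epsilon> (Y n \<omega>) - h n) \<le> \<eta>}"
      have n0: "0 < n" using n by simp
      have fb: "cmod (f x) \<le> D" for x using f(2) by blast
      have e1: "real (2 * m + 1) * real (2 * m) ^ (2 * m) / n \<le> 2 * (real m)\<^sup>2" if "m \<in> {1..m0}" for m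
        using elim(1) that by blast
      obtain E where E: "E \<in> sets (M n)"
        "1 - (G / a + 2 * G / b + sqrt (1 - \<theta>) * G / (exp (- b) / 4) + 2 * sqrt ?V / sqrt n * G / d) \<le> prob E"
        "\<And>\<omega> z. \<omega> \<in> E \<Longrightarrow> cmod z \<le> r \<Longrightarrow> exp (- b) / 4 \<le> cmod (rev_char (entry (K n) (A n) (B n) (\<lambda>x. x) \<omega>) n z)"
        "\<And>\<omega> z. \<omega> \<in> E \<Longrightarrow> cmod z \<le> r \<Longrightarrow>
          cmod (\<Sum>m\<le>n. (- z) ^ Suc m * (off_sum (entry (K n) (A n) (B n) (\<lambda>x. x) \<omega>) (\<lambda>j. u n $ j) (\<lambda>j. cnj (v n $ j)) n m
            - diag_sum (entry (K n) (A n) (B n) (\<lambda>x. x) \<omega>) (\<lambda>j. u n $ j) (\<lambda>j. cnj (v n $ j)) n m)) \<le> d"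
        using good_event[OF Kn[OF n] n0 law lc li(4) f(1) fb f(3-5,7) elim(2) r(1-3) m0 e1 ab d,
            of "\<lambda>j. u n $ j" "\<lambda>j. cnj (v n $ j)"] unfolding G_def by blast
      have "E \<subseteq> ?S"
      proof
        fix \<omega> assume \<omega>: "\<omega> \<in> E"
        have hs: "cmod (h n) \<le> C\<^sup>2" "1 + 2 * \<epsilon> < cmod (h n)" using hb(1)[OF n] elim(4) by auto
        have t1: "\<tau> < 1" using \<tau> by simp
        have t2: "1 + \<tau> \<le> cmod (\<Sum>j<n. u n $ j * cnj (v n $ j)) / (1 + \<epsilon>)"
        proof -
          have "(1 + \<tau>) * (1 + \<epsilon>) \<le> 1 + 2 * \<epsilon>" using \<tau>(3) assms(15) by (simp add: field_simps)
          then show ?thesis using hs(2) assms(15) unfolding he[OF n] by (simp add: pos_le_divide_eq)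
        qed
        have t3: "\<tau> < cmod (\<Sum>j<n. u n $ j * cnj (v n $ j)) * ((r - 1 / (1 + \<epsilon>)) / 2)"
        proof -
          have "\<tau> < 1 * ((r - r0) / 2)" using \<tau>(4) r(4) by simp
          also have "\<dots> \<le> cmod (h n) * ((r - r0) / 2)"
            using hs(2) assms(15) r(4) by (intro mult_right_mono) auto
          finally show ?thesis unfolding he[OF n] r0_def .
        qed
        have r': "1 / (1 + \<epsilon>) < r" using r(4) by (simp add: r0_def)
        note O = outlier_unique[OF Ye[OF n, of \<omega>] assms(15) r' E(3)[OF \<omega>] \<delta>[unfolded \<delta>_def]
            E(4)[OF \<omega>, unfolded d_def \<delta>_def] t1 t2 t3]
        have g: "good n \<omega>" unfolding good_def by (rule O(1))
        have "cmod (lambda_max \<epsilon> (Y n \<omega>) - h n) \<le> \<tau> * cmod (h n) / (1 - \<tau>)"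
          unfolding he[OF n] by (rule O(2))
        also have "\<dots> \<le> \<tau> * C\<^sup>2 / (1 / 2)"
          using \<tau> hs(1) by (intro frac_le mult_mono) auto
        also have "\<dots> \<le> \<eta>" using \<tau>(5) assms(12) by (simp add: field_simps)
        finally show "\<omega> \<in> ?S" using g sets.sets_into_space[OF E(1)] \<omega> by auto
      qed
      have Sm: "?S \<in> sets (M n)" by (rule meas2[OF n])
      have sq: "sqrt (1 - \<theta>) * G / \<delta> \<le> p / 4"
      proof -
        have "sqrt (1 - \<theta>) \<le> p * \<delta> / (4 * G)"
          using f(6) p \<delta> G by (intro real_le_lsqrt) auto
        then show ?thesis using \<delta> G by (simp add: field_simps)
      qed
      have sv: "2 * sqrt ?V / sqrt n * G / d \<le> p / 4"
      proof -
        have "sqrt ?V \<le> C\<^sup>2" using hb(2)[OF n] by (intro real_le_lsqrt) auto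
        then have "2 * sqrt ?V / sqrt n * G / d \<le> 2 * C\<^sup>2 / sqrt n * G / d"
          using G d by (intro divide_right_mono mult_right_mono mult_left_mono) auto
        then show ?thesis using elim(3) by linarith
      qed
      have "G / a = p / 4" "2 * G / b = p / 4" using G p by (auto simp: a_def b_def)
      with sq sv E(2) have "1 - p \<le> prob E" unfolding \<delta>_def by linarith
      also have "prob E \<le> prob ?S" by (rule finite_measure_mono[OF \<open>E \<subseteq> ?S\<close> Sm])
      finally have "1 - p \<le> prob ?S" .
      moreover have "{\<omega> \<in> space (M n). \<not> (good n \<omega> \<and> cmod (lambda_max \<epsilon> (Y n \<omega>) - h n) \<le> \<eta>)} = space (M n) - ?S" by blast
      ultimately show ?case using prob_compl[OF Sm] by simp
    qed
  qed
  have prob: "prob_space (M n)" if "1 \<le> n" for n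
    using model[OF that] by (simp add: sparse_iid_model_def)
  have bad_sets: "{\<omega> \<in> space (M n). \<not> (good n \<omega> \<and> cmod (lambda_max \<epsilon> (Y n \<omega>) - h n) \<le> \<eta>)} \<in> sets (M n)"
    if "1 \<le> n" for n \<eta>
  proof -
    have "{\<omega> \<in> space (M n). \<not> (good n \<omega> \<and> cmod (lambda_max \<epsilon> (Y n \<omega>) - h n) \<le> \<eta>)} =
      space (M n) - {\<omega> \<in> space (M n). good n \<omega> \<and> cmod (lambda_max \<epsilon> (Y n \<omega>) - h n) \<le> \<eta>}" by blast
    then show ?thesis using meas2[OF that, of \<eta>] by simp
  qed
  have "(\<lambda>n. measure (M n) {\<omega> \<in> space (M n). good n \<omega>}) \<longlonglongrightarrow> 1"
  proof (rule tendstoI)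
    fix e :: real assume e: "0 < e"
    \<comment> \<open>For uniqueness alone the accuracy is irrelevant; 1 is an arbitrary
      choice.\<close>
    have "0 < e / 2" "(0::real) < 1" using e by auto
    from key[OF this] eventually_ge_at_top[of 1]
    show "eventually (\<lambda>n. dist (measure (M n) {\<omega> \<in> space (M n). good n \<omega>}) 1 < e) sequentially"
    proof eventually_elim
      case (elim n)
      interpret prob_space "M n" by (rule prob[OF elim(2)])
      have "space (M n) - {\<omega> \<in> space (M n). good n \<omega>} \<subseteq>
        {\<omega> \<in> space (M n). \<not> (good n \<omega> \<and> cmod (lambda_max \<epsilon> (Y n \<omega>) - h n) \<le> 1)}" by blast
      then have "prob (space (M n) - {\<omega> \<in> space (M n). good n \<omega>}) \<le> e / 2"
        using finite_measure_mono[OF _ bad_sets[OF elim(2), of 1]] elim(1) by (meson order_trans)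
      then have "1 - e / 2 \<le> prob {\<omega> \<in> space (M n). good n \<omega>}"
        unfolding prob_compl[OF meas(1)[OF elim(2)]] by simp
      moreover have "prob {\<omega> \<in> space (M n). good n \<omega>} \<le> 1" by (rule prob_le_1)
      ultimately show ?case using e by (simp add: dist_real_def)
    qed
  qed
  moreover have "tendsto_zero_in_prob M (\<lambda>n \<omega>. lambda_max \<epsilon> (Y n \<omega>) - h n)"
    unfolding tendsto_zero_in_prob_def
  proof (intro conjI allI impI)
    fix n :: nat assume "1 \<le> n"
    then show "(\<lambda>\<omega>. lambda_max \<epsilon> (Y n \<omega>) - h n) \<in> borel_measurable (M n)"
      by (intro borel_measurable_diff meas(2)) auto
  next
    fix \<eta> :: real assume \<eta>: "0 < \<eta>"
    show "(\<lambda>n. measure (M n) {\<omega> \<in> space (M n). \<eta> < cmod (lambda_max \<epsilon> (Y n \<omega>) - h n)}) \<longlonglongrightarrow> 0"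
    proof (rule tendstoI)
      fix e :: real assume e: "0 < e"
      have "0 < e / 2" using e by simp
      from key[OF this \<eta>] eventually_ge_at_top[of 1]
      show "eventually (\<lambda>n. dist (measure (M n) {\<omega> \<in> space (M n). \<eta> < cmod (lambda_max \<epsilon> (Y n \<omega>) - h n)}) 0 < e) sequentially"
      proof eventually_elim
        case (elim n)
        interpret prob_space "M n" by (rule prob[OF elim(2)])
        have "{\<omega> \<in> space (M n). \<eta> < cmod (lambda_max \<epsilon> (Y n \<omega>) - h n)} \<subseteq>
          {\<omega> \<in> space (M n). \<not> (good n \<omega> \<and> cmod (lambda_max \<epsilon> (Y n \<omega>) - h n) \<le> \<eta>)}" by auto
        from finite_measure_mono[OF this bad_sets[OF elim(2)]] elim(1) e
        show ?case by (simp add: dist_real_def)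
      qed
    qed
  qed
  ultimately show ?thesis unfolding good_def h_def by blast
qed

end
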